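(* Let $\alpha\in(0,2]$ and let $\mathbf{S}(n)=\sum_{i=1}^n\mathbf{Y}_i$, $\mathbf{S}(0)=0$, be a random walk in $\mathbb{R}^d$ with i.i.d. steps such that $$\frac{\mathbf{S}(n)-\mathbf{a}_n}{b_n}\xrightarrow[n\to\infty]{\mathcal{D}}\mathbf{X}(1),$$ where $\{\mathbf{X}(t)\}_{t\ge0}$ is an $\alpha$-stable Lévy process in $\mathbb{R}^d$ and $\mathbf{a}_n\in\mathbb{R}^d$, $b_n>0$ are the normalizing sequences specified in the context. Then $$\frac{\mathrm{conv}\{\mathbf{S}(0)-\mathbf{a}_0,\ldots,\mathbf{S}(n)-\mathbf{a}_n\}}{b_n}\;\Longrightarrow\;\mathrm{conv}\,\mathbf{X}[0,1]\qquad (n\to\infty)$$ in the sense of weak convergence in $(\mathcal{K}^d_0,\mathrm{dist}_{\mathcal{H}})$. Moreover, for every $m\in\{1,\ldots,d\}$, $$\frac{V_m\bigl(\mathrm{conv}\{\mathbf{S}(0)-\mathbf{a}_0,\ldots,\mathbf{S}(n)-\mathbf{a}_n\}\bigr)}{b_n^m}\xrightarrow[n\to\infty]{\mathcal{D}}V_m\bigl(\mathrm{conv}\,\mathbf{X}[0,1]\bigr)$$ and $$\frac{\mathsf{p}\bigl(\mathrm{conv}\{\mathbf{S}(0)-\mathbf{a}_0,\ldots,\mathbf{S}(n)-\mathbf{a}_n\}\bigr)}{b_n}\xrightarrow[n\to\infty]{\mathcal{D}}\mathsf{p}\bigl(\mathrm{conv}\,\mathbf{X}[0,1]\bigr).$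$
   Context: $\mathcal{K}^d_0$ is the set of convex bodies (compact convex subsets) of $\mathbb{R}^d$ containing $0$, with Hausdorff metric $\mathrm{dist}_{\mathcal{H}}$. $\mathrm{conv}$ is the convex hull and $\mathbf{X}[0,1]=\mathrm{cl}\{\mathbf{X}(t):t\in[0,1]\}$ is the closure of the range of a càdlàg path up to time one. $\xrightarrow{\mathcal{D}}$ is convergence in distribution. Normalization: writing $\mathbf{a}_n=(a_n^{(1)},\dots,a_n^{(d)})$, $\mathbf{Y}_1=(Y_1^{(1)},\dots,Y_1^{(d)})$, the centering is $a_n^{(k)}=0$ if $\alpha<1$, $a_n^{(k)}=n b_n\mathbb{E}[\sin(Y_1^{(k)}/b_n)]$ if $\alpha=1$, and $a_n^{(k)}=n\,\mathbb{E}[Y_1^{(k)}]$ if $\alpha>1$ (so $\mathbf{a}_0=0$); $b_n=n^{1/\alpha}\ell(n)$ with $\ell$ slowly varying at infinity. Intrinsic volumes $V_0(A),\dots,V_d(A)$ of a convex body $A$ are defined by the Steiner formula $\mathrm{Vol}_d(A+\rho B^d)=\sum_{m=0}^d\rho^{d-m}\kappa_{d-m}V_m(A)$, $\rho\ge0$, where $B^d$ is the closed unit ball and $\kappa_d=\mathrm{Vol}_d(B^d)$. The Steiner point is $\mathsf{p}(A)=\frac1{\kappa_d}\int_{\mathbb{S}^{d-1}}s_A(\theta)\,\theta\,\sigma(\mathrm{d}\theta)$, with $s_A(x)=\sup_{y\in A}\langle x,y\rangle$ the support function and $\sigma$ the surface measure on the unit sphere $\mathbb{S}^{d-1}$.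
   Formalization: "α-stable Lévy process" is taken as self-similar (strictly stable), which is automatic for α≠1; for α=1 non-strictly stable limits are excluded, since there the claim fails: with P(Y>y)=1/y, b_n=n, the centred path tends to X(t)−t log t, not X(t). *)

theory Defs
  imports "HOL-Probability.Probability"
begin

section \<open>Convergence in distribution\<close>

definition borel_of :: "'a topology \<Rightarrow> 'a measure" where
  "borel_of T = sigma (topspace T) {U. openin T U}"

lemma borel_of_euclidean: "borel_of (euclidean :: 'a::topological_space topology) = borel"
  by (simp add: borel_of_def borel_def)

text \<open>
  The random elements \<open>Z n\<close> and \<open>Z'\<close> may live on different probability spaces. That they are
  random elements of \<open>T\<close>, i.e. Borel measurable, is part of the notion. (The library's
  \<open>weak_conv_m\<close> only covers real-valued random variables.)
\<close>
definition converges_in_distribution ::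
  "'a topology \<Rightarrow> 'w measure \<Rightarrow> (nat \<Rightarrow> 'w \<Rightarrow> 'a) \<Rightarrow> 'v measure \<Rightarrow> ('v \<Rightarrow> 'a) \<Rightarrow> bool" where
  "converges_in_distribution T M Z N Z' \<longleftrightarrow>
     (\<forall>n. Z n \<in> M \<rightarrow>\<^sub>M borel_of T) \<and> Z' \<in> N \<rightarrow>\<^sub>M borel_of T \<and>
     (\<forall>f. continuous_map T euclideanreal f \<and> bounded (f ` topspace T) \<longrightarrow>
        (\<lambda>n. \<integral>\<omega>. f (Z n \<omega>) \<partial>M) \<longlonglongrightarrow> (\<integral>\<omega>. f (Z' \<omega>) \<partial>N))"

lemma converges_in_distribution_real_iff_weak_conv_m:
  fixes Z :: "nat \<Rightarrow> 'w \<Rightarrow> real" and Z' :: "'v \<Rightarrow> real"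
  assumes "prob_space M" "prob_space N"
    and Z: "\<And>n. Z n \<in> borel_measurable M" and Z': "Z' \<in> borel_measurable N"
  shows "converges_in_distribution euclidean M Z N Z' \<longleftrightarrow>
    weak_conv_m (\<lambda>n. distr M borel (Z n)) (distr N borel Z')"
proof -
  have rd: "real_distribution (distr M borel (Z n))" for n
    by (simp add: real_distribution_def real_distribution_axioms_def Z
        prob_space.prob_space_distr[OF assms(1)])
  have rd': "real_distribution (distr N borel Z')"
    by (simp add: real_distribution_def real_distribution_axioms_def Z'
        prob_space.prob_space_distr[OF assms(2)])
  have I: "(\<integral>x. f x \<partial>distr M borel (Z n)) = (\<integral>\<omega>. f (Z n \<omega>) \<partial>M)"
    if "continuous_on UNIV f" for f :: "real \<Rightarrow> real" and n
    using that by (intro integral_distr Z) (auto intro: borel_measurable_continuous_onI)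
  have I': "(\<integral>x. f x \<partial>distr N borel Z') = (\<integral>\<omega>. f (Z' \<omega>) \<partial>N)"
    if "continuous_on UNIV f" for f :: "real \<Rightarrow> real"
    using that by (intro integral_distr Z') (auto intro: borel_measurable_continuous_onI)
  show ?thesis
  proof
    assume L: "converges_in_distribution euclidean M Z N Z'"
    show "weak_conv_m (\<lambda>n. distr M borel (Z n)) (distr N borel Z')"
    proof (rule integral_bdd_continuous_conv_imp_weak_conv[OF rd rd'])
      fix f :: "real \<Rightarrow> real"
      assume c: "\<And>x. isCont f x" and b: "\<And>x. \<bar>f x\<bar> \<le> 1"
      have c': "continuous_on UNIV f" using c by (simp add: continuous_at_imp_continuous_on)
      have "bounded (range f)" using b by (auto intro!: boundedI[of _ 1])
      with L c' show "(\<lambda>n. integral\<^sup>L (distr M borel (Z n)) f) \<longlonglongrightarrow> integral\<^sup>L (distr N borel Z') f"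
        by (simp add: converges_in_distribution_def I I')
    qed
  next
    assume R: "weak_conv_m (\<lambda>n. distr M borel (Z n)) (distr N borel Z')"
    have "(\<lambda>n. \<integral>\<omega>. f (Z n \<omega>) \<partial>M) \<longlonglongrightarrow> (\<integral>\<omega>. f (Z' \<omega>) \<partial>N)"
      if c: "continuous_on UNIV f" and b: "bounded (range f)" for f :: "real \<Rightarrow> real"
    proof -
      obtain B where B: "\<And>x. \<bar>f x\<bar> \<le> B" using b by (auto simp: bounded_iff)
      have "isCont f x" for x using c by (simp add: continuous_on_eq_continuous_at)
      then show ?thesis
        using weak_conv_imp_integral_bdd_continuous_conv[OF rd rd' R, of f B] B
        by (simp add: I[OF c] I'[OF c])
    qed
    then show "converges_in_distribution euclidean M Z N Z'"
      by (simp add: converges_in_distribution_def borel_of_euclidean Z Z')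
  qed
qed


section \<open>Convex bodies containing the origin\<close>

definition convex_bodies0 :: "'a::euclidean_space set set" where
  "convex_bodies0 = {A. compact A \<and> convex A \<and> 0 \<in> A}"

text \<open>The value \<open>0\<close> outside nonempty compact sets is junk; it makes the function total and nonnegative,
  as the locale \<open>Metric_space\<close> requires.\<close>
definition hausdorff_dist :: "'a::euclidean_space set \<Rightarrow> 'a set \<Rightarrow> real" where
  "hausdorff_dist A B =
     (if compact A \<and> A \<noteq> {} \<and> compact B \<and> B \<noteq> {}
      then max (SUP a\<in>A. infdist a B) (SUP b\<in>B. infdist b A) else 0)"

lemma infdist_le_hausdorff_dist:
  fixes A B :: "'a::euclidean_space set"
  assumes "compact A" "compact B" "B \<noteq> {}" "a \<in> A"
  shows "infdist a B \<le> hausdorff_dist A B"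
proof -
  have "bdd_above ((\<lambda>a. infdist a B) ` A)"
    using assms(1)
    by (intro bounded_imp_bdd_above compact_imp_bounded compact_continuous_image)
       (auto intro!: continuous_intros)
  then have "infdist a B \<le> (SUP a\<in>A. infdist a B)" using assms(4) by (intro cSUP_upper)
  then show ?thesis using assms by (auto simp: hausdorff_dist_def)
qed

lemma hausdorff_dist_commute: "hausdorff_dist A B = hausdorff_dist B A"
  by (simp add: hausdorff_dist_def max.commute conj_ac)

lemma hausdorff_dist_le:
  fixes A B :: "'a::euclidean_space set"
  assumes "compact A" "A \<noteq> {}" "compact B" "B \<noteq> {}"
    and "\<And>a. a \<in> A \<Longrightarrow> infdist a B \<le> e" "\<And>b. b \<in> B \<Longrightarrow> infdist b A \<le> e"
  shows "hausdorff_dist A B \<le> e"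
  unfolding hausdorff_dist_def using assms by (auto intro!: cSUP_least)

lemma infdist_le_hausdorff_dist_trans:
  fixes A B C :: "'a::euclidean_space set"
  assumes "compact A" "compact B" "B \<noteq> {}" "compact C" "C \<noteq> {}" "a \<in> A"
  shows "infdist a C \<le> hausdorff_dist A B + hausdorff_dist B C"
proof -
  obtain b where b: "b \<in> B" "infdist a B = dist a b"
    using infdist_attains_inf[of B a] assms compact_imp_closed by blast
  have "infdist a C \<le> infdist b C + dist a b" by (rule infdist_triangle)
  then show ?thesis
    using infdist_le_hausdorff_dist[of A B a] infdist_le_hausdorff_dist[of B C b] b assms
    by auto
qed

lemma hausdorff_dist_nonneg: "0 \<le> hausdorff_dist A B"
proof (cases "compact A \<and> A \<noteq> {} \<and> compact B \<and> B \<noteq> {}")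
  case True
  then obtain a where "a \<in> A" by blast
  then have "infdist a B \<le> hausdorff_dist A B" using True by (intro infdist_le_hausdorff_dist) auto
  then show ?thesis using infdist_nonneg[of a B] by linarith
qed (auto simp: hausdorff_dist_def)

lemma Metric_space_convex_bodies0: "Metric_space convex_bodies0 hausdorff_dist"
proof
  fix A B C :: "'a set"
  show "0 \<le> hausdorff_dist A B" by (rule hausdorff_dist_nonneg)
  show "hausdorff_dist A B = hausdorff_dist B A" by (rule hausdorff_dist_commute)
  have sub: "A \<subseteq> B" if "compact A" "compact B" "B \<noteq> {}" "hausdorff_dist A B = 0" for A B :: "'a set"
  proof
    fix a assume "a \<in> A"
    then have "infdist a B = 0"
      using infdist_le_hausdorff_dist[OF that(1-3) \<open>a \<in> A\<close>] infdist_nonneg[of a B] that(4) by linarith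
    then show "a \<in> B" using that by (simp add: in_closed_iff_infdist_zero compact_imp_closed)
  qed
  have ne: "compact D" "D \<noteq> {}" if "D \<in> convex_bodies0" for D :: "'a set"
    using that by (auto simp: convex_bodies0_def)
  show "hausdorff_dist A B = 0 \<longleftrightarrow> A = B" if A: "A \<in> convex_bodies0" and B: "B \<in> convex_bodies0"
  proof
    assume "hausdorff_dist A B = 0"
    then show "A = B"
      using sub[of A B] sub[of B A] ne[OF A] ne[OF B] hausdorff_dist_commute[of A B] by auto
  next
    assume "A = B"
    then have "hausdorff_dist A B \<le> 0" using ne[OF A] by (intro hausdorff_dist_le) auto
    then show "hausdorff_dist A B = 0" using hausdorff_dist_nonneg[of A B] by linarith
  qed
  show "hausdorff_dist A C \<le> hausdorff_dist A B + hausdorff_dist B C"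
    if A: "A \<in> convex_bodies0" and B: "B \<in> convex_bodies0" and C: "C \<in> convex_bodies0"
    using infdist_le_hausdorff_dist_trans[of A B C] infdist_le_hausdorff_dist_trans[of C B A]
      ne[OF A] ne[OF B] ne[OF C]
    by (intro hausdorff_dist_le)
       (auto simp: hausdorff_dist_commute[of C B] hausdorff_dist_commute[of B A] add.commute)
qed

abbreviation hausdorff_topology :: "'a::euclidean_space set topology" where
  "hausdorff_topology \<equiv> Metric_space.mtopology convex_bodies0 hausdorff_dist"


section \<open>Intrinsic volumes and the Steiner point\<close>

text \<open>
  The intrinsic volumes are the coefficients in the Steiner formula. \<open>unit_ball_vol (real j)\<close> is the
  volume of the closed unit ball of the \<open>j\<close>-dimensional Euclidean space.
\<close>
definition steiner_formula :: "'a::euclidean_space set \<Rightarrow> (nat \<Rightarrow> real) \<Rightarrow> bool" where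
  "steiner_formula A V \<longleftrightarrow>
     (\<forall>\<rho>\<ge>0. measure lborel {x + \<rho> *\<^sub>R y |x y. x \<in> A \<and> y \<in> cball 0 1} =
        (\<Sum>m\<le>DIM('a). \<rho> ^ (DIM('a) - m) * unit_ball_vol (real (DIM('a) - m)) * V m))"

definition intrinsic_volume :: "nat \<Rightarrow> 'a::euclidean_space set \<Rightarrow> real" where
  "intrinsic_volume m A = (THE V. steiner_formula A V \<and> (\<forall>j>DIM('a). V j = 0)) m"

lemma steiner_formula_unique:
  fixes A :: "'a::euclidean_space set"
  assumes V: "steiner_formula A V" and W: "steiner_formula A W" and m: "m \<le> DIM('a)"
  shows "V m = W m"
proof -
  let ?d = "DIM('a)"
  define c where "c i = unit_ball_vol (real i) * (V (?d - i) - W (?d - i))" for i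
  have S: "(\<Sum>i\<le>?d. c i * \<rho> ^ i) = 0" if "\<rho> \<ge> 0" for \<rho> :: real
  proof -
    have "(\<Sum>i\<le>?d. c i * \<rho> ^ i) = (\<Sum>m\<le>?d. c (?d - m) * \<rho> ^ (?d - m))"
      by (rule sum.reindex_bij_witness[of _ "\<lambda>i. ?d - i" "\<lambda>i. ?d - i"]) auto
    also have "\<dots> = (\<Sum>m\<le>?d. \<rho> ^ (?d - m) * unit_ball_vol (real (?d - m)) * V m)
        - (\<Sum>m\<le>?d. \<rho> ^ (?d - m) * unit_ball_vol (real (?d - m)) * W m)"
      by (subst sum_subtractf[symmetric]) (auto simp: c_def algebra_simps intro!: sum.cong)
    also have "\<dots> = 0" using V W that by (simp add: steiner_formula_def)
    finally show ?thesis .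
  qed
  have "c (?d - m) = 0"
  proof (rule ccontr)
    assume nz: "c (?d - m) \<noteq> 0"
    have "finite {z. (\<Sum>i\<le>?d. c i * z ^ i) = 0}"
      using polyfun_finite_roots[of c ?d] nz by (meson diff_le_self)
    moreover have "{0..} \<subseteq> {z. (\<Sum>i\<le>?d. c i * z ^ i) = 0}" using S by auto
    ultimately have "finite {0::real..}" by (rule rev_finite_subset)
    then show False by (simp add: infinite_Ici)
  qed
  then have "unit_ball_vol (real (?d - m)) * (V m - W m) = 0" using m by (simp add: c_def)
  moreover have "unit_ball_vol (real (?d - m)) > 0" by (rule unit_ball_vol_pos) (rule of_nat_0_le_iff)
  ultimately show ?thesis by (simp only: mult_eq_0_iff) auto
qed

lemma intrinsic_volume_eqI:
  fixes A :: "'a::euclidean_space set"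
  assumes V: "steiner_formula A V" and m: "m \<le> DIM('a)"
  shows "intrinsic_volume m A = V m"
proof -
  define W where "W j = (if j \<le> DIM('a) then V j else 0)" for j
  have W: "steiner_formula A W" using V by (simp add: steiner_formula_def W_def)
  have "(THE V. steiner_formula A V \<and> (\<forall>j>DIM('a). V j = 0)) = W"
  proof (rule the_equality)
    show "steiner_formula A W \<and> (\<forall>j>DIM('a). W j = 0)" using W by (simp add: W_def)
    fix U assume "steiner_formula A U \<and> (\<forall>j>DIM('a). U j = 0)"
    then show "U = W"
      using steiner_formula_unique[of A U W] W by (auto simp: fun_eq_iff W_def not_le)
  qed
  then show ?thesis using m by (simp add: intrinsic_volume_def W_def)
qed

text \<open>
  The surface measure on the unit sphere, as in polar coordinates:
  \<open>\<sigma>(E) = d \<cdot> Vol {r\<theta> | \<theta> \<in> E, 0 < r \<le> 1}\<close>. Here \<open>sgn x = x / norm x\<close>.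
\<close>
definition sphere_measure :: "'a::euclidean_space measure" where
  "sphere_measure =
     scale_measure (of_nat DIM('a))
       (distr (restrict_space lborel (cball 0 1 - {0})) (restrict_space borel (sphere 0 1)) sgn)"

lemma measurable_sgn_sphere:
  "sgn \<in> restrict_space lborel (cball 0 1 - {0 :: 'a::euclidean_space}) \<rightarrow>\<^sub>M restrict_space borel (sphere 0 1)"
proof (rule measurable_restrict_space2)
  have "(\<lambda>x::'a. x /\<^sub>R norm x) \<in> borel_measurable borel" by measurable
  then have "(sgn :: 'a \<Rightarrow> 'a) \<in> borel_measurable borel" by (simp add: sgn_div_norm[abs_def])
  then show "sgn \<in> restrict_space lborel (cball 0 1 - {0 :: 'a}) \<rightarrow>\<^sub>M borel"
    by (intro measurable_restrict_space1) simp
  show "sgn \<in> space (restrict_space lborel (cball 0 1 - {0 :: 'a})) \<rightarrow> sphere 0 1"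
    by (auto simp: space_restrict_space norm_sgn)
qed

lemma emeasure_sphere_measure_sphere:
  "emeasure sphere_measure (sphere 0 1 :: 'a::euclidean_space set) =
     of_nat DIM('a) * ennreal (unit_ball_vol (real DIM('a)))"
proof -
  have "emeasure (distr (restrict_space lborel (cball 0 1 - {0 :: 'a})) (restrict_space borel (sphere 0 1)) sgn)
      (sphere 0 1) = emeasure (restrict_space lborel (cball 0 1 - {0 :: 'a})) (cball 0 1 - {0})"
    by (subst emeasure_distr[OF measurable_sgn_sphere])
       (auto simp: space_restrict_space norm_sgn sets_restrict_space intro!: arg_cong2[where f = emeasure])
  also have "\<dots> = emeasure lborel (cball 0 1 - {0 :: 'a})"
    by (subst emeasure_restrict_space) auto
  also have "\<dots> = emeasure lborel (cball (0 :: 'a) 1)"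
    by (subst emeasure_Diff) auto
  also have "\<dots> = ennreal (unit_ball_vol (real DIM('a)))"
    by (subst emeasure_cball) auto
  finally show ?thesis by (simp add: sphere_measure_def)
qed

definition support_function :: "'a::euclidean_space set \<Rightarrow> 'a \<Rightarrow> real" where
  "support_function A x = (SUP y\<in>A. x \<bullet> y)"

definition steiner_point :: "'a::euclidean_space set \<Rightarrow> 'a" where
  "steiner_point A =
     (1 / unit_ball_vol (real DIM('a))) *\<^sub>R (\<integral>\<theta>. support_function A \<theta> *\<^sub>R \<theta> \<partial>sphere_measure)"


section \<open>Stable processes\<close>

definition cadlag :: "(real \<Rightarrow> 'a::topological_space) \<Rightarrow> bool" where
  "cadlag f \<longleftrightarrow>
     (\<forall>t\<ge>0. (f \<longlongrightarrow> f t) (at_right t)) \<and> (\<forall>t>0. \<exists>l. (f \<longlongrightarrow> l) (at_left t))"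

text \<open>
  Time is \<open>{0..}\<close>; values \<open>X t\<close> with \<open>t < 0\<close> are irrelevant. All paths are cadlag and start at \<open>0\<close>,
  so stochastic continuity follows from stationarity of the increments.
\<close>
definition levy_process :: "'v measure \<Rightarrow> (real \<Rightarrow> 'v \<Rightarrow> 'a::euclidean_space) \<Rightarrow> bool" where
  "levy_process N X \<longleftrightarrow>
     prob_space N \<and>
     (\<forall>t\<ge>0. X t \<in> borel_measurable N) \<and>
     (\<forall>\<omega>\<in>space N. X 0 \<omega> = 0 \<and> cadlag (\<lambda>t. X t \<omega>)) \<and>
     (\<forall>(t :: nat \<Rightarrow> real) n. 0 \<le> t 0 \<and> mono t \<longrightarrow>
        prob_space.indep_vars N (\<lambda>_. borel) (\<lambda>i \<omega>. X (t (Suc i)) \<omega> - X (t i) \<omega>) {..<n}) \<and>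
     (\<forall>s\<ge>0. \<forall>t\<ge>0. distr N borel (\<lambda>\<omega>. X (s + t) \<omega> - X s \<omega>) = distr N borel (X t))"

text \<open>
  Stability is self-similarity: \<open>(X(ct))\<close> and \<open>(c powr (1/\<alpha>) X(t))\<close>, \<open>t \<ge> 0\<close>, have the same law
  (equivalently, the same finite-dimensional distributions) for every \<open>c > 0\<close>. For \<open>\<alpha> \<noteq> 1\<close> a limit
  under the centering below is automatically of this kind; for \<open>\<alpha> = 1\<close> skewed laws with
  \<open>X(ct) = c X(t) + \<gamma> t c log c\<close> in law, \<open>\<gamma> \<noteq> 0\<close>, are not stable in this sense.
\<close>
definition stable_levy_process :: "'v measure \<Rightarrow> real \<Rightarrow> (real \<Rightarrow> 'v \<Rightarrow> 'a::euclidean_space) \<Rightarrow> bool" where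
  "stable_levy_process N \<alpha> X \<longleftrightarrow>
     levy_process N X \<and>
     (\<forall>c>0. distr N (\<Pi>\<^sub>M t\<in>{0..}. borel) (\<lambda>\<omega>. \<lambda>t\<in>{0..}. X (c * t) \<omega>) =
            distr N (\<Pi>\<^sub>M t\<in>{0..}. borel) (\<lambda>\<omega>. \<lambda>t\<in>{0..}. (c powr (1 / \<alpha>)) *\<^sub>R X t \<omega>))"

definition path_hull :: "(real \<Rightarrow> 'v \<Rightarrow> 'a::euclidean_space) \<Rightarrow> 'v \<Rightarrow> 'a set" where
  "path_hull X \<omega> = convex hull (closure ((\<lambda>t. X t \<omega>) ` {0..1}))"


section \<open>Random walks and their normalization\<close>

definition slowly_varying :: "(real \<Rightarrow> real) \<Rightarrow> bool" where
  "slowly_varying l \<longleftrightarrow>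
     (\<exists>x0. l \<in> borel_measurable (restrict_space borel {x0..}) \<and> (\<forall>x\<ge>x0. 0 < l x)) \<and>
     (\<forall>c>0. ((\<lambda>x. l (c * x) / l x) \<longlongrightarrow> 1) at_top)"

definition walk :: "(nat \<Rightarrow> 'w \<Rightarrow> 'a::euclidean_space) \<Rightarrow> nat \<Rightarrow> 'w \<Rightarrow> 'a" where
  "walk Y n \<omega> = (\<Sum>i=1..n. Y i \<omega>)"

definition centering ::
  "'w measure \<Rightarrow> real \<Rightarrow> (nat \<Rightarrow> real) \<Rightarrow> ('w \<Rightarrow> real ^ 'd) \<Rightarrow> nat \<Rightarrow> real ^ 'd" where
  "centering M \<alpha> b Y1 n = (\<chi> k.
     if \<alpha> < 1 then 0
     else if \<alpha> = 1 then real n * b n * (\<integral>\<omega>. sin (Y1 \<omega> $ k / b n) \<partial>M)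
     else real n * (\<integral>\<omega>. Y1 \<omega> $ k \<partial>M))"

definition walk_hull ::
  "'w measure \<Rightarrow> real \<Rightarrow> (nat \<Rightarrow> real) \<Rightarrow> (nat \<Rightarrow> 'w \<Rightarrow> real ^ 'd) \<Rightarrow> nat \<Rightarrow> 'w \<Rightarrow> (real ^ 'd) set" where
  "walk_hull M \<alpha> b Y n \<omega> =
     convex hull ((\<lambda>k. walk Y k \<omega> - centering M \<alpha> b (Y 1) k) ` {0..n})"

end

theory Submission
  imports Defs "HOL-Real_Asymp.Real_Asymp"
begin

text \<open>
  No functional limit theorem is needed. Along a dyadic grid of times the increments of the centred walk
  are independent and converge in law (the centering is asymptotically additive, because the limit law
  is not invariant under a translation), so the hull of the grid points converges to the hull of the
  dyadic values of \<open>X\<close>, and refining the grid gives \<open>conv X[0,1]\<close>. In between, a walk that is far from both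
  ends of a block has made two independent large excursions within it. Self-similarity and boundedness of
  the paths give \<open>P(|X(t)| > c) = O(t)\<close>, so this has probability \<open>O(4^(-K))\<close> in each of the \<open>2^K\<close>
  blocks. The intrinsic volumes and the Steiner point are continuous and homogeneous; for the former this
  rests on the Steiner formula, obtained for polytopes by observing that dilation away from the body is
  piecewise a linear stretch, and for convex bodies by approximation and polynomial interpolation.
\<close>

text \<open>The hypothesis speaks only of the whole walk at scale \<open>b n\<close>, whereas the
  grid needs blocks of every length k \<le> n. The bridge is that \<open>b k / b n\<close> is close
  to (k/n)^(1/\<alpha>) uniformly in 1 \<le> k \<le> n; this is what slow variation is used for.
  Because the block varies with n, errors are measured by one number, uniform over bounded Lipschitz
  test functions, instead of by one limit per test function; such numbers add up over independent
  increments. A single large jump in a given block has probability of order 2^(-K), so among 2^K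
  blocks it cannot be excluded, and the limit may jump as well. It is harmless to the hull, since
  before and after the jump the walk stays near one of the two ends of its block. Only two
  excursions in the same block do damage. Random convex bodies are tested by functions that are
  1-Lipschitz for the Hausdorff distance. This settles both measurability and weak convergence with
  no description of the Borel sets of \<open>hausdorff_topology\<close>.\<close>

section \<open>The Steiner formula\<close>

text \<open>Uniqueness of Haar measure. The double integral of
  \<open>indicator A x * indicator B (y + x)\<close> is evaluated once directly, and once after
  shifting \<open>x\<close> by the invariance of \<nu>, exchanging the integrals and reflecting
  \<open>y\<close>. The product form avoids dividing by a measure that may be 0 or infinite.\<close>

lemma translation_invariant_proportional_lborel:
  fixes \<nu> :: "'a::euclidean_space measure"
  assumes sets: "sets \<nu> = sets borel" and "sigma_finite_measure \<nu>"
    and inv: "\<And>y. distr \<nu> borel (\<lambda>x. x + y) = \<nu>"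
    and A: "A \<in> sets borel" and B: "B \<in> sets borel"
  shows "emeasure \<nu> A * emeasure lborel B = emeasure \<nu> B * emeasure lborel A"
proof -
  interpret \<nu>: sigma_finite_measure \<nu> by fact
  interpret P: pair_sigma_finite \<nu> "lborel :: 'a measure"
    by (simp add: pair_sigma_finite_def \<nu>.sigma_finite_measure_axioms lborel.sigma_finite_measure_axioms)
  note [measurable_cong] = sets
  note [measurable] = A B
  have trans: "(\<integral>\<^sup>+y. indicator B (y + x) \<partial>lborel) = emeasure lborel B" for x
  proof -
    have "(\<integral>\<^sup>+y. indicator B (x + y) \<partial>lborel) = (\<integral>\<^sup>+y. indicator B y \<partial>distr lborel borel ((+) x))"
      by (subst nn_integral_distr) auto
    then show ?thesis by (simp add: lborel_distr_plus add.commute)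
  qed
  have refl: "(\<integral>\<^sup>+y. indicator A (x - y) \<partial>lborel) = emeasure lborel A" for x
  proof -
    have "emeasure lborel A = (\<integral>\<^sup>+y. indicator A y \<partial>density (distr lborel borel (\<lambda>y. x + (-1) *\<^sub>R y)) (\<lambda>_. ennreal (\<bar>-1\<bar> ^ DIM('a))))"
      by (subst lborel_affine[of "-1" x, symmetric]) auto
    also have "\<dots> = (\<integral>\<^sup>+y. indicator A (x - y) \<partial>lborel)"
      by (subst nn_integral_density, simp, simp, subst nn_integral_distr) auto
    finally show ?thesis ..
  qed
  have "emeasure \<nu> A * emeasure lborel B = (\<integral>\<^sup>+x. indicator A x * (\<integral>\<^sup>+y. indicator B (y + x) \<partial>lborel) \<partial>\<nu>)"
    by (simp add: trans nn_integral_multc)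
  also have "\<dots> = (\<integral>\<^sup>+x. (\<integral>\<^sup>+y. indicator A x * indicator B (y + x) \<partial>lborel) \<partial>\<nu>)"
    by (intro nn_integral_cong, subst nn_integral_cmult) auto
  also have "\<dots> = (\<integral>\<^sup>+y. (\<integral>\<^sup>+x. indicator A x * indicator B (y + x) \<partial>\<nu>) \<partial>lborel)"
    by (rule P.Fubini'[symmetric]) measurable
  also have "\<dots> = (\<integral>\<^sup>+y. (\<integral>\<^sup>+x. indicator A (x - y) * indicator B x \<partial>\<nu>) \<partial>lborel)"
  proof (rule nn_integral_cong)
    fix y :: 'a
    have "(\<integral>\<^sup>+x. indicator A (x - y) * indicator B x \<partial>\<nu>) = (\<integral>\<^sup>+x. indicator A (x - y) * indicator B x \<partial>distr \<nu> borel (\<lambda>x. x + y))"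
      by (simp add: inv)
    also have "\<dots> = (\<integral>\<^sup>+x. indicator A x * indicator B (y + x) \<partial>\<nu>)"
      by (subst nn_integral_distr) (auto simp: add.commute)
    finally show "(\<integral>\<^sup>+x. indicator A x * indicator B (y + x) \<partial>\<nu>) = (\<integral>\<^sup>+x. indicator A (x - y) * indicator B x \<partial>\<nu>)"
      by (rule sym)
  qed
  also have "\<dots> = (\<integral>\<^sup>+x. (\<integral>\<^sup>+y. indicator A (x - y) * indicator B x \<partial>lborel) \<partial>\<nu>)"
    by (rule P.Fubini') measurable
  also have "\<dots> = (\<integral>\<^sup>+x. indicator B x * (\<integral>\<^sup>+y. indicator A (x - y) \<partial>lborel) \<partial>\<nu>)"
    by (intro nn_integral_cong, subst nn_integral_cmult[symmetric]) (auto simp: mult.commute)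
  also have "\<dots> = emeasure \<nu> B * emeasure lborel A"
    by (simp add: refl nn_integral_multc)
  finally show ?thesis .
qed

text \<open>The image measure is translation invariant, hence proportional to Lebesgue measure, and
  the factor is 1 because \<open>g\<close> preserves every ball around 0.\<close>

lemma lborel_distr_orthogonal_transformation:
  fixes g :: "'a::euclidean_space \<Rightarrow> 'a"
  assumes g: "orthogonal_transformation g"
  shows "distr lborel borel g = lborel"
proof -
  have lin: "linear g" using g by (rule orthogonal_transformation_linear)
  have [measurable]: "g \<in> borel_measurable borel"
    using lin by (intro borel_measurable_continuous_onI linear_continuous_on linear_conv_bounded_linear[THEN iffD1])
  have gb: "g -` ball 0 r = ball 0 r" for r
    using orthogonal_transformation_norm[OF g] by auto
  have em: "emeasure (distr lborel borel g) (ball 0 r) = emeasure lborel (ball (0::'a) r)" for r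
    by (subst emeasure_distr) (auto simp: gb)
  have finb: "emeasure lborel (ball (0::'a) r) \<noteq> \<top>" for r
    using emeasure_lborel_ball_finite by (metis less_irrefl infinity_ennreal_def)
  have sf: "sigma_finite_measure (distr lborel borel g)"
  proof
    have "(\<Union>n::nat. ball (0::'a) (real n)) = UNIV"
      using reals_Archimedean2 by (auto simp: dist_norm)
    then show "\<exists>A. countable A \<and> A \<subseteq> sets (distr lborel borel g) \<and> \<Union> A = space (distr lborel borel g) \<and> (\<forall>a\<in>A. emeasure (distr lborel borel g) a \<noteq> \<infinity>)"
      by (intro exI[of _ "range (\<lambda>n::nat. ball 0 (real n))"])
         (auto simp: em finb simp del: emeasure_ball)
  qed
  have inv: "distr (distr lborel borel g) borel (\<lambda>x. x + y) = distr lborel borel g" for y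
  proof -
    obtain z where z: "g z = y" using orthogonal_transformation_surj[OF g] by (metis surjD)
    have "distr (distr lborel borel g) borel (\<lambda>x. x + y) = distr lborel borel (\<lambda>x. g (z + x))"
      by (subst distr_distr) (auto simp: o_def linear_add[OF lin] z add.commute)
    also have "\<dots> = distr (distr lborel borel ((+) z)) borel g"
      by (subst distr_distr) (auto simp: o_def)
    finally show ?thesis by (simp add: lborel_distr_plus)
  qed
  show ?thesis
  proof (rule measure_eqI)
    fix A assume "A \<in> sets (distr lborel borel g)"
    then have A: "A \<in> sets borel" by simp
    have "emeasure (distr lborel borel g) A * emeasure lborel (ball (0::'a) 1) =
        emeasure lborel (ball (0::'a) 1) * emeasure lborel A"
      using translation_invariant_proportional_lborel[OF _ sf inv A, of "ball 0 1"] by (simp add: em del: emeasure_ball)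
    moreover have "emeasure lborel (ball (0::'a) 1) \<noteq> 0" by (simp add: emeasure_ball less_imp_neq[OF unit_ball_vol_pos, symmetric])
    ultimately show "emeasure (distr lborel borel g) A = emeasure lborel A"
      using finb by (metis ennreal_mult_cancel_left mult.commute)
  qed simp
qed

lemma orthonormal_set_extend:
  fixes B :: "'a::euclidean_space set"
  assumes "pairwise orthogonal B" "\<And>b. b \<in> B \<Longrightarrow> norm b = 1"
  obtains C where "B \<subseteq> C" "pairwise orthogonal C" "\<And>c. c \<in> C \<Longrightarrow> norm c = 1" "finite C" "card C = DIM('a)"
proof -
  define T where "T = {y::'a. \<forall>x\<in>span B. orthogonal x y}"
  have "subspace T" unfolding T_def by (rule subspace_orthogonal_to_vectors)
  then obtain D where D: "D \<subseteq> T" "pairwise orthogonal D" "\<And>x. x \<in> D \<Longrightarrow> norm x = 1" "independent D" "card D = dim T"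
    using orthonormal_basis_subspace by metis
  have iB: "independent B" using assms by (intro pairwise_orthogonal_independent) (auto, metis norm_zero zero_neq_one)
  have "dim T + dim B = DIM('a)"
    using dim_subspace_orthogonal_to_vectors[of "span B" UNIV] by (simp add: T_def)
  moreover have "dim B = card B" by (simp add: dim_eq_card_independent iB)
  moreover have fin: "finite B" "finite D" using iB D(4) independent_imp_finite by auto
  moreover have "B \<inter> D = {}"
  proof (rule ccontr)
    assume "B \<inter> D \<noteq> {}"
    then obtain x where "x \<in> B" "x \<in> D" by auto
    then have "orthogonal x x" using D(1) by (auto simp: T_def span_base)
    with assms(2)[OF \<open>x \<in> B\<close>] show False by (auto simp: orthogonal_def)
  qed
  ultimately have "card (B \<union> D) = DIM('a)" using D(5) by (simp add: card_Un_disjoint)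
  moreover have "orthogonal x y \<and> orthogonal y x" if "x \<in> B" "y \<in> D" for x y
    using that D(1) by (auto simp: T_def orthogonal_commute span_base)
  then have "pairwise orthogonal (B \<union> D)"
    using assms(1) D(1,2) by (auto simp: pairwise_def T_def orthogonal_commute subset_iff span_base)
  ultimately show ?thesis using that[of "B \<union> D"] fin assms(2) D(3) by auto
qed

lemma orthonormal_inner:
  assumes "pairwise orthogonal C" "\<And>c. c \<in> C \<Longrightarrow> norm c = 1" "x \<in> C" "y \<in> C"
  shows "x \<bullet> y = (if x = y then 1 else 0)"
  using assms by (auto simp: pairwise_def orthogonal_def norm_eq_1)

text \<open>\<open>L\<close> is the orthogonal projection onto \<open>span B\<close>, so the map is
  the identity on \<open>span B\<close> and multiplication by \<open>t\<close> on the orthogonal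
  complement. A rotation \<open>R\<close> taking \<open>Basis\<close> to an orthonormal extension of
  \<open>B\<close> conjugates it to the diagonal map \<open>D\<close>, whose determinant is
  \<open>t ^ (DIM('a) - card B)\<close>.\<close>

lemma emeasure_lborel_vimage_stretch:
  fixes B :: "'a::euclidean_space set"
  assumes B: "pairwise orthogonal B" "\<And>b. b \<in> B \<Longrightarrow> norm b = 1"
    and t: "0 < t" and S: "S \<in> sets borel"
  defines "L \<equiv> \<lambda>x. \<Sum>b\<in>B. (x \<bullet> b) *\<^sub>R b"
  shows "ennreal (t ^ (DIM('a) - card B)) * emeasure lborel ((\<lambda>x. t *\<^sub>R x + (1 - t) *\<^sub>R L x) -` S) = emeasure lborel S"
proof -
  obtain C where C: "B \<subseteq> C" "pairwise orthogonal C" "\<And>c. c \<in> C \<Longrightarrow> norm c = 1" "finite C" "card C = DIM('a)"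
    using orthonormal_set_extend[OF B] by blast
  have finB: "finite B" using C finite_subset by blast
  obtain f where f: "bij_betw f (Basis :: 'a set) C"
    using finite_same_card_bij[OF finite_Basis C(4)] C(5) by auto
  define M where "M x = t *\<^sub>R x + (1 - t) *\<^sub>R L x" for x
  define R where "R x = (\<Sum>i\<in>Basis. (x \<bullet> i) *\<^sub>R f i)" for x
  define c where "c i = (if f i \<in> B then 1 else t)" for i
  define D where "D x = 0 + (\<Sum>j\<in>Basis. (c j * (x \<bullet> j)) *\<^sub>R j)" for x
  have linL: "linear L"
    unfolding L_def by (intro linearI) (simp_all add: inner_add_left scaleR_add_left sum.distrib scaleR_sum_right)
  have linM: "linear M"
    unfolding M_def by (intro linearI) (simp_all add: linear_add[OF linL] linear_scale[OF linL] scaleR_add_right mult.commute)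
  have fin: "f i \<bullet> f j = (if i = j then 1 else 0)" if "i \<in> Basis" "j \<in> Basis" for i j
    using orthonormal_inner[OF C(2,3), of "f i" "f j"] that f
    by (auto simp: bij_betw_def inj_on_def)
  have linR: "linear R"
    unfolding R_def by (intro linearI) (simp_all add: inner_add_left scaleR_add_left sum.distrib scaleR_sum_right)
  have ortR: "orthogonal_transformation R"
  proof -
    have "R x \<bullet> R y = x \<bullet> y" for x y
    proof -
      have "R x \<bullet> R y = (\<Sum>i\<in>Basis. \<Sum>j\<in>Basis. (x \<bullet> i) * (y \<bullet> j) * (f i \<bullet> f j))"
        by (subst sum.swap) (simp add: R_def inner_sum_left inner_sum_right sum_distrib_left mult_ac)
      also have "\<dots> = (\<Sum>i\<in>Basis. \<Sum>j\<in>Basis. if i = j then (x \<bullet> i) * (y \<bullet> j) else 0)"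
        by (intro sum.cong refl) (simp add: fin)
      also have "\<dots> = x \<bullet> y" by (simp add: euclidean_inner[of x y])
      finally show ?thesis .
    qed
    then show ?thesis using linR by (simp add: orthogonal_transformation_def)
  qed
  have Lf: "L (f i) = (if f i \<in> B then f i else 0)" if "i \<in> Basis" for i
  proof -
    have "L (f i) = (\<Sum>b\<in>B. (if b = f i then f i else 0))"
      unfolding L_def
    proof (intro sum.cong refl)
      fix b assume "b \<in> B"
      then have "f i \<bullet> b = (if f i = b then 1 else 0)"
        using f that C(1) by (intro orthonormal_inner[OF C(2,3)]) (auto simp: bij_betw_def)
      then show "(f i \<bullet> b) *\<^sub>R b = (if b = f i then f i else 0)" by simp
    qed
    also have "\<dots> = (if f i \<in> B then f i else 0)" using finB by (simp add: sum.delta)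
    finally show ?thesis .
  qed
  have MR: "M (R x) = R (D x)" for x
  proof -
    have "M (R x) = (\<Sum>i\<in>Basis. (x \<bullet> i) *\<^sub>R M (f i))"
      by (simp add: R_def linear_sum[OF linM] linear_scale[OF linM])
    also have "\<dots> = (\<Sum>i\<in>Basis. (x \<bullet> i) *\<^sub>R (c i *\<^sub>R f i))"
      by (intro sum.cong refl) (auto simp: M_def Lf c_def algebra_simps)
    also have "\<dots> = R (D x)"
      by (simp add: R_def D_def mult.commute)
    finally show ?thesis .
  qed
  have meas: "h \<in> borel_measurable borel" if "linear h" for h :: "'a \<Rightarrow> 'a"
    using that by (intro borel_measurable_continuous_onI linear_continuous_on linear_conv_bounded_linear[THEN iffD1])
  have linD: "linear D"
    unfolding D_def by (intro linearI) (simp_all add: inner_add_left distrib_left scaleR_add_left sum.distrib scaleR_sum_right mult.left_commute)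
  note [measurable] = meas[OF linM] meas[OF linR] meas[OF linD] S
  have prodc: "(\<Prod>j\<in>Basis. \<bar>c j\<bar>) = t ^ (DIM('a) - card B)"
  proof -
    have "(\<Prod>j\<in>Basis. \<bar>c j\<bar>) = (\<Prod>v\<in>C. if v \<in> B then 1 else t)"
      using t by (subst prod.reindex_bij_betw[OF f, symmetric]) (auto simp: c_def intro!: prod.cong)
    also have "\<dots> = (\<Prod>v\<in>C - B. t)"
      using C(4) by (subst prod.If_cases) (auto simp: Diff_eq)
    also have "\<dots> = t ^ (DIM('a) - card B)"
      using C finB by (simp add: card_Diff_subset)
    finally show ?thesis .
  qed
  have dens: "lborel = density (distr lborel borel D) (\<lambda>_. ennreal (\<Prod>j\<in>Basis. \<bar>c j\<bar>))"
    unfolding D_def using t by (intro lborel_affine_euclidean) (auto simp: c_def)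
  have "emeasure lborel (M -` S) = emeasure (distr lborel borel M) S"
    by (subst emeasure_distr) auto
  also have "distr lborel borel M = distr (distr lborel borel R) borel M"
    by (simp add: lborel_distr_orthogonal_transformation[OF ortR])
  also have "\<dots> = distr (distr lborel borel D) borel R"
    by (simp add: distr_distr o_def MR)
  also have "emeasure \<dots> S = emeasure (distr lborel borel D) (R -` S)"
    by (subst emeasure_distr) auto
  finally have 1: "emeasure lborel (M -` S) = emeasure (distr lborel borel D) (R -` S)" .
  have RS: "R -` S \<in> sets borel" using measurable_sets[OF meas[OF linR] S] by simp
  have "emeasure lborel S = emeasure (distr lborel borel R) S"
    by (simp add: lborel_distr_orthogonal_transformation[OF ortR])
  also have "\<dots> = emeasure lborel (R -` S)" by (subst emeasure_distr) auto
  also have "\<dots> = emeasure (density (distr lborel borel D) (\<lambda>_. ennreal (\<Prod>j\<in>Basis. \<bar>c j\<bar>))) (R -` S)"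
    by (subst dens) (rule refl)
  also have "\<dots> = ennreal (\<Prod>j\<in>Basis. \<bar>c j\<bar>) * emeasure (distr lborel borel D) (R -` S)"
    using RS by (subst emeasure_density_const) auto
  finally show ?thesis unfolding prodc 1[symmetric] M_def[abs_def] by (rule sym)
qed

section \<open>Nearest points and the parallel bodies of a polytope\<close>

lemma closest_point_eqI:
  fixes A :: "'a::euclidean_space set"
  assumes "convex A" "closed A" "p \<in> A" "\<And>z. z \<in> A \<Longrightarrow> (y - p) \<bullet> (z - p) \<le> 0"
  shows "closest_point A y = p"
proof -
  have "dist y p \<le> dist y z" if "z \<in> A" for z
  proof -
    have "(norm (y - z))\<^sup>2 = (norm (y - p))\<^sup>2 - 2 * ((y - p) \<bullet> (z - p)) + (norm (z - p))\<^sup>2"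
      unfolding power2_norm_eq_inner by (simp add: inner_diff_left inner_diff_right inner_commute algebra_simps)
    also have "\<dots> \<ge> (norm (y - p))\<^sup>2" using assms(4)[OF that] zero_le_power2[of "norm (z - p)"] by linarith
    finally show ?thesis by (simp add: dist_norm power2_le_iff_abs_le)
  qed
  then show ?thesis using closest_point_unique[of A p y] assms by auto
qed

lemma closest_point_ray:
  fixes A :: "'a::euclidean_space set"
  assumes "convex A" "closed A" "A \<noteq> {}" "0 \<le> t"
  shows "closest_point A (closest_point A x + t *\<^sub>R (x - closest_point A x)) = closest_point A x"
proof (rule closest_point_eqI)
  show "closest_point A x \<in> A" using assms by (intro closest_point_in_set)
  show "(closest_point A x + t *\<^sub>R (x - closest_point A x) - closest_point A x) \<bullet> (z - closest_point A x) \<le> 0" if "z \<in> A" for z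
    using closest_point_dot[OF assms(1,2) that, of x] assms(4) by (simp add: mult_nonneg_nonpos)
qed (use assms in auto)

lemma infdist_eq_dist_closest_point:
  fixes A :: "'a::euclidean_space set"
  assumes "closed A" "A \<noteq> {}"
  shows "infdist x A = dist x (closest_point A x)"
  using setdist_closest_point[OF assms, of x] assms by (simp add: infdist_eq_setdist)

text \<open>Write \<open>p\<close> as a convex combination of \<open>V\<close> and let
  \<open>W\<close> carry the nonzero weights. The numbers \<open>(x - p) \<bullet> (v - p)\<close>
  are nonpositive and their weighted sum is 0, so they vanish on \<open>W\<close>. Hence
  \<open>p\<close> is the orthogonal projection of \<open>x\<close> onto the affine hull of
  \<open>W\<close>.\<close>

lemma closest_point_polytope_face:
  fixes V :: "'a::euclidean_space set" and x :: 'a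
  assumes V: "finite V" "V \<noteq> {}"
  defines "p \<equiv> closest_point (convex hull V) x"
  obtains W where "W \<subseteq> V" "p \<in> convex hull W" "\<And>w. w \<in> W \<Longrightarrow> (x - p) \<bullet> (w - p) = 0"
proof -
  have A: "closed (convex hull V)" "convex hull V \<noteq> {}" "convex (convex hull V)"
    using V by (auto intro: compact_imp_closed finite_imp_compact_convex_hull)
  have "p \<in> convex hull V" unfolding p_def using A by (intro closest_point_in_set)
  then obtain u where u: "\<forall>v\<in>V. 0 \<le> u v" "sum u V = 1" "(\<Sum>v\<in>V. u v *\<^sub>R v) = p"
    using V by (auto simp: convex_hull_finite)
  define W where "W = {v \<in> V. u v \<noteq> 0}"
  have "(\<Sum>v\<in>V. u v * ((x - p) \<bullet> (v - p))) = (x - p) \<bullet> (\<Sum>v\<in>V. u v *\<^sub>R (v - p))"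
    by (simp add: inner_sum_right)
  also have "(\<Sum>v\<in>V. u v *\<^sub>R (v - p)) = 0"
    using u by (simp add: scaleR_diff_right sum_subtractf scaleR_sum_left[symmetric])
  finally have "(\<Sum>v\<in>V. u v * ((x - p) \<bullet> (v - p))) = 0" by simp
  moreover have "u v * ((x - p) \<bullet> (v - p)) \<le> 0" if "v \<in> V" for v
    using closest_point_dot[OF A(3,1), of v x] u(1) that
    by (auto simp: p_def hull_inc intro!: mult_nonneg_nonpos)
  ultimately have "\<forall>v\<in>V. u v * ((x - p) \<bullet> (v - p)) = 0"
    using sum_nonneg_eq_0_iff[OF V(1), of "\<lambda>v. - (u v * ((x - p) \<bullet> (v - p)))"] by (auto simp: sum_negf)
  then have z: "(x - p) \<bullet> (w - p) = 0" if "w \<in> W" for w using that by (auto simp: W_def)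
  have W: "W \<subseteq> V" "finite W" using V(1) by (auto simp: W_def)
  have "sum u W = sum u V" "(\<Sum>v\<in>W. u v *\<^sub>R v) = (\<Sum>v\<in>V. u v *\<^sub>R v)"
    using V(1) by (intro sum.mono_neutral_left; auto simp: W_def)+
  then have "(\<forall>v\<in>W. 0 \<le> u v) \<and> sum u W = 1 \<and> (\<Sum>v\<in>W. u v *\<^sub>R v) = p"
    using u W(1) by auto
  then have "p \<in> convex hull W"
    unfolding convex_hull_finite[OF W(2)] by blast
  with z show ?thesis using that[of W] by (auto simp: W_def)
qed


text \<open>On each cell of a finite partition the nearest point map of a polytope agrees with an orthogonal
  projection onto an affine subspace, so that dilation away from the polytope is a stretch on the cell.\<close>
lemma parallel_volume_polytope:
  fixes V :: "'a::euclidean_space set"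
  assumes V: "finite V" "V \<noteq> {}"
  shows "\<exists>q. degree q \<le> DIM('a) \<and>
    (\<forall>t>0. measure lborel {x. infdist x (convex hull V) \<le> t} = poly q t)"
proof -
  let ?A = "convex hull V"
  define p where "p = closest_point ?A"
  have A: "closed ?A" "?A \<noteq> {}" "convex ?A" "compact ?A"
    using V by (auto intro: compact_imp_closed finite_imp_compact_convex_hull)
  \<comment> \<open>\<Phi> keeps the nearest point and multiplies the distance to the polytope by
    \<open>t\<close>, so for \<open>t > 0\<close> it carries the parallel body of radius 1 onto the
    one of radius \<open>t\<close>.\<close>
  define \<Phi> where "\<Phi> t x = p x + t *\<^sub>R (x - p x)" for t :: real and x
  have p\<Phi>: "p (\<Phi> t x) = p x" if "0 \<le> t" for t x
    unfolding \<Phi>_def p_def using closest_point_ray[OF A(3,1,2) that] by simp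
  have \<Phi>\<Phi>: "\<Phi> s (\<Phi> t x) = \<Phi> (s * t) x" if "0 \<le> t" for s t x
    using p\<Phi>[OF that, of x] by (simp add: \<Phi>_def)
  have \<Phi>1: "\<Phi> 1 x = x" for x by (simp add: \<Phi>_def)
  have idp: "infdist x ?A = dist x (p x)" for x
    unfolding p_def by (rule infdist_eq_dist_closest_point[OF A(1,2)])
  have id\<Phi>: "infdist (\<Phi> t x) ?A = t * infdist x ?A" if "0 \<le> t" for t x
  proof -
    have "infdist (\<Phi> t x) ?A = dist (\<Phi> t x) (p x)" by (simp add: idp p\<Phi>[OF that])
    also have "\<dots> = t * dist x (p x)" using that by (simp add: \<Phi>_def dist_norm)
    finally show ?thesis by (simp add: idp)
  qed
  define w0 where "w0 W = (SOME w. w \<in> W)" for W :: "'a set"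
  have "\<exists>B. pairwise orthogonal B \<and> (\<forall>b\<in>B. norm b = 1) \<and> span B = span ((\<lambda>w. w - w0 W) ` W)" for W :: "'a set"
    by (rule orthonormal_basis_subspace[OF subspace_span[of "(\<lambda>w. w - w0 W) ` W"]]) blast
  then obtain B where B: "\<And>W. pairwise orthogonal (B W) \<and> (\<forall>b\<in>B W. norm b = 1) \<and> span (B W) = span ((\<lambda>w. w - w0 W) ` W)"
    using choice[of "\<lambda>W B. pairwise orthogonal B \<and> (\<forall>b\<in>B. norm b = 1) \<and> span B = span ((\<lambda>w. w - w0 W) ` W)"] by blast
  have Bw: "pairwise orthogonal (B W)" "\<And>b. b \<in> B W \<Longrightarrow> norm b = 1" "w0 W \<in> W"
      "span (B W) = span ((\<lambda>w. w - w0 W) ` W)" if "W \<noteq> {}" for W :: "'a set"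
    using B[of W] that some_in_eq[of W] by (auto simp: w0_def)
  define L where "L W x = (\<Sum>b\<in>B W. (x \<bullet> b) *\<^sub>R b)" for W x
  define Q where "Q W x = w0 W + L W (x - w0 W)" for W x
  \<comment> \<open>\<open>Q W\<close> is the orthogonal projection onto the affine hull of
    \<open>W\<close>. The cell of \<open>W\<close> collects the points whose nearest point is given
    by this projection; cells may overlap.\<close>
  define Cell where "Cell W = (if W \<noteq> {} \<and> W \<subseteq> V then {x. p x = Q W x} else {})" for W
  have linL: "linear (L W)" for W
    unfolding L_def by (intro linearI) (simp_all add: inner_add_left scaleR_add_left sum.distrib scaleR_sum_right)
  have finB: "finite (B W)" if "W \<noteq> {}" for W
    using Bw(1,2)[OF that] by (intro pairwise_orthogonal_imp_finite)
  have Lb: "L W b = b" if "W \<noteq> {}" "b \<in> B W" for W b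
  proof -
    have "L W b = (\<Sum>c\<in>B W. (if c = b then b else 0))"
      unfolding L_def using orthonormal_inner[OF Bw(1,2)[OF that(1)] that(2)] by (intro sum.cong) auto
    then show ?thesis using finB[OF that(1)] that(2) by simp
  qed
  have Lspan: "L W y = y" if "W \<noteq> {}" "y \<in> span (B W)" for W y
    using that(2)
  proof (induction rule: span_induct_alt)
    case base then show ?case by (simp add: linear_0[OF linL])
  next
    case (step c x y)
    then show ?case by (simp add: linear_add[OF linL] linear_scale[OF linL] Lb[OF that(1)])
  qed
  have LL: "L W (L W x) = L W x" if "W \<noteq> {}" for W x
    by (rule Lspan[OF that]) (unfold L_def, intro span_sum span_scale span_base)
  have Qmix: "Q W (t *\<^sub>R x + (1 - t) *\<^sub>R Q W x) = Q W x" if "W \<noteq> {}" for W t x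
  proof -
    have "t *\<^sub>R x + (1 - t) *\<^sub>R Q W x - w0 W = t *\<^sub>R (x - w0 W) + (1 - t) *\<^sub>R L W (x - w0 W)"
      by (simp add: Q_def algebra_simps)
    then have "L W (t *\<^sub>R x + (1 - t) *\<^sub>R Q W x - w0 W) = t *\<^sub>R L W (x - w0 W) + (1 - t) *\<^sub>R L W (x - w0 W)"
      by (simp add: linear_add[OF linL] linear_scale[OF linL] LL[OF that])
    then show ?thesis by (simp add: Q_def algebra_simps)
  qed
  define G where "G W t x = t *\<^sub>R x + (1 - t) *\<^sub>R Q W x" for W t x
  have G\<Phi>: "\<Phi> t x = G W t x" if "x \<in> Cell W" for W t x
    using that by (auto simp: \<Phi>_def G_def Cell_def algebra_simps split: if_splits)
  have cell\<Phi>: "\<Phi> t x \<in> Cell W" if x: "x \<in> Cell W" and "0 \<le> t" for W t x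
  proof -
    have W: "W \<noteq> {}" "W \<subseteq> V" "p x = Q W x" using x by (auto simp: Cell_def split: if_splits)
    have "Q W (\<Phi> t x) = Q W x" using Qmix[OF W(1)] by (simp add: G\<Phi>[OF x] G_def)
    then show ?thesis using W p\<Phi>[OF that(2)] by (simp add: Cell_def)
  qed
  have cell\<Phi>_iff: "\<Phi> t x \<in> Cell W \<longleftrightarrow> x \<in> Cell W" if "0 < t" for W t x
    using cell\<Phi>[of x W t] cell\<Phi>[of "\<Phi> t x" W "1/t"] that by (auto simp: \<Phi>\<Phi> \<Phi>1)
  have GG: "G W s (G W t x) = G W (s * t) x" if "W \<noteq> {}" for W s t x
    using Qmix[OF that] by (simp add: G_def algebra_simps)
  have cover: "\<exists>W. x \<in> Cell W" for x
  proof -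
    obtain W where W: "W \<subseteq> V" "p x \<in> convex hull W" "\<And>w. w \<in> W \<Longrightarrow> (x - p x) \<bullet> (w - p x) = 0"
      using closest_point_polytope_face[OF V, of x] by (auto simp: p_def)
    have ne: "W \<noteq> {}" using W(2) by auto
    let ?w = "w0 W"
    have 0: "(x - p x) \<bullet> (w - ?w) = 0" if "w \<in> W" for w
    proof -
      have "w - ?w = (w - p x) - (?w - p x)" by simp
      then show ?thesis using W(3)[OF that] W(3)[OF Bw(3)[OF ne]] by (metis inner_diff_right diff_self)
    qed
    have "(x - p x) \<bullet> b = 0" if "b \<in> B W" for b
    proof -
      have "b \<in> span ((\<lambda>w. w - ?w) ` W)" using Bw(4)[OF ne] span_base[OF that] by simp
      then have "orthogonal (x - p x) b"
        by (rule orthogonal_to_span) (use 0 in \<open>auto simp: orthogonal_def\<close>)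
      then show ?thesis by (simp add: orthogonal_def)
    qed
    then have L0: "L W (x - p x) = 0" by (simp add: L_def)
    have "convex hull W \<subseteq> (\<lambda>y. ?w + y) ` span ((\<lambda>w. w - ?w) ` W)"
    proof (rule hull_minimal)
      show "W \<subseteq> (\<lambda>y. ?w + y) ` span ((\<lambda>w. w - ?w) ` W)"
      proof
        fix w assume "w \<in> W"
        then have "w - ?w \<in> span ((\<lambda>w. w - ?w) ` W)" by (intro span_base) auto
        then show "w \<in> (\<lambda>y. ?w + y) ` span ((\<lambda>w. w - ?w) ` W)"
          by (intro image_eqI[of _ _ "w - ?w"]) auto
      qed
      show "convex ((\<lambda>y. ?w + y) ` span ((\<lambda>w. w - ?w) ` W))"
        by (intro convex_translation subspace_imp_convex subspace_span)
    qed
    then obtain y where y: "y \<in> span ((\<lambda>w. w - ?w) ` W)" "p x = ?w + y" using W(2) by blast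
    then have "y \<in> span (B W)" using Bw(4)[OF ne] by simp
    then have "L W (p x - ?w) = p x - ?w" using Lspan[OF ne] y by simp
    moreover have "x - ?w = (x - p x) + (p x - ?w)" by simp
    ultimately have "L W (x - ?w) = p x - ?w" using L0 linear_add[OF linL] by (metis add_0)
    then have "p x = Q W x" by (simp add: Q_def)
    then show ?thesis using W(1) ne by (auto simp: Cell_def)
  qed
  have contL: "continuous_on S (L W)" for S W
    using linL by (simp add: linear_continuous_on linear_conv_bounded_linear)
  have contQ: "continuous_on S (Q W)" for S W
    unfolding Q_def by (intro continuous_intros continuous_on_compose2[OF contL[of UNIV]]) auto
  have contp: "continuous_on S p" for S
    unfolding p_def using A by (intro continuous_on_closest_point)
  have closedC: "closed (Cell W)" for W
    unfolding Cell_def by (auto intro!: closed_Collect_eq contQ contp)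
  obtain e :: "nat \<Rightarrow> 'a set" where e: "bij_betw e {..<card (Pow V)} (Pow V)"
    using ex_bij_betw_nat_finite[of "Pow V"] V(1) by (auto simp: atLeast0LessThan)
  define m where "m = card (Pow V)"
  \<comment> \<open>The overlapping cells are made disjoint. The pieces are differences of cells, so
    they remain closed under \<Phi> in both directions.\<close>
  define D where "D = disjointed (\<lambda>i. if i < m then Cell (e i) else {})"
  have Dsets: "D i \<in> sets borel" for i
  proof -
    have "range (disjointed (\<lambda>i. if i < m then Cell (e i) else {})) \<subseteq> sets borel"
      by (rule sets.range_disjointed_sets) (auto intro!: borel_closed closedC)
    then show ?thesis by (auto simp: D_def)
  qed
  have Ddisj: "disjoint_family D" unfolding D_def by (rule disjoint_family_disjointed)
  have D\<Phi>: "\<Phi> t x \<in> D i \<longleftrightarrow> x \<in> D i" if "0 < t" for t x i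
    using that by (auto simp: D_def disjointed_def cell\<Phi>_iff split: if_splits)
  have Dsub: "D i \<subseteq> Cell (e i)" "i < m" if "D i \<noteq> {}" for i
    using that by (auto simp: D_def disjointed_def split: if_splits)
  have Dcover: "(\<Union>i<m. D i) = UNIV"
  proof -
    have "x \<in> (\<Union>i<m. D i)" for x
    proof -
      obtain W where "x \<in> Cell W" using cover by blast
      moreover then have "W \<in> Pow V" by (auto simp: Cell_def split: if_splits)
      ultimately obtain i where i: "i < m" "x \<in> Cell (e i)"
        using e unfolding bij_betw_def m_def by (metis imageE lessThan_iff)
      then have "x \<in> (\<Union>i. if i < m then Cell (e i) else {})" by (intro UN_I[of i]) auto
      then have "x \<in> (\<Union>i. D i)" by (simp add: D_def UN_disjointed_eq)
      then obtain j where "x \<in> D j" by blast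
      moreover then have "j < m" using Dsub(2)[of j] by auto
      ultimately show ?thesis by blast
    qed
    then show ?thesis by (intro UNIV_eq_I[symmetric])
  qed
  define K where "K t = {x. infdist x ?A \<le> t}" for t
  have K: "closed (K t)" for t
    unfolding K_def by (intro closed_Collect_le continuous_intros)
  have Kbounded: "bounded (K t)" for t
  proof -
    obtain M where M: "\<And>a. a \<in> ?A \<Longrightarrow> norm a \<le> M" using A(4) compact_imp_bounded bounded_iff by metis
    show ?thesis
    proof (rule boundedI)
      fix x assume "x \<in> K t"
      then have "dist x (p x) \<le> t" by (simp add: K_def idp)
      moreover have "p x \<in> ?A" unfolding p_def using A by (intro closest_point_in_set)
      ultimately show "norm x \<le> t + M" using M[of "p x"] norm_triangle_ineq[of "x - p x" "p x"] by (simp add: dist_norm)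
    qed
  qed
  have Kfin: "emeasure lborel (K t \<inter> D i) < \<infinity>" for t i
    by (intro emeasure_bounded_finite bounded_Int disjI1 Kbounded)
  \<comment> \<open>The codimension of the affine hull: only the directions normal to it are
    stretched by \<Phi>.\<close>
  define k where "k i = DIM('a) - card (B (e i))" for i
  have scale: "measure lborel (K t \<inter> D i) = t ^ k i * measure lborel (K 1 \<inter> D i)" if t: "0 < t" for t i
  proof (cases "D i = {}")
    case False
    let ?W = "e i"
    have "Cell ?W \<noteq> {}" using Dsub(1)[OF False] False by auto
    then have W: "?W \<noteq> {}" by (auto simp: Cell_def split: if_splits)
    \<comment> \<open>On \<open>D i\<close> the map \<Phi> agrees with the affine map
      \<open>G\<close>, which is defined as one affine map on the whole space; this turns scaling of
      the piece into a preimage under an affine stretch.\<close>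
    have eq: "K t \<inter> D i = G ?W (1/t) -` (K 1 \<inter> D i)"
    proof (intro set_eqI iffI)
      fix x assume x: "x \<in> K t \<inter> D i"
      then have "G ?W (1/t) x = \<Phi> (1/t) x" using Dsub(1)[OF False] G\<Phi> by auto
      then show "x \<in> G ?W (1/t) -` (K 1 \<inter> D i)"
        using x t D\<Phi>[of "1/t" x i] by (auto simp: K_def id\<Phi> field_simps)
    next
      fix x assume x: "x \<in> G ?W (1/t) -` (K 1 \<inter> D i)"
      let ?y = "G ?W (1/t) x"
      have "x = G ?W t ?y" using t by (simp add: GG[OF W]) (simp add: G_def)
      also have "\<dots> = \<Phi> t ?y" using x Dsub(1)[OF False] G\<Phi> by auto
      finally have "x = \<Phi> t ?y" .
      then have "infdist x ?A = t * infdist ?y ?A" "x \<in> D i"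
        using id\<Phi>[of t ?y] D\<Phi>[of t ?y i] x t by auto
      then show "x \<in> K t \<inter> D i" using x t by (auto simp: K_def)
    qed
    \<comment> \<open>Moving the base point \<open>w0\<close> to the origin makes the affine stretch
      linear.\<close>
    let ?w = "w0 ?W"
    define S where "S = (\<lambda>x. x + ?w) -` (K 1 \<inter> D i)"
    have KD: "K r \<inter> D i \<in> sets borel" for r using K Dsets by auto
    have Sb: "S \<in> sets borel"
      unfolding S_def using KD by (intro measurable_sets[of "\<lambda>x. x + ?w" borel borel, simplified])
    have shift: "emeasure lborel ((\<lambda>x. x + ?w) -` X) = emeasure lborel X" if X: "X \<in> sets borel" for X
    proof -
      have "emeasure lborel X = emeasure (distr lborel borel ((+) ?w)) X" by (simp add: lborel_distr_plus)
      also have "\<dots> = emeasure lborel ((+) ?w -` X)" using X by (subst emeasure_distr) auto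
      finally show ?thesis by (simp add: add.commute[of ?w] vimage_def)
    qed
    have "(\<lambda>x. x + ?w) -` (K t \<inter> D i) = (\<lambda>x. (1/t) *\<^sub>R x + (1 - 1/t) *\<^sub>R (\<Sum>b\<in>B ?W. (x \<bullet> b) *\<^sub>R b)) -` S"
    proof -
      have "G ?W (1/t) (x + ?w) = (1/t) *\<^sub>R x + (1 - 1/t) *\<^sub>R (\<Sum>b\<in>B ?W. (x \<bullet> b) *\<^sub>R b) + ?w" for x
        by (simp add: G_def Q_def L_def algebra_simps)
      then show ?thesis unfolding eq S_def by (auto simp: vimage_def)
    qed
    then have "ennreal ((1/t) ^ k i) * emeasure lborel (K t \<inter> D i) = emeasure lborel (K 1 \<inter> D i)"
      using emeasure_lborel_vimage_stretch[OF Bw(1,2)[OF W], of "1/t" S] t Sb shift[OF KD[of t]] shift[OF KD[of 1]]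
      by (simp add: k_def S_def)
    then have "(1/t) ^ k i * measure lborel (K t \<inter> D i) = measure lborel (K 1 \<inter> D i)"
      using t Kfin by (simp add: emeasure_eq_ennreal_measure less_top[symmetric] ennreal_mult[symmetric])
    then show ?thesis using t by (simp add: field_simps)
  qed simp
  define q where "q = (\<Sum>i<m. monom (measure lborel (K 1 \<inter> D i)) (k i))"
  have "degree q \<le> DIM('a)"
    unfolding q_def by (intro degree_sum_le) (auto simp: k_def intro: order_trans[OF degree_monom_le])
  moreover have "measure lborel (K t) = poly q t" if t: "0 < t" for t
  proof -
    have "(\<Union>i\<in>{..<m}. K t \<inter> D i) = K t" using Dcover by (simp add: Int_UN_distrib[symmetric])
    then have "measure lborel (K t) = measure lborel (\<Union>i\<in>{..<m}. K t \<inter> D i)" by (rule arg_cong[OF sym])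
    also have "\<dots> = (\<Sum>i<m. measure lborel (K t \<inter> D i))"
    proof (rule measure_finite_Union)
      show "disjoint_family_on (\<lambda>i. K t \<inter> D i) {..<m}"
        using Ddisj by (auto simp: disjoint_family_on_def)
      show "emeasure lborel (K t \<inter> D i) \<noteq> \<infinity>" for i using Kfin[of t i] by simp
    qed (use K Dsets in auto)
    also have "\<dots> = poly q t"
      unfolding q_def poly_sum poly_monom by (intro sum.cong refl) (simp add: scale[OF t] mult.commute)
    finally show ?thesis .
  qed
  ultimately show ?thesis by (auto simp: K_def)
qed

section \<open>Polynomial interpolation\<close>

text \<open>Lagrange basis polynomials for the nodes 1, ..., d + 1. Starting at 1 instead of 0 keeps
  all radii positive, where parallel volumes depend continuously on the body.\<close>

definition lagrange_basis :: "nat \<Rightarrow> nat \<Rightarrow> real poly" where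
  "lagrange_basis d j = (\<Prod>i\<in>{..d} - {j}. smult (1 / (real j - real i)) [:- real (Suc i), 1:])"

lemma degree_lagrange_basis:
  assumes "j \<le> d"
  shows "degree (lagrange_basis d j) \<le> d"
proof -
  have "degree (lagrange_basis d j) \<le> sum (degree \<circ> (\<lambda>i. smult (1 / (real j - real i)) [:- real (Suc i), 1:])) ({..d} - {j})"
    unfolding lagrange_basis_def by (intro degree_prod_sum_le) auto
  also have "\<dots> \<le> (\<Sum>i\<in>{..d} - {j}. 1)"
    by (intro sum_mono) (auto intro: order_trans[OF degree_smult_le])
  also have "\<dots> = d" using assms by simp
  finally show ?thesis .
qed

lemma poly_lagrange_basis:
  assumes "j \<le> d" "k \<le> d"
  shows "poly (lagrange_basis d j) (real (Suc k)) = (if k = j then 1 else 0)"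
proof (cases "k = j")
  case True
  have "poly (smult (1 / (real j - real i)) [:- real (Suc i), 1:]) (real (Suc j)) = 1" if "i \<in> {..d} - {j}" for i
    using that by (simp add: divide_simps)
  then show ?thesis using True by (simp only: lagrange_basis_def poly_prod) simp
next
  case False
  have "poly (smult (1 / (real j - real k)) [:- real (Suc k), 1:]) (real (Suc k)) = 0"
    by (simp add: add_divide_distrib[symmetric])
  then have "\<exists>i\<in>{..d} - {j}. poly (smult (1 / (real j - real i)) [:- real (Suc i), 1:]) (real (Suc k)) = 0"
    using assms False by (intro bexI[of _ k]) auto
  then show ?thesis using False by (simp only: lagrange_basis_def poly_prod) auto
qed

lemma lagrange_interpolation:
  assumes "degree p \<le> d"
  shows "p = (\<Sum>j\<le>d. smult (poly p (real (Suc j))) (lagrange_basis d j))"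
proof (rule poly_eqI_degree[of "(\<lambda>j. real (Suc j)) ` {..d}"])
  have card: "card ((\<lambda>j. real (Suc j)) ` {..d}) = Suc d"
    by (subst card_image) (auto simp: inj_on_def)
  show "degree p < card ((\<lambda>j. real (Suc j)) ` {..d})" using assms by (simp only: card)
  have "degree (\<Sum>j\<le>d. smult (poly p (real (Suc j))) (lagrange_basis d j)) \<le> d"
    by (intro degree_sum_le) (auto intro: order_trans[OF degree_smult_le] degree_lagrange_basis)
  then show "degree (\<Sum>j\<le>d. smult (poly p (real (Suc j))) (lagrange_basis d j)) < card ((\<lambda>j. real (Suc j)) ` {..d})"
    by (simp only: card)
  fix x assume "x \<in> (\<lambda>j. real (Suc j)) ` {..d}"
  then obtain k where k: "k \<le> d" "x = real (Suc k)" by auto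
  have "poly (\<Sum>j\<le>d. smult (poly p (real (Suc j))) (lagrange_basis d j)) x
      = (\<Sum>j\<le>d. if k = j then poly p (real (Suc j)) else 0)"
    unfolding poly_sum k(2) by (intro sum.cong refl) (simp add: poly_lagrange_basis[OF _ k(1)] del: of_nat_Suc)
  also have "\<dots> = poly p x" using k by simp
  finally show "poly p x = poly (\<Sum>j\<le>d. smult (poly p (real (Suc j))) (lagrange_basis d j)) x" by simp
qed

section \<open>Parallel volumes, their continuity and the Steiner formula\<close>

definition parallel_volume :: "'a::euclidean_space set \<Rightarrow> real \<Rightarrow> real" where
  "parallel_volume A \<rho> = measure lborel {x. infdist x A \<le> \<rho>}"

lemma infdist_le_infdist_add:
  fixes A B :: "'a::euclidean_space set"
  assumes "closed B" "B \<noteq> {}" "\<And>b. b \<in> B \<Longrightarrow> infdist b A \<le> e"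
  shows "infdist x A \<le> infdist x B + e"
proof -
  obtain b where "b \<in> B" "infdist x B = dist x b"
    using infdist_attains_inf[OF assms(1,2)] by blast
  then show ?thesis using infdist_triangle[of x A b] assms(3)[of b] by simp
qed

lemma abs_infdist_diff_le_hausdorff_dist:
  fixes A B :: "'a::euclidean_space set"
  assumes "compact A" "A \<noteq> {}" "compact B" "B \<noteq> {}"
  shows "\<bar>infdist x A - infdist x B\<bar> \<le> hausdorff_dist A B"
  using infdist_le_infdist_add[of A B "hausdorff_dist A B" x] infdist_le_infdist_add[of B A "hausdorff_dist A B" x]
    infdist_le_hausdorff_dist[of A B] infdist_le_hausdorff_dist[of B A] assms
  by (auto simp: compact_imp_closed hausdorff_dist_commute[of B A])

lemma closed_infdist_le: "closed {x. infdist x A \<le> r}"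
  by (intro closed_Collect_le continuous_intros)

lemma bounded_infdist_le:
  fixes A :: "'a::euclidean_space set"
  assumes "compact A" "A \<noteq> {}"
  shows "bounded {x. infdist x A \<le> r}"
proof -
  obtain M where M: "\<And>a. a \<in> A \<Longrightarrow> norm a \<le> M" using assms(1) compact_imp_bounded bounded_iff by metis
  show ?thesis
  proof (rule boundedI)
    fix x assume "x \<in> {x. infdist x A \<le> r}"
    moreover obtain a where "a \<in> A" "infdist x A = dist x a"
      using infdist_attains_inf[of A x] assms compact_imp_closed by blast
    ultimately show "norm x \<le> r + M" using M[of a] norm_triangle_ineq[of "x - a" a] by (simp add: dist_norm)
  qed
qed

lemma convex_infdist_le:
  fixes A :: "'a::euclidean_space set"
  assumes A: "convex A" "A \<noteq> {}" and cA: "closed A"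
  shows "convex {x. infdist x A \<le> r}"
proof (rule convexI)
  fix x y and u v :: real
  assume x: "x \<in> {x. infdist x A \<le> r}" and y: "y \<in> {x. infdist x A \<le> r}" and uv: "0 \<le> u" "0 \<le> v" "u + v = 1"
  obtain a where a: "a \<in> A" "infdist x A = dist x a" using infdist_attains_inf[OF cA A(2)] by blast
  obtain b where b: "b \<in> A" "infdist y A = dist y b" using infdist_attains_inf[OF cA A(2)] by blast
  have "infdist (u *\<^sub>R x + v *\<^sub>R y) A \<le> dist (u *\<^sub>R x + v *\<^sub>R y) (u *\<^sub>R a + v *\<^sub>R b)"
    using convexD[OF A(1) a(1) b(1) uv] by (rule infdist_le)
  also have "\<dots> = norm (u *\<^sub>R (x - a) + v *\<^sub>R (y - b))" by (simp add: dist_norm algebra_simps)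
  also have "\<dots> \<le> u * dist x a + v * dist y b"
    using uv by (intro order_trans[OF norm_triangle_ineq]) (simp add: dist_norm)
  also have "\<dots> \<le> u * r + v * r" using x y a b uv by (intro add_mono mult_left_mono) auto
  also have "\<dots> = r" using uv by (simp add: distrib_right[symmetric])
  finally show "u *\<^sub>R x + v *\<^sub>R y \<in> {x. infdist x A \<le> r}" by simp
qed

text \<open>A point at distance exactly \<open>r\<close> can be pushed outward along its normal ray,
  so it lies on the frontier of the parallel body; that body is convex and the frontier of a convex
  set is negligible.\<close>

lemma AE_infdist_neq:
  fixes A :: "'a::euclidean_space set"
  assumes A: "compact A" "convex A" "A \<noteq> {}" and r: "0 < r"
  shows "AE x in lborel. infdist x A \<noteq> r"
proof -
  let ?K = "{x. infdist x A \<le> r}"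
  have cA: "closed A" using A compact_imp_closed by blast
  have "convex ?K" using A(2,3) cA by (rule convex_infdist_le)
  moreover have "x \<in> frontier ?K" if x: "infdist x A = r" for x
  proof -
    define p where "p = closest_point A x"
    have px: "dist x p = r" using x infdist_eq_dist_closest_point[OF cA A(3), of x] by (simp add: p_def)
    have "x \<notin> interior ?K"
    proof
      assume "x \<in> interior ?K"
      then obtain e where e: "0 < e" "ball x e \<subseteq> ?K" by (auto simp: mem_interior)
      \<comment> \<open>With this \<open>s\<close> the point \<open>y\<close> lies at distance
        \<open>e / 2\<close> from \<open>x\<close>, still inside the ball, but at distance
        \<open>(1 + s) * r\<close> from \<open>A\<close>.\<close>
      define s where "s = e / (2 * r)"
      define y where "y = p + (1 + s) *\<^sub>R (x - p)"
      have s: "0 < s" using e r by (simp add: s_def)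
      have "dist x y = s * dist x p" using s by (simp add: y_def dist_norm algebra_simps flip: scaleR_diff_right)
      also have "\<dots> < e" using e r by (simp add: px s_def)
      finally have "y \<in> ?K" using e by auto
      moreover have "closest_point A y = p"
        unfolding y_def p_def using s by (intro closest_point_ray A cA) auto
      then have "infdist y A = (1 + s) * r"
        using infdist_eq_dist_closest_point[OF cA A(3), of y] s px by (simp add: y_def dist_norm)
      ultimately have "(1 + s) * r \<le> 1 * r" by simp
      then show False using s r by (simp only: mult_le_cancel_right) auto
    qed
    moreover have "x \<in> closure ?K" using x closure_subset[of ?K] by auto
    ultimately show ?thesis by (simp add: frontier_def)
  qed
  ultimately have "negligible {x. infdist x A = r}"
    using negligible_convex_frontier[of ?K] negligible_subset[of "frontier ?K" "{x. infdist x A = r}"] by auto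
  then have "AE x in lebesgue. x \<notin> {x. infdist x A = r}"
    by (intro AE_not_in) (simp add: negligible_iff_null_sets)
  then show ?thesis by (simp add: AE_completion_iff)
qed

text \<open>Dominated convergence of indicators: they converge wherever \<open>infdist x A\<close>
  differs from \<open>r\<close>, hence almost everywhere.\<close>

lemma parallel_volume_tendsto:
  fixes A :: "'a::euclidean_space set" and B :: "nat \<Rightarrow> 'a set"
  assumes A: "compact A" "convex A" "A \<noteq> {}" and r: "0 < r"
    and AB: "\<And>k x. \<bar>infdist x (B k) - infdist x A\<bar> \<le> e k" and e: "e \<longlonglongrightarrow> 0"
  shows "(\<lambda>k. parallel_volume (B k) r) \<longlonglongrightarrow> parallel_volume A r"
proof -
  \<comment> \<open>From \<open>N\<close> on the error is at most 1, so the parallel body of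
    \<open>A\<close> of radius \<open>r + 1\<close> dominates all the indicators.\<close>
  obtain N where N: "\<And>k. k \<ge> N \<Longrightarrow> e k \<le> 1"
    using order_tendstoD(2)[OF e, of 1] by (auto simp: eventually_sequentially) (meson less_imp_le)
  define K where "K = {x. infdist x A \<le> r + 1}"
  have inf[measurable]: "(\<lambda>x. infdist x C) \<in> borel_measurable lborel" for C :: "'a set"
    by (simp, intro borel_measurable_continuous_onI continuous_intros)
  have Kfin: "emeasure lborel K < \<infinity>"
    unfolding K_def by (intro emeasure_bounded_finite bounded_infdist_le A)
  have [measurable]: "K \<in> sets borel" unfolding K_def by (intro borel_closed closed_infdist_le)
  have "(\<lambda>k. \<integral>x. indicator {x. infdist x (B (k + N)) \<le> r} x \<partial>lborel) \<longlonglongrightarrow> (\<integral>x. indicat_real {x. infdist x A \<le> r} x \<partial>lborel)"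
  proof (rule integral_dominated_convergence[where w = "indicator K"])
    show "integrable lborel (indicat_real K)" using Kfin by (simp add: less_top)
    have lim: "(\<lambda>k. infdist x (B (k + N))) \<longlonglongrightarrow> infdist x A" for x
    proof (rule LIM_zero_cancel, rule Lim_null_comparison)
      show "(\<lambda>k. e (k + N)) \<longlonglongrightarrow> 0" using e by (rule LIMSEQ_ignore_initial_segment)
    qed (use AB in auto)
    show "AE x in lborel. (\<lambda>k. indicat_real {x. infdist x (B (k + N)) \<le> r} x) \<longlonglongrightarrow> indicat_real {x. infdist x A \<le> r} x"
      using AE_infdist_neq[OF A r]
    proof eventually_elim
      case (elim x)
      show ?case
      proof (cases "infdist x A < r")
        case True
        then have "eventually (\<lambda>k. infdist x (B (k + N)) < r) sequentially" using lim by (rule order_tendstoD[rotated])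
        then have "eventually (\<lambda>k. indicat_real {x. infdist x (B (k + N)) \<le> r} x = 1) sequentially"
          by eventually_elim auto
        then show ?thesis using True by (auto intro: tendsto_eventually)
      next
        case False
        then have "r < infdist x A" using elim by simp
        then have "eventually (\<lambda>k. r < infdist x (B (k + N))) sequentially" using lim by (rule order_tendstoD[rotated])
        then have "eventually (\<lambda>k. indicat_real {x. infdist x (B (k + N)) \<le> r} x = 0) sequentially"
          by eventually_elim auto
        then show ?thesis using \<open>r < infdist x A\<close> by (auto intro: tendsto_eventually)
      qed
    qed
    show "AE x in lborel. norm (indicat_real {x. infdist x (B (k + N)) \<le> r} x) \<le> indicat_real K x" for k
    proof (rule AE_I2)
      fix x
      have "infdist x A \<le> infdist x (B (k + N)) + 1" using AB[of x "k + N"] N[of "k + N"] by auto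
      then show "norm (indicat_real {x. infdist x (B (k + N)) \<le> r} x) \<le> indicat_real K x"
        by (auto simp: indicator_def K_def)
    qed
  qed measurable
  then have "(\<lambda>k. parallel_volume (B (k + N)) r) \<longlonglongrightarrow> parallel_volume A r"
    by (simp add: parallel_volume_def)
  then show ?thesis by (rule LIMSEQ_offset)
qed

text \<open>The vertices are a finite \<open>e\<close>-net of \<open>A\<close> chosen inside
  \<open>A\<close>, so the polytope is contained in \<open>A\<close> and only one of the two
  inequalities costs \<open>e\<close>.\<close>

lemma polytope_approximation:
  fixes A :: "'a::euclidean_space set"
  assumes A: "compact A" "convex A" "A \<noteq> {}" and e: "0 < e"
  shows "\<exists>V. finite V \<and> V \<noteq> {} \<and> (\<forall>x. \<bar>infdist x (convex hull V) - infdist x A\<bar> \<le> e)"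
proof -
  obtain V where V: "finite V" "V \<subseteq> A" "A \<subseteq> (\<Union>x\<in>V. ball x e)"
    using seq_compact_imp_totally_bounded[of A] A(1) e by (auto simp: compact_eq_seq_compact_metric)
  have ne: "V \<noteq> {}" using V A by auto
  have sub: "convex hull V \<subseteq> A" using V A by (simp add: hull_minimal)
  have 1: "infdist x (convex hull V) \<le> infdist x A + e" for x
  proof (rule infdist_le_infdist_add)
    fix b assume "b \<in> A"
    then obtain v where v: "v \<in> V" "dist v b < e" using V by auto
    then have "infdist b (convex hull V) \<le> dist b v" by (intro infdist_le hull_inc)
    then show "infdist b (convex hull V) \<le> e" using v by (simp add: dist_commute)
  qed (use A compact_imp_closed in auto)
  have 2: "infdist x A \<le> infdist x (convex hull V)" for x
    using sub ne by (intro infdist_mono) auto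
  have "\<bar>infdist x (convex hull V) - infdist x A\<bar> \<le> e" for x using 1[of x] 2[of x] by auto
  then show ?thesis using V ne by auto
qed

text \<open>Being a polynomial of degree at most \<open>d\<close> is expressed as a linear identity
  between values at finitely many radii. In this form it passes from polytopes to their limits
  without any control of the coefficients.\<close>

lemma parallel_volume_interpolation:
  fixes A :: "'a::euclidean_space set"
  assumes A: "compact A" "convex A" "A \<noteq> {}" and r: "0 \<le> r"
  shows "parallel_volume A r = (\<Sum>j\<le>DIM('a). parallel_volume A (real (Suc j)) * poly (lagrange_basis DIM('a) j) r)"
proof -
  let ?R = "\<lambda>A r. \<Sum>j\<le>DIM('a). parallel_volume A (real (Suc j)) * poly (lagrange_basis DIM('a) j) r"
  have poly: "parallel_volume (convex hull V) r = ?R (convex hull V) r" if V: "finite V" "V \<noteq> {}" and r: "0 < r" for V :: "'a set" and r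
  proof -
    obtain q where q: "degree q \<le> DIM('a)" "\<And>t. t > 0 \<Longrightarrow> parallel_volume (convex hull V) t = poly q t"
      using parallel_volume_polytope[OF V] by (auto simp: parallel_volume_def)
    have "poly q r = poly (\<Sum>j\<le>DIM('a). smult (poly q (real (Suc j))) (lagrange_basis DIM('a) j)) r"
      using lagrange_interpolation[OF q(1)] by simp
    then show ?thesis using r by (simp add: q(2) poly_sum del: of_nat_Suc)
  qed
  have pos: "parallel_volume A r = ?R A r" if r: "0 < r" for r
  proof -
    have "\<forall>n. \<exists>V. finite V \<and> V \<noteq> {} \<and> (\<forall>x. \<bar>infdist x (convex hull V) - infdist x A\<bar> \<le> inverse (real (Suc n)))"
      using polytope_approximation[OF A] by simp
    then obtain V where V: "\<And>n. finite (V n)" "\<And>n. V n \<noteq> {}"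
        "\<And>n x. \<bar>infdist x (convex hull V n) - infdist x A\<bar> \<le> inverse (real (Suc n))"
      by metis
    have lim: "(\<lambda>n. parallel_volume (convex hull V n) t) \<longlonglongrightarrow> parallel_volume A t" if "0 < t" for t
      by (rule parallel_volume_tendsto[OF A that V(3) LIMSEQ_inverse_real_of_nat])
    have "(\<lambda>n. ?R (convex hull V n) r) \<longlonglongrightarrow> ?R A r"
      by (intro tendsto_intros lim) auto
    moreover have "(\<lambda>n. ?R (convex hull V n) r) = (\<lambda>n. parallel_volume (convex hull V n) r)"
      using poly[OF V(1,2) r] by simp
    ultimately show ?thesis using lim[OF r] LIMSEQ_unique by auto
  qed
  show ?thesis
  \<comment> \<open>At radius 0 the level set is \<open>A\<close> itself, which need not be null, so
    the limit along positive radii is taken by continuity of the measure from above.\<close>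
  proof (cases "r = 0")
    case True
    have "(\<lambda>n. parallel_volume A (inverse (real (Suc n)))) \<longlonglongrightarrow> measure lborel (\<Inter>n. {x. infdist x A \<le> inverse (real (Suc n))})"
      unfolding parallel_volume_def
    proof (rule Lim_measure_decseq)
      show "range (\<lambda>n. {x. infdist x A \<le> inverse (real (Suc n))}) \<subseteq> sets lborel"
        using closed_infdist_le by (auto intro!: borel_closed)
      have "inverse (real (Suc n)) \<le> inverse (real (Suc m))" if "m \<le> n" for m n
        using that by (simp add: field_simps)
      then show "decseq (\<lambda>n. {x. infdist x A \<le> inverse (real (Suc n))})"
        unfolding decseq_def by (blast intro: order_trans)
      show "emeasure lborel {x. infdist x A \<le> inverse (real (Suc i))} \<noteq> \<infinity>" for i
        using emeasure_bounded_finite[OF bounded_infdist_le[OF A(1,3)]] by (simp add: less_top)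
    qed
    also have "(\<Inter>n. {x. infdist x A \<le> inverse (real (Suc n))}) = {x. infdist x A \<le> 0}"
    proof (intro set_eqI iffI)
      fix x assume "x \<in> (\<Inter>n. {x. infdist x A \<le> inverse (real (Suc n))})"
      then have "\<And>n. infdist x A \<le> inverse (real (Suc n))" by auto
      then have "infdist x A \<le> 0"
        by (intro LIMSEQ_le_const[OF LIMSEQ_inverse_real_of_nat]) auto
      then show "x \<in> {x. infdist x A \<le> 0}" by simp
    next
      fix x assume "x \<in> {x. infdist x A \<le> 0}"
      then show "x \<in> (\<Inter>n. {x. infdist x A \<le> inverse (real (Suc n))})"
        by (auto intro: order_trans[of _ 0])
    qed
    finally have "(\<lambda>n. parallel_volume A (inverse (real (Suc n)))) \<longlonglongrightarrow> parallel_volume A 0"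
      by (simp add: parallel_volume_def)
    moreover have "(\<lambda>n. ?R A (inverse (real (Suc n)))) \<longlonglongrightarrow> ?R A 0"
      by (intro tendsto_intros LIMSEQ_inverse_real_of_nat)
    moreover have "(\<lambda>n. ?R A (inverse (real (Suc n)))) = (\<lambda>n. parallel_volume A (inverse (real (Suc n))))"
      using pos by auto
    ultimately show ?thesis using True LIMSEQ_unique by metis
  qed (use pos r in auto)
qed

lemma Minkowski_sum_ball_eq_infdist_le:
  fixes A :: "'a::euclidean_space set"
  assumes "compact A" "A \<noteq> {}" "0 \<le> r"
  shows "{x + r *\<^sub>R y |x y. x \<in> A \<and> y \<in> cball 0 1} = {x. infdist x A \<le> r}"
proof (intro set_eqI iffI)
  fix z assume "z \<in> {x + r *\<^sub>R y |x y. x \<in> A \<and> y \<in> cball 0 1}"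
  then obtain x y where z: "z = x + r *\<^sub>R y" "x \<in> A" "norm y \<le> 1" by auto
  then have "infdist z A \<le> dist z x" by (intro infdist_le)
  also have "\<dots> \<le> r" using z assms by (simp add: dist_norm mult_left_le)
  finally show "z \<in> {x. infdist x A \<le> r}" by simp
next
  fix z assume z: "z \<in> {x. infdist x A \<le> r}"
  obtain a where a: "a \<in> A" "infdist z A = dist z a"
    using infdist_attains_inf[of A z] assms compact_imp_closed by blast
  show "z \<in> {x + r *\<^sub>R y |x y. x \<in> A \<and> y \<in> cball 0 1}"
  proof (cases "r = 0")
    case True
    then have "z = a" using z a by simp
    then show ?thesis using True a(1) by (auto intro!: exI[of _ 0])
  next
    case False
    have "norm ((1/r) *\<^sub>R (z - a)) \<le> 1"
      using False z a assms by (simp add: dist_norm divide_le_eq del: scaleR_diff_right)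
    then have "z = a + r *\<^sub>R ((1/r) *\<^sub>R (z - a))" "(1/r) *\<^sub>R (z - a) \<in> cball 0 1"
      using False by auto
    then show ?thesis using a(1) by blast
  qed
qed

lemma poly_eq_sum_atMost:
  fixes p :: "real poly"
  assumes "degree p \<le> d"
  shows "poly p x = (\<Sum>i\<le>d. coeff p i * x ^ i)"
  unfolding poly_altdef using assms by (intro sum.mono_neutral_left) (auto simp: coeff_eq_0)

lemma unit_ball_vol_of_nat_neq_0: "unit_ball_vol (real n) \<noteq> 0"
  by (metis unit_ball_vol_pos of_nat_0_le_iff less_irrefl)

text \<open>The coefficients of the interpolating polynomial, regrouped by powers of the radius.
  Every intrinsic volume thus becomes a fixed linear combination of the parallel volumes at the
  radii 1, ..., d + 1, and continuity is inherited from those.\<close>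

lemma steiner_formula_parallel_volume:
  fixes A :: "'a::euclidean_space set"
  assumes A: "compact A" "convex A" "A \<noteq> {}"
  shows "steiner_formula A (\<lambda>m. (\<Sum>j\<le>DIM('a). parallel_volume A (real (Suc j)) * coeff (lagrange_basis DIM('a) j) (DIM('a) - m)) / unit_ball_vol (real (DIM('a) - m)))"
  unfolding steiner_formula_def
proof (intro allI impI)
  fix r :: real assume r: "0 \<le> r"
  let ?d = "DIM('a)" and ?f = "\<lambda>j. parallel_volume A (real (Suc j))"
  note ub = unit_ball_vol_of_nat_neq_0
  have "(\<Sum>m\<le>?d. r ^ (?d - m) * unit_ball_vol (real (?d - m)) * ((\<Sum>j\<le>?d. ?f j * coeff (lagrange_basis ?d j) (?d - m)) / unit_ball_vol (real (?d - m))))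
      = (\<Sum>m\<le>?d. r ^ (?d - m) * (\<Sum>j\<le>?d. ?f j * coeff (lagrange_basis ?d j) (?d - m)))"
    using ub by (simp del: of_nat_diff of_nat_Suc)
  also have "\<dots> = (\<Sum>i\<le>?d. r ^ i * (\<Sum>j\<le>?d. ?f j * coeff (lagrange_basis ?d j) i))"
    by (rule sum.reindex_bij_witness[of _ "\<lambda>i. ?d - i" "\<lambda>i. ?d - i"]) auto
  also have "\<dots> = (\<Sum>i\<le>?d. \<Sum>j\<le>?d. r ^ i * (?f j * coeff (lagrange_basis ?d j) i))"
    by (simp add: sum_distrib_left)
  also have "\<dots> = (\<Sum>j\<le>?d. \<Sum>i\<le>?d. r ^ i * (?f j * coeff (lagrange_basis ?d j) i))"
    by (rule sum.swap)
  also have "\<dots> = (\<Sum>j\<le>?d. ?f j * (\<Sum>i\<le>?d. coeff (lagrange_basis ?d j) i * r ^ i))"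
    by (simp add: sum_distrib_left mult_ac)
  also have "\<dots> = (\<Sum>j\<le>?d. ?f j * poly (lagrange_basis ?d j) r)"
    by (intro sum.cong refl) (simp add: poly_eq_sum_atMost[OF degree_lagrange_basis])
  also have "\<dots> = parallel_volume A r" by (rule parallel_volume_interpolation[OF A r, symmetric])
  also have "\<dots> = measure lborel {x + r *\<^sub>R y |x y. x \<in> A \<and> y \<in> cball 0 1}"
    unfolding Minkowski_sum_ball_eq_infdist_le[OF A(1,3) r] parallel_volume_def by (rule refl)
  finally show "measure lborel {x + r *\<^sub>R y |x y. x \<in> A \<and> y \<in> cball 0 1} =
    (\<Sum>m\<le>?d. r ^ (?d - m) * unit_ball_vol (real (?d - m)) * ((\<Sum>j\<le>?d. ?f j * coeff (lagrange_basis ?d j) (?d - m)) / unit_ball_vol (real (?d - m))))"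
    by (rule sym)
qed

lemma intrinsic_volume_tendsto:
  fixes A :: "'a::euclidean_space set" and B :: "nat \<Rightarrow> 'a set"
  assumes m: "m \<le> DIM('a)"
    and A: "compact A" "convex A" "A \<noteq> {}" and B: "\<And>k. compact (B k)" "\<And>k. convex (B k)" "\<And>k. B k \<noteq> {}"
    and lim: "(\<lambda>k. hausdorff_dist A (B k)) \<longlonglongrightarrow> 0"
  shows "(\<lambda>k. intrinsic_volume m (B k)) \<longlonglongrightarrow> intrinsic_volume m A"
proof -
  have "(\<lambda>k. parallel_volume (B k) r) \<longlonglongrightarrow> parallel_volume A r" if "0 < r" for r
  proof (rule parallel_volume_tendsto[OF A that _ lim])
    show "\<bar>infdist x (B k) - infdist x A\<bar> \<le> hausdorff_dist A (B k)" for k x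
      using abs_infdist_diff_le_hausdorff_dist[OF A(1,3) B(1,3), of x k] by (simp add: abs_minus_commute)
  qed
  then show ?thesis
    unfolding intrinsic_volume_eqI[OF steiner_formula_parallel_volume[OF A] m]
      intrinsic_volume_eqI[OF steiner_formula_parallel_volume[OF B] m]
    using unit_ball_vol_of_nat_neq_0 by (intro tendsto_intros) auto
qed

text \<open>The parallel body of \<open>c A\<close> at radius \<open>r\<close> is \<open>c\<close>
  times that of \<open>A\<close> at radius \<open>r / c\<close>; comparing coefficients is
  legitimate because the Steiner coefficients are unique.\<close>

lemma intrinsic_volume_scaleR:
  fixes A :: "'a::euclidean_space set"
  assumes m: "m \<le> DIM('a)" and A: "compact A" "convex A" "A \<noteq> {}" and c: "0 < c"
  shows "intrinsic_volume m ((\<lambda>x. c *\<^sub>R x) ` A) = c ^ m * intrinsic_volume m A"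
proof -
  let ?d = "DIM('a)" and ?A = "(\<lambda>x. c *\<^sub>R x) ` A"
  define V where "V m = (\<Sum>j\<le>DIM('a). parallel_volume A (real (Suc j)) * coeff (lagrange_basis DIM('a) j) (DIM('a) - m)) / unit_ball_vol (real (DIM('a) - m))" for m
  have V: "steiner_formula A V"
    using steiner_formula_parallel_volume[OF A] by (simp add: V_def[abs_def])
  have "steiner_formula ?A (\<lambda>m. c ^ m * V m)"
    unfolding steiner_formula_def
  proof (intro allI impI)
    fix r :: real assume r: "0 \<le> r"
    have *: "{x + r *\<^sub>R y |x y. x \<in> ?A \<and> y \<in> cball 0 1} = (\<lambda>x. c *\<^sub>R x + 0) ` {x + (r/c) *\<^sub>R y |x y. x \<in> A \<and> y \<in> cball 0 1}" (is "?L = _ ` ?B")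
    proof (intro set_eqI iffI)
      fix z assume "z \<in> ?L"
      then obtain x y where "z = c *\<^sub>R x + r *\<^sub>R y" "x \<in> A" "y \<in> cball 0 1" by auto
      then show "z \<in> (\<lambda>x. c *\<^sub>R x + 0) ` ?B"
        using c by (intro image_eqI[of _ _ "x + (r/c) *\<^sub>R y"]) (simp add: scaleR_add_right, blast)
    next
      fix z assume "z \<in> (\<lambda>x. c *\<^sub>R x + 0) ` ?B"
      then obtain x y where "z = c *\<^sub>R (x + (r/c) *\<^sub>R y)" "x \<in> A" "y \<in> cball 0 1" by auto
      then show "z \<in> ?L" using c by (auto simp: scaleR_add_right)
    qed

    have "compact ?A" "?A \<noteq> {}" using A by (auto intro: compact_scaling)
    then have L: "?L \<in> sets borel"
      using r by (subst Minkowski_sum_ball_eq_infdist_le) (auto intro!: borel_closed closed_infdist_le)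
    \<comment> \<open>With an empty orthonormal set the stretch is plain multiplication by
      \<open>c\<close>, so the stretch lemma gives the factor \<open>c ^ d\<close>.\<close>
    have "(\<lambda>x. c *\<^sub>R x + (1 - c) *\<^sub>R (\<Sum>b\<in>{}. (x \<bullet> b) *\<^sub>R b)) -` ?L = ?B"
      unfolding * using c by (auto simp: image_iff) blast
    then have "emeasure lborel ?L = ennreal (c ^ ?d) * emeasure lborel ?B"
      using emeasure_lborel_vimage_stretch[of "{}" c ?L] c L by simp
    then have "enn2real (emeasure lborel ?L) = enn2real (ennreal (c ^ ?d) * emeasure lborel ?B)"
      by (rule arg_cong)
    then have "measure lborel ?L = c ^ ?d * measure lborel ?B"
      using c by (simp only: measure_def enn2real_mult enn2real_ennreal zero_le_power less_imp_le)
    also have "\<dots> = c ^ ?d * (\<Sum>m\<le>?d. (r/c) ^ (?d - m) * unit_ball_vol (real (?d - m)) * V m)"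
      using V r c by (simp add: steiner_formula_def)
    also have "\<dots> = (\<Sum>m\<le>?d. r ^ (?d - m) * unit_ball_vol (real (?d - m)) * (c ^ m * V m))"
      unfolding sum_distrib_left
    proof (intro sum.cong refl)
      fix m assume "m \<in> {..?d}"
      then have "c ^ ?d = c ^ m * c ^ (?d - m)" by (simp flip: power_add)
      then show "c ^ ?d * ((r/c) ^ (?d - m) * unit_ball_vol (real (?d - m)) * V m) = r ^ (?d - m) * unit_ball_vol (real (?d - m)) * (c ^ m * V m)"
        using c by (simp add: power_divide)
    qed
    finally show "measure lborel ?L = (\<Sum>m\<le>?d. r ^ (?d - m) * unit_ball_vol (real (?d - m)) * (c ^ m * V m))" .
  qed
  from intrinsic_volume_eqI[OF this m] intrinsic_volume_eqI[OF V m] show ?thesis by simp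
qed


section \<open>Support functions and the Steiner point\<close>

lemma bdd_above_inner_compact:
  fixes A :: "'a::euclidean_space set"
  assumes "compact A"
  shows "bdd_above ((\<lambda>y. x \<bullet> y) ` A)"
proof -
  have "compact ((\<lambda>y. x \<bullet> y) ` A)" using assms by (intro compact_continuous_image continuous_intros)
  then show ?thesis by (intro bounded_imp_bdd_above compact_imp_bounded)
qed

lemma support_function_le:
  fixes A B :: "'a::euclidean_space set"
  assumes "compact A" "A \<noteq> {}" "compact B" "B \<noteq> {}" "norm x \<le> 1"
  shows "support_function A x \<le> support_function B x + hausdorff_dist A B"
  unfolding support_function_def
proof (rule cSUP_least)
  fix a assume a: "a \<in> A"
  obtain b where b: "b \<in> B" "infdist a B = dist a b"
    using infdist_attains_inf[of B a] assms compact_imp_closed by blast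
  have "x \<bullet> a = x \<bullet> b + x \<bullet> (a - b)" by (simp add: inner_diff_right)
  also have "x \<bullet> (a - b) \<le> norm x * norm (a - b)" by (rule norm_cauchy_schwarz)
  also have "\<dots> \<le> 1 * norm (a - b)" using assms by (intro mult_right_mono) auto
  also have "\<dots> \<le> hausdorff_dist A B"
    using infdist_le_hausdorff_dist[OF assms(1,3,4) a] b by (simp add: dist_norm)
  also have "x \<bullet> b \<le> (SUP y\<in>B. x \<bullet> y)" by (intro cSUP_upper b bdd_above_inner_compact assms)
  finally show "x \<bullet> a \<le> (SUP y\<in>B. x \<bullet> y) + hausdorff_dist A B" by simp
qed (use assms in auto)

lemma abs_support_function_diff_le:
  fixes A B :: "'a::euclidean_space set"
  assumes "compact A" "A \<noteq> {}" "compact B" "B \<noteq> {}" "norm x \<le> 1"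
  shows "\<bar>support_function A x - support_function B x\<bar> \<le> hausdorff_dist A B"
  using support_function_le[OF assms] support_function_le[OF assms(3,4,1,2,5)]
  by (simp add: hausdorff_dist_commute[of B A])

text \<open>Regularity in the direction instead of in the body; it makes the integrand of the
  Steiner point measurable and bounds it on the sphere.\<close>

lemma abs_support_function_diff_le_norm:
  fixes A :: "'a::euclidean_space set"
  assumes A: "compact A" "A \<noteq> {}" "\<And>a. a \<in> A \<Longrightarrow> norm a \<le> M"
  shows "\<bar>support_function A x - support_function A y\<bar> \<le> M * norm (x - y)"
proof -
  have *: "support_function A x \<le> support_function A y + M * norm (x - y)" for x y
    unfolding support_function_def
  proof (rule cSUP_least)
    fix a assume a: "a \<in> A"
    have "x \<bullet> a = y \<bullet> a + (x - y) \<bullet> a" by (simp add: inner_diff_left)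
    also have "(x - y) \<bullet> a \<le> norm (x - y) * norm a" by (rule norm_cauchy_schwarz)
    also have "\<dots> \<le> norm (x - y) * M" using A(3)[OF a] by (intro mult_left_mono) auto
    also have "y \<bullet> a \<le> (SUP z\<in>A. y \<bullet> z)" by (intro cSUP_upper a bdd_above_inner_compact A)
    finally show "x \<bullet> a \<le> (SUP z\<in>A. y \<bullet> z) + M * norm (x - y)" by (simp add: mult.commute)
  qed (use A in auto)
  show ?thesis using *[of x y] *[of y x] by (simp add: norm_minus_commute)
qed

lemma continuous_on_support_function:
  fixes A :: "'a::euclidean_space set"
  assumes A: "compact A" "A \<noteq> {}"
  shows "continuous_on S (support_function A)"
proof -
  obtain M where M: "0 < M" "\<And>a. a \<in> A \<Longrightarrow> norm a \<le> M"
    using compact_imp_bounded[OF A(1)] bounded_pos by metis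
  show ?thesis
  proof (rule continuous_onI)
    fix x e :: real and x0 assume "0 < (e::real)"
    then show "\<exists>d>0. \<forall>x'\<in>S. dist x' x0 < d \<longrightarrow> dist (support_function A x') (support_function A x0) \<le> e"
      using M(1) abs_support_function_diff_le_norm[OF A M(2)]
      by (intro exI[of _ "e / M"]) (auto simp: dist_norm field_simps, smt (verit, best) mult.commute)
  qed
qed

lemma space_sphere_measure: "space (sphere_measure :: 'a::euclidean_space measure) = sphere 0 1"
  by (simp add: sphere_measure_def space_scale_measure space_restrict_space)

lemma sets_sphere_measure: "sets (sphere_measure :: 'a::euclidean_space measure) = sets (restrict_space borel (sphere 0 1))"
  by (simp add: sphere_measure_def)

lemma finite_measure_sphere_measure: "finite_measure (sphere_measure :: 'a::euclidean_space measure)"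
  by (intro finite_measureI)
    (simp add: space_sphere_measure emeasure_sphere_measure_sphere ennreal_mult_eq_top_iff)

lemma measurable_sphere_measureI:
  fixes f :: "'a::euclidean_space \<Rightarrow> 'b::topological_space"
  assumes "continuous_on UNIV f"
  shows "f \<in> borel_measurable sphere_measure"
proof -
  have "f \<in> borel_measurable (restrict_space borel (sphere 0 1))"
    using borel_measurable_continuous_onI[OF assms] by (rule measurable_restrict_space1)
  then show ?thesis by (simp cong: measurable_cong_sets add: sets_sphere_measure)
qed

lemma borel_measurable_support_function_scaleR:
  fixes A :: "'a::euclidean_space set"
  assumes "compact A" "A \<noteq> {}"
  shows "(\<lambda>\<theta>. support_function A \<theta> *\<^sub>R \<theta>) \<in> borel_measurable sphere_measure"
  by (intro measurable_sphere_measureI continuous_intros continuous_on_support_function assms)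

text \<open>On the unit sphere the support functions converge uniformly, at the rate of the
  Hausdorff distance, and the surface measure is finite.\<close>

lemma steiner_point_tendsto:
  fixes A :: "'a::euclidean_space set" and B :: "nat \<Rightarrow> 'a set"
  assumes A: "compact A" "A \<noteq> {}" and B: "\<And>k. compact (B k)" "\<And>k. B k \<noteq> {}"
    and lim: "(\<lambda>k. hausdorff_dist A (B k)) \<longlonglongrightarrow> 0"
  shows "(\<lambda>k. steiner_point (B k)) \<longlonglongrightarrow> steiner_point A"
proof -
  interpret finite_measure "sphere_measure :: 'a measure" by (rule finite_measure_sphere_measure)
  obtain M where M: "0 < M" "\<And>a. a \<in> A \<Longrightarrow> norm a \<le> M"
    using compact_imp_bounded[OF A(1)] bounded_pos by metis
  obtain C where C: "\<And>k. \<bar>hausdorff_dist A (B k)\<bar> \<le> C"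
    using convergent_imp_Bseq[OF convergentI[OF lim]] by (auto simp: Bseq_def)
  have supp0: "support_function A 0 = 0" using A(2) by (simp add: support_function_def)
  have hA: "\<bar>support_function A x\<bar> \<le> M * norm x" for x
    using abs_support_function_diff_le_norm[OF A M(2), of x 0] supp0 by simp
  have d: "\<bar>support_function (B k) x - support_function A x\<bar> \<le> hausdorff_dist A (B k)" if "norm x \<le> 1" for k x
    using abs_support_function_diff_le[OF A B that, of k] by (simp add: abs_minus_commute)
  have "(\<lambda>k. \<integral>\<theta>. support_function (B k) \<theta> *\<^sub>R \<theta> \<partial>sphere_measure) \<longlonglongrightarrow> (\<integral>\<theta>. support_function A \<theta> *\<^sub>R \<theta> \<partial>sphere_measure)"
  proof (rule integral_dominated_convergence[where w = "\<lambda>_. C + M"])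
    show "AE x in sphere_measure. (\<lambda>k. support_function (B k) x *\<^sub>R x) \<longlonglongrightarrow> support_function A x *\<^sub>R (x::'a)"
    proof (rule AE_I2)
      fix x :: 'a assume "x \<in> space sphere_measure"
      then have x: "norm x \<le> 1" by (simp add: space_sphere_measure)
      have "(\<lambda>k. support_function (B k) x) \<longlonglongrightarrow> support_function A x"
        by (rule LIM_zero_cancel, rule Lim_null_comparison[OF _ lim]) (use d[OF x] in auto)
      then show "(\<lambda>k. support_function (B k) x *\<^sub>R x) \<longlonglongrightarrow> support_function A x *\<^sub>R x"
        by (intro tendsto_intros)
    qed
    show "AE x in sphere_measure. norm (support_function (B k) x *\<^sub>R (x::'a)) \<le> C + M" for k
    proof (rule AE_I2)
      fix x :: 'a assume "x \<in> space sphere_measure"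
      then have x: "norm x = 1" by (simp add: space_sphere_measure)
      have "\<bar>support_function (B k) x\<bar> \<le> \<bar>support_function (B k) x - support_function A x\<bar> + \<bar>support_function A x\<bar>" by simp
      also have "\<dots> \<le> C + M" using d[of x k] C[of k] hA[of x] x by simp
      finally show "norm (support_function (B k) x *\<^sub>R x) \<le> C + M" using x by simp
    qed
  qed (use A B borel_measurable_support_function_scaleR in auto)
  then show ?thesis unfolding steiner_point_def by (intro tendsto_intros)
qed

lemma steiner_point_scaleR:
  fixes A :: "'a::euclidean_space set"
  assumes A: "compact A" "A \<noteq> {}" and c: "0 < c"
  shows "steiner_point ((\<lambda>x. c *\<^sub>R x) ` A) = c *\<^sub>R steiner_point A"
proof -
  have "support_function ((\<lambda>x. c *\<^sub>R x) ` A) x = c * support_function A x" for x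
  proof (rule antisym)
    show "support_function ((\<lambda>x. c *\<^sub>R x) ` A) x \<le> c * support_function A x"
      unfolding support_function_def using A c
      by (intro cSUP_least) (auto intro!: mult_left_mono cSUP_upper bdd_above_inner_compact)
    have "support_function A x \<le> support_function ((\<lambda>x. c *\<^sub>R x) ` A) x / c"
      unfolding support_function_def
    proof (rule cSUP_least)
      fix y assume "y \<in> A"
      then have "x \<bullet> (c *\<^sub>R y) \<le> (SUP y\<in>(\<lambda>x. c *\<^sub>R x) ` A. x \<bullet> y)"
        using A by (intro cSUP_upper bdd_above_inner_compact compact_scaling) auto
      then show "x \<bullet> y \<le> (SUP y\<in>(\<lambda>x. c *\<^sub>R x) ` A. x \<bullet> y) / c" using c by (simp add: field_simps)
    qed (use A in auto)
    then show "c * support_function A x \<le> support_function ((\<lambda>x. c *\<^sub>R x) ` A) x"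
      using c by (simp add: field_simps)
  qed
  then show ?thesis
    by (simp add: steiner_point_def flip: scaleR_scaleR) (simp add: scaleR_left_commute)
qed

section \<open>Convergence in distribution\<close>

lemma space_borel_of [simp]: "space (borel_of T) = topspace T"
  unfolding borel_of_def by (rule space_measure_of) (auto dest: openin_subset)

lemma sets_borel_of: "sets (borel_of T) = sigma_sets (topspace T) {U. openin T U}"
  unfolding borel_of_def by (rule sets_measure_of) (auto dest: openin_subset)

lemma measurable_continuous_map_borel_of:
  fixes f :: "'a \<Rightarrow> 'b::topological_space"
  assumes "continuous_map T euclidean f"
  shows "f \<in> borel_measurable (borel_of T)"
proof (rule borel_measurableI)
  fix S :: "'b set" assume "open S"
  then have "openin T {x \<in> topspace T. f x \<in> S}"
    using assms by (intro openin_continuous_map_preimage[of T euclidean]) auto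
  moreover have "f -` S \<inter> space (borel_of T) = {x \<in> topspace T. f x \<in> S}" by auto
  ultimately show "f -` S \<inter> space (borel_of T) \<in> sets (borel_of T)"
    unfolding sets_borel_of by (simp only:) (rule sigma_sets.Basic, simp)
qed

lemma converges_in_distribution_continuous_map:
  fixes f :: "'a \<Rightarrow> 'b::topological_space"
  assumes conv: "converges_in_distribution T M Z N Z'" and f: "continuous_map T euclidean f"
  shows "converges_in_distribution euclidean M (\<lambda>n \<omega>. f (Z n \<omega>)) N (\<lambda>\<omega>. f (Z' \<omega>))"
  unfolding converges_in_distribution_def borel_of_euclidean
proof (intro conjI allI impI)
  note mf = measurable_continuous_map_borel_of[OF f]
  show "(\<lambda>\<omega>. f (Z n \<omega>)) \<in> borel_measurable M" for n
    using conv measurable_compose[OF _ mf] by (auto simp: converges_in_distribution_def)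
  show "(\<lambda>\<omega>. f (Z' \<omega>)) \<in> borel_measurable N"
    using conv measurable_compose[OF _ mf] by (auto simp: converges_in_distribution_def)
  fix g :: "'b \<Rightarrow> real"
  assume g: "continuous_map euclidean euclideanreal g \<and> bounded (g ` topspace euclidean)"
  then have "continuous_map T euclideanreal (g \<circ> f)" using f continuous_map_compose by blast
  moreover have "bounded ((g \<circ> f) ` topspace T)"
    using g by (auto intro: bounded_subset)
  ultimately have "(\<lambda>n. \<integral>\<omega>. (g \<circ> f) (Z n \<omega>) \<partial>M) \<longlonglongrightarrow> (\<integral>\<omega>. (g \<circ> f) (Z' \<omega>) \<partial>N)"
    using conv unfolding converges_in_distribution_def by blast
  then show "(\<lambda>n. \<integral>\<omega>. g (f (Z n \<omega>)) \<partial>M) \<longlonglongrightarrow> (\<integral>\<omega>. g (f (Z' \<omega>)) \<partial>N)"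
    by (simp add: comp_def)
qed

lemma (in prob_space) abs_integral_diff_le:
  fixes f g :: "'a \<Rightarrow> real"
  assumes "integrable M f" "integrable M g" "\<And>x. x \<in> space M \<Longrightarrow> \<bar>f x - g x\<bar> \<le> c"
  shows "\<bar>(\<integral>x. f x \<partial>M) - (\<integral>x. g x \<partial>M)\<bar> \<le> c"
proof -
  have "\<bar>(\<integral>x. f x \<partial>M) - (\<integral>x. g x \<partial>M)\<bar> = \<bar>\<integral>x. f x - g x \<partial>M\<bar>" using assms by simp
  also have "\<dots> \<le> (\<integral>x. \<bar>f x - g x\<bar> \<partial>M)" using integral_abs_bound by blast
  also have "\<dots> \<le> (\<integral>x. c \<partial>M)" using assms by (intro integral_mono) auto
  finally show ?thesis by (simp add: prob_space)
qed

lemma (in prob_space) integrable_bounded: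
  fixes f :: "'a \<Rightarrow> real"
  assumes "f \<in> borel_measurable M" "\<And>x. x \<in> space M \<Longrightarrow> \<bar>f x\<bar> \<le> B"
  shows "integrable M f"
  using assms by (intro integrable_const_bound[where B = B]) auto

lemma (in prob_space) exists_norm_bound:
  fixes Z :: "'a \<Rightarrow> 'b::real_normed_vector"
  assumes [measurable]: "Z \<in> borel_measurable M" and "0 < \<delta>"
  shows "\<exists>R::nat. prob {\<omega> \<in> space M. real R < norm (Z \<omega>)} < \<delta>"
proof -
  have "(\<lambda>n. prob {\<omega> \<in> space M. real n < norm (Z \<omega>)}) \<longlonglongrightarrow> prob (\<Inter>n. {\<omega> \<in> space M. real n < norm (Z \<omega>)})"
    by (rule finite_Lim_measure_decseq) (auto simp: decseq_def intro: le_less_trans of_nat_mono)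
  moreover have "(\<Inter>n. {\<omega> \<in> space M. real n < norm (Z \<omega>)}) = {}"
    using reals_Archimedean2 by (auto, metis less_asym)
  ultimately have "eventually (\<lambda>n. prob {\<omega> \<in> space M. real n < norm (Z \<omega>)} < \<delta>) sequentially"
    using assms(2) by (intro order_tendstoD) auto
  then show ?thesis by (auto simp: eventually_sequentially)
qed

section \<open>Lipschitz test functions on a metric space\<close>

context Metric_space
begin

lemma continuous_map_sequentiallyI:
  fixes f :: "'a \<Rightarrow> 'b::topological_space"
  assumes "\<And>a s. a \<in> M \<Longrightarrow> (\<And>n. s n \<in> M) \<Longrightarrow> (\<lambda>n. d a (s n)) \<longlonglongrightarrow> 0 \<Longrightarrow> (\<lambda>n. f (s n)) \<longlonglongrightarrow> f a"
  shows "continuous_map mtopology euclidean f"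
  unfolding continuous_map_def
proof (intro conjI allI impI)
  fix U :: "'b set" assume "openin euclidean U"
  then have U: "open U" by simp
  have "\<exists>r>0. mball x r \<subseteq> {x \<in> M. f x \<in> U}" if x: "x \<in> M" "f x \<in> U" for x
  proof (rule ccontr)
    assume neg: "\<not> (\<exists>r>0. mball x r \<subseteq> {x \<in> M. f x \<in> U})"
    have "\<forall>n. \<exists>y. y \<in> mball x (inverse (real (Suc n))) \<and> f y \<notin> U"
    proof
      fix n
      have "0 < inverse (real (Suc n))" by simp
      with neg obtain y where "y \<in> mball x (inverse (real (Suc n)))" "y \<notin> {x \<in> M. f x \<in> U}" by blast
      then show "\<exists>y. y \<in> mball x (inverse (real (Suc n))) \<and> f y \<notin> U" by auto
    qed
    then obtain s where s: "\<And>n. s n \<in> mball x (inverse (real (Suc n)))" "\<And>n. f (s n) \<notin> U" by metis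
    have "(\<lambda>n. d x (s n)) \<longlonglongrightarrow> 0"
      by (rule Lim_null_comparison[OF _ LIMSEQ_inverse_real_of_nat])
         (use s(1) in \<open>auto intro!: always_eventually intro: less_imp_le\<close>)
    then have "(\<lambda>n. f (s n)) \<longlonglongrightarrow> f x" using s(1) x by (intro assms) auto
    then have "eventually (\<lambda>n. f (s n) \<in> U) sequentially" using U x(2) by (rule topological_tendstoD)
    then show False using s(2) by auto
  qed
  then show "openin mtopology {x \<in> topspace mtopology. f x \<in> U}"
    by (auto simp: openin_mtopology)
qed auto

lemma lipschitz_continuous_map:
  fixes f :: "'a \<Rightarrow> real"
  assumes "\<And>x y. x \<in> M \<Longrightarrow> y \<in> M \<Longrightarrow> \<bar>f x - f y\<bar> \<le> L * d x y"
  shows "continuous_map mtopology euclidean f"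
proof (rule continuous_map_sequentiallyI)
  fix a s assume a: "a \<in> M" and s: "\<And>n. s n \<in> M" and lim: "(\<lambda>n. d a (s n)) \<longlonglongrightarrow> 0"
  have "(\<lambda>n. L * d a (s n)) \<longlonglongrightarrow> L * 0" by (intro tendsto_intros lim)
  then have lim0: "(\<lambda>n. L * d a (s n)) \<longlonglongrightarrow> 0" by simp
  have "norm (f (s n) - f a) \<le> L * d a (s n)" for n
    using assms[OF s a, of n] by (simp add: commute)
  then have "(\<lambda>n. f (s n) - f a) \<longlonglongrightarrow> 0"
    by (intro Lim_null_comparison[OF _ lim0] always_eventually) blast
  then show "(\<lambda>n. f (s n)) \<longlonglongrightarrow> f a" by (rule LIM_zero_cancel)
qed

text \<open>An open set is the set where the distance to its complement is positive, and that
  distance is a 1-Lipschitz function.\<close>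

lemma measurable_borel_of_mtopologyI:
  assumes Z: "Z \<in> space N \<rightarrow> M"
    and lip: "\<And>h::'a \<Rightarrow> real. (\<And>x y. x \<in> M \<Longrightarrow> y \<in> M \<Longrightarrow> \<bar>h x - h y\<bar> \<le> d x y) \<Longrightarrow> (\<lambda>\<omega>. h (Z \<omega>)) \<in> borel_measurable N"
  shows "Z \<in> N \<rightarrow>\<^sub>M borel_of mtopology"
  unfolding borel_of_def
proof (rule measurable_measure_of)
  fix U assume "U \<in> {U. openin mtopology U}"
  then have U: "U \<subseteq> M" "\<And>x. x \<in> U \<Longrightarrow> \<exists>r>0. mball x r \<subseteq> U" by (auto simp: openin_mtopology)
  show "Z -` U \<inter> space N \<in> sets N"
  \<comment> \<open>The infimum defining \<open>h\<close> is meaningful only over a nonempty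
    complement.\<close>
  proof (cases "M - U = {}")
    case True
    then have "Z -` U \<inter> space N = space N" using Z U by auto
    then show ?thesis by simp
  next
    case False
    define h where "h x = (INF y\<in>M - U. d x y)" for x
    have bdd: "bdd_below (d x ` (M - U))" for x by (intro bdd_belowI[of _ 0]) auto
    have h1: "h x \<le> h y + d x y" if "x \<in> M" "y \<in> M" for x y
    proof -
      have "h x - d x y \<le> h y"
        unfolding h_def[of y]
      proof (rule cINF_greatest[OF False])
        fix z assume z: "z \<in> M - U"
        have "h x \<le> d x z" unfolding h_def by (intro cINF_lower bdd z)
        also have "\<dots> \<le> d x y + d y z" using that z by (intro triangle) auto
        finally show "h x - d x y \<le> d y z" by simp
      qed
      then show ?thesis by simp
    qed
    have "(\<lambda>\<omega>. h (Z \<omega>)) \<in> borel_measurable N"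
    proof (rule lip)
      show "\<bar>h x - h y\<bar> \<le> d x y" if "x \<in> M" "y \<in> M" for x y
        using h1[OF that] h1[OF that(2,1)] by (simp add: commute)
    qed
    then have "{\<omega> \<in> space N. 0 < h (Z \<omega>)} \<in> sets N" by measurable
    moreover have "x \<in> U \<longleftrightarrow> 0 < h x" if x: "x \<in> M" for x
    proof
      assume "x \<in> U"
      then obtain r where r: "0 < r" "mball x r \<subseteq> U" using U by blast
      have "r \<le> h x" unfolding h_def
        using r x by (intro cINF_greatest[OF False]) (force simp: not_less[symmetric])
      then show "0 < h x" using r by simp
    next
      assume "0 < h x"
      show "x \<in> U"
      proof (rule ccontr)
        assume "x \<notin> U"
        then have "h x \<le> d x x" unfolding h_def using x by (intro cINF_lower bdd) auto
        then show False using \<open>0 < h x\<close> x by simp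
      qed
    qed
    then have "{\<omega> \<in> space N. 0 < h (Z \<omega>)} = Z -` U \<inter> space N" using Z by auto
    ultimately show ?thesis by simp
  qed
qed (use Z in \<open>auto simp: openin_mtopology\<close>)

text \<open>Infimal convolution with a multiple of the metric. Approximating from below is what
  turns convergence for Lipschitz functions into a lower bound for continuous ones.\<close>

lemma lower_lipschitz_approximation:
  fixes f :: "'a \<Rightarrow> real"
  assumes f: "continuous_map mtopology euclidean f" and B: "\<And>x. x \<in> M \<Longrightarrow> \<bar>f x\<bar> \<le> B"
  defines "g \<equiv> \<lambda>(k::nat) x. INF y\<in>M. f y + real k * d x y"
  shows "\<And>k x y. x \<in> M \<Longrightarrow> y \<in> M \<Longrightarrow> \<bar>g k x - g k y\<bar> \<le> real k * d x y"
    and "\<And>k x. x \<in> M \<Longrightarrow> \<bar>g k x\<bar> \<le> B"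
    and "\<And>k x. x \<in> M \<Longrightarrow> g k x \<le> f x"
    and "\<And>x. x \<in> M \<Longrightarrow> (\<lambda>k. g k x) \<longlonglongrightarrow> f x"
proof -
  have g_eq: "g k x = (INF y\<in>M. f y + real k * d x y)" for k x by (simp add: g_def)
  have lb: "- B \<le> f y + real k * d x y" if "y \<in> M" for x y k
  proof -
    have "- B \<le> f y" using B[OF that] by simp
    also have "\<dots> \<le> f y + real k * d x y" by simp
    finally show ?thesis .
  qed
  have bdd: "bdd_below ((\<lambda>y. f y + real k * d x y) ` M)" for x k
    by (intro bdd_belowI[of _ "- B"]) (use lb in auto)
  have g_le: "g k x \<le> f y + real k * d x y" if "y \<in> M" for k x y
    unfolding g_def by (intro cINF_lower bdd that)
  show gf: "g k x \<le> f x" if "x \<in> M" for k x using g_le[OF that, of k x] that by simp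
  have gB: "- B \<le> g k x" if "x \<in> M" for k x
    unfolding g_def using that lb by (intro cINF_greatest) auto
  show "\<bar>g k x\<bar> \<le> B" if "x \<in> M" for k x
    using gB[OF that, of k] gf[OF that, of k] B[OF that] by simp
  have g1: "g k x \<le> g k y + real k * d x y" if "x \<in> M" "y \<in> M" for k x y
  proof -
    have "g k x - real k * d x y \<le> g k y"
      unfolding g_eq[of k y]
    proof (rule cINF_greatest)
      fix z assume z: "z \<in> M"
      have "g k x \<le> f z + real k * d x z" by (rule g_le[OF z])
      also have "real k * d x z \<le> real k * (d x y + d y z)" using that z by (intro mult_left_mono triangle) auto
      finally show "g k x - real k * d x y \<le> f z + real k * d y z" by (simp add: distrib_left)
    qed (use that in auto)
    then show ?thesis by simp
  qed
  show "\<bar>g k x - g k y\<bar> \<le> real k * d x y" if "x \<in> M" "y \<in> M" for k x y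
    using g1[OF that, of k] g1[OF that(2,1), of k] by (simp add: commute)
  fix x assume x: "x \<in> M"
  show "(\<lambda>k. g k x) \<longlonglongrightarrow> f x"
  proof (rule LIMSEQ_I)
    fix e :: real assume e: "0 < e"
    have "openin mtopology {y \<in> topspace mtopology. f y \<in> {f x - e / 2<..}}"
      using f by (intro openin_continuous_map_preimage) auto
    then obtain r where r: "0 < r" "mball x r \<subseteq> {y \<in> M. f y \<in> {f x - e / 2<..}}"
      using x e by (auto simp: openin_mtopology)
    \<comment> \<open>Outside the ball of radius \<open>r\<close> the penalty \<open>k * r\<close>
      exceeds \<open>2 * B\<close>, the largest possible oscillation of \<open>f\<close>, so only
      points near \<open>x\<close> can compete in the infimum.\<close>
    obtain k0 :: nat where k0: "2 * B / r \<le> real k0" using real_arch_simple by blast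
    have "norm (g k x - f x) < e" if k: "k0 \<le> k" for k
    proof -
      have "f x - e / 2 \<le> g k x"
        unfolding g_def
      proof (rule cINF_greatest)
        fix y assume y: "y \<in> M"
        show "f x - e / 2 \<le> f y + real k * d x y"
        proof (cases "d x y < r")
          case True
          then have "f x - e / 2 < f y" using r x y by auto
          also have "\<dots> \<le> f y + real k * d x y" by simp
          finally show ?thesis by simp
        next
          case False
          have "2 * B \<le> real k0 * r" using k0 r by (simp add: divide_le_eq)
          also have "\<dots> \<le> real k * d x y" using False k r by (intro mult_mono) auto
          finally show ?thesis using B[OF x] B[OF y] e by simp
        qed
      qed (use x in auto)
      then show ?thesis using gf[OF x, of k] e by simp
    qed
    then show "\<exists>no. \<forall>n\<ge>no. norm (g n x - f x) < e" by blast
  qed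
qed

text \<open>A Lipschitz minorant of \<open>f\<close> with nearly the same limiting integral bounds
  the integrals of \<open>f\<close> from below in the limit; the same bound for \<open>- f\<close>
  supplies the other half.\<close>

lemma converges_in_distributionI:
  assumes "prob_space P" "prob_space Q"
    and Z: "\<And>n. Z n \<in> P \<rightarrow>\<^sub>M borel_of mtopology" and Z': "Z' \<in> Q \<rightarrow>\<^sub>M borel_of mtopology"
    and lip: "\<And>g::'a \<Rightarrow> real. (\<And>x. x \<in> M \<Longrightarrow> \<bar>g x\<bar> \<le> 1) \<Longrightarrow> (\<And>x y. x \<in> M \<Longrightarrow> y \<in> M \<Longrightarrow> \<bar>g x - g y\<bar> \<le> d x y) \<Longrightarrow>
      (\<lambda>n. \<integral>\<omega>. g (Z n \<omega>) \<partial>P) \<longlonglongrightarrow> (\<integral>\<omega>. g (Z' \<omega>) \<partial>Q)"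
  shows "converges_in_distribution mtopology P Z Q Z'"
proof -
  interpret P: prob_space P by fact
  interpret Q: prob_space Q by fact
  have ZM: "Z n \<omega> \<in> M" if "\<omega> \<in> space P" for n \<omega> using measurable_space[OF Z that] by simp
  have ZM': "Z' \<omega> \<in> M" if "\<omega> \<in> space Q" for \<omega> using measurable_space[OF Z' that] by simp
  have meas: "(\<lambda>\<omega>. g (Z n \<omega>)) \<in> borel_measurable P" "(\<lambda>\<omega>. g (Z' \<omega>)) \<in> borel_measurable Q"
    if "continuous_map mtopology euclidean g" for g :: "'a \<Rightarrow> real" and n
    using measurable_compose[OF Z measurable_continuous_map_borel_of[OF that]]
      measurable_compose[OF Z' measurable_continuous_map_borel_of[OF that]] by auto
  have int: "integrable P (\<lambda>\<omega>. g (Z n \<omega>))" "integrable Q (\<lambda>\<omega>. g (Z' \<omega>))"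
    if "continuous_map mtopology euclidean g" "\<And>x. x \<in> M \<Longrightarrow> \<bar>g x\<bar> \<le> B" for g :: "'a \<Rightarrow> real" and n B
    using meas[OF that(1)] ZM ZM' that(2) P.integrable_bounded Q.integrable_bounded by blast+
  have lower: "eventually (\<lambda>n. (\<integral>\<omega>. f (Z' \<omega>) \<partial>Q) - e < (\<integral>\<omega>. f (Z n \<omega>) \<partial>P)) sequentially"
    if f: "continuous_map mtopology euclidean f" and B: "\<And>x. x \<in> M \<Longrightarrow> \<bar>f x\<bar> \<le> B" and e: "0 < e"
    for f :: "'a \<Rightarrow> real" and B e
  proof -
    define g where "g = (\<lambda>(k::nat) x. INF y\<in>M. f y + real k * d x y)"
    have g: "\<And>k x y. x \<in> M \<Longrightarrow> y \<in> M \<Longrightarrow> \<bar>g k x - g k y\<bar> \<le> real k * d x y"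
        "\<And>k x. x \<in> M \<Longrightarrow> \<bar>g k x\<bar> \<le> B" "\<And>k x. x \<in> M \<Longrightarrow> g k x \<le> f x"
        "\<And>x. x \<in> M \<Longrightarrow> (\<lambda>k. g k x) \<longlonglongrightarrow> f x"
      unfolding g_def using lower_lipschitz_approximation[OF f] B by blast+
    have gc: "continuous_map mtopology euclidean (g k)" for k
      using g(1) by (rule lipschitz_continuous_map)
    have "(\<lambda>k. \<integral>\<omega>. g k (Z' \<omega>) \<partial>Q) \<longlonglongrightarrow> (\<integral>\<omega>. f (Z' \<omega>) \<partial>Q)"
      by (rule integral_dominated_convergence[where w = "\<lambda>_. B"])
         (use meas gc f g ZM' in auto)
    then have "eventually (\<lambda>k. (\<integral>\<omega>. f (Z' \<omega>) \<partial>Q) - e < (\<integral>\<omega>. g k (Z' \<omega>) \<partial>Q)) sequentially"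
      using e by (intro order_tendstoD) auto
    then obtain k where k: "(\<integral>\<omega>. f (Z' \<omega>) \<partial>Q) - e < (\<integral>\<omega>. g k (Z' \<omega>) \<partial>Q)"
      by (auto simp: eventually_sequentially)
    \<comment> \<open>Dividing by \<open>c\<close> brings both the bound and the Lipschitz constant
      of \<open>g k\<close> down to 1, as the assumption requires.\<close>
    define c where "c = max 1 (max B (real k))"
    have c: "0 < c" "B \<le> c" "real k \<le> c" by (auto simp: c_def)
    have "(\<lambda>n. \<integral>\<omega>. g k (Z n \<omega>) / c \<partial>P) \<longlonglongrightarrow> (\<integral>\<omega>. g k (Z' \<omega>) / c \<partial>Q)"
    proof (rule lip)
      show "\<bar>g k x / c\<bar> \<le> 1" if "x \<in> M" for x
        using g(2)[OF that, of k] c by (simp add: divide_le_eq)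
      show "\<bar>g k x / c - g k y / c\<bar> \<le> d x y" if "x \<in> M" "y \<in> M" for x y
      proof -
        have "\<bar>g k x - g k y\<bar> \<le> c * d x y"
          using g(1)[OF that, of k] c by (meson mult_right_mono nonneg order_trans)
        then show ?thesis using c by (simp add: diff_divide_distrib[symmetric] divide_le_eq mult.commute)
      qed
    qed
    then have "(\<lambda>n. c * (\<integral>\<omega>. g k (Z n \<omega>) / c \<partial>P)) \<longlonglongrightarrow> c * (\<integral>\<omega>. g k (Z' \<omega>) / c \<partial>Q)"
      by (intro tendsto_intros)
    then have "(\<lambda>n. \<integral>\<omega>. g k (Z n \<omega>) \<partial>P) \<longlonglongrightarrow> (\<integral>\<omega>. g k (Z' \<omega>) \<partial>Q)" using c by simp
    then have "eventually (\<lambda>n. (\<integral>\<omega>. f (Z' \<omega>) \<partial>Q) - e < (\<integral>\<omega>. g k (Z n \<omega>) \<partial>P)) sequentially"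
      using k by (rule order_tendstoD)
    then show ?thesis
    proof eventually_elim
      case (elim n)
      have "(\<integral>\<omega>. g k (Z n \<omega>) \<partial>P) \<le> (\<integral>\<omega>. f (Z n \<omega>) \<partial>P)"
        using int(1)[OF gc g(2)] int(1)[OF f B] g(3) ZM by (intro integral_mono) auto
      then show ?case using elim by simp
    qed
  qed
  show ?thesis
    unfolding converges_in_distribution_def
  proof (intro conjI allI impI Z Z')
    fix f :: "'a \<Rightarrow> real"
    assume "continuous_map mtopology euclideanreal f \<and> bounded (f ` topspace mtopology)"
    then obtain B where f: "continuous_map mtopology euclidean f" and B: "\<And>x. x \<in> M \<Longrightarrow> \<bar>f x\<bar> \<le> B"
      by (auto simp: bounded_iff)
    have f': "continuous_map mtopology euclidean (\<lambda>x. - f x)" using f by (rule continuous_map_minus)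
    show "(\<lambda>n. \<integral>\<omega>. f (Z n \<omega>) \<partial>P) \<longlonglongrightarrow> (\<integral>\<omega>. f (Z' \<omega>) \<partial>Q)"
    proof (rule tendstoI)
      fix e :: real assume e: "0 < e"
      have "eventually (\<lambda>n. (\<integral>\<omega>. - f (Z' \<omega>) \<partial>Q) - e < (\<integral>\<omega>. - f (Z n \<omega>) \<partial>P)) sequentially"
        using B by (intro lower[OF f' _ e, of B]) auto
      moreover have "eventually (\<lambda>n. (\<integral>\<omega>. f (Z' \<omega>) \<partial>Q) - e < (\<integral>\<omega>. f (Z n \<omega>) \<partial>P)) sequentially"
        by (rule lower[OF f B e])
      ultimately show "eventually (\<lambda>n. dist (\<integral>\<omega>. f (Z n \<omega>) \<partial>P) (\<integral>\<omega>. f (Z' \<omega>) \<partial>Q) < e) sequentially"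
        by eventually_elim (auto simp: dist_real_def)
    qed
  qed
qed

end

section \<open>Bounded Lipschitz closeness of laws\<close>

text \<open>The point of this notion is uniformity over the test functions: up to constants, closeness is
  preserved by rescaling, shifting and adding independent summands.\<close>

definition BL1 :: "('a::real_normed_vector \<Rightarrow> real) set" where
  "BL1 = {f. (\<forall>x. \<bar>f x\<bar> \<le> 1) \<and> (\<forall>x y. \<bar>f x - f y\<bar> \<le> norm (x - y))}"

definition bl_close :: "real \<Rightarrow> 'a::real_normed_vector measure \<Rightarrow> 'a measure \<Rightarrow> bool" where
  "bl_close e \<mu> \<nu> \<longleftrightarrow> (\<forall>f\<in>BL1. \<bar>(\<integral>x. f x \<partial>\<mu>) - (\<integral>x. f x \<partial>\<nu>)\<bar> \<le> e)"

lemma BL1_bound: "f \<in> BL1 \<Longrightarrow> \<bar>f x\<bar> \<le> 1"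
  by (simp add: BL1_def)

lemma BL1_lipschitz: "f \<in> BL1 \<Longrightarrow> \<bar>f x - f y\<bar> \<le> norm (x - y)"
  by (simp add: BL1_def)

lemma BL1_continuous_on: "f \<in> BL1 \<Longrightarrow> continuous_on S f"
  by (rule continuous_onI) (force simp: dist_norm BL1_def intro: order_trans[OF _ less_imp_le])

lemma BL1_borel_measurable: "f \<in> BL1 \<Longrightarrow> f \<in> borel_measurable borel"
  by (intro borel_measurable_continuous_onI BL1_continuous_on)

lemma bl_close_mono: "bl_close e \<mu> \<nu> \<Longrightarrow> e \<le> e' \<Longrightarrow> bl_close e' \<mu> \<nu>"
  by (auto simp: bl_close_def intro: order_trans)

lemma bl_close_sym: "bl_close e \<mu> \<nu> \<Longrightarrow> bl_close e \<nu> \<mu>"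
  by (auto simp: bl_close_def abs_minus_commute)

lemma bl_close_trans: "bl_close e \<mu> \<nu> \<Longrightarrow> bl_close e' \<nu> \<rho> \<Longrightarrow> bl_close (e + e') \<mu> \<rho>"
  unfolding bl_close_def by (smt (verit, ccfv_SIG))

lemma (in prob_space) integrable_BL1:
  "f \<in> BL1 \<Longrightarrow> X \<in> borel_measurable M \<Longrightarrow> integrable M (\<lambda>\<omega>. f (X \<omega>))"
  using measurable_compose[OF _ BL1_borel_measurable, of X M f]
  by (intro integrable_bounded[of _ 1]) (auto simp: BL1_bound)

lemma bl_close_distrI:
  assumes "X \<in> borel_measurable M" "Y \<in> borel_measurable N"
    and "\<And>f. f \<in> BL1 \<Longrightarrow> \<bar>(\<integral>\<omega>. f (X \<omega>) \<partial>M) - (\<integral>\<omega>. f (Y \<omega>) \<partial>N)\<bar> \<le> e"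
  shows "bl_close e (distr M borel X) (distr N borel Y)"
  unfolding bl_close_def using assms by (auto simp: integral_distr BL1_borel_measurable)

lemma bl_close_distrD:
  assumes "bl_close e (distr M borel X) (distr N borel Y)"
    and "X \<in> borel_measurable M" "Y \<in> borel_measurable N" "f \<in> BL1"
  shows "\<bar>(\<integral>\<omega>. f (X \<omega>) \<partial>M) - (\<integral>\<omega>. f (Y \<omega>) \<partial>N)\<bar> \<le> e"
  using assms by (auto simp: bl_close_def integral_distr BL1_borel_measurable)

lemma bl_close_scaleR:
  fixes X :: "'a \<Rightarrow> 'b::{real_normed_vector, second_countable_topology}"
  assumes "bl_close e (distr M borel X) (distr N borel Y)"
    and X: "X \<in> borel_measurable M" and Y: "Y \<in> borel_measurable N" and r: "\<bar>r\<bar> \<le> C" "1 \<le> C"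
  shows "bl_close (C * e) (distr M borel (\<lambda>\<omega>. r *\<^sub>R X \<omega>)) (distr N borel (\<lambda>\<omega>. r *\<^sub>R Y \<omega>))"
proof (rule bl_close_distrI)
  fix f :: "'b \<Rightarrow> real" assume f: "f \<in> BL1"
  have "(\<lambda>x. f (r *\<^sub>R x) / C) \<in> BL1"
    unfolding BL1_def
  proof (safe)
    show "\<bar>f (r *\<^sub>R x) / C\<bar> \<le> 1" for x using BL1_bound[OF f, of "r *\<^sub>R x"] r by (simp add: divide_le_eq)
    show "\<bar>f (r *\<^sub>R x) / C - f (r *\<^sub>R y) / C\<bar> \<le> norm (x - y)" for x y
    proof -
      have "\<bar>f (r *\<^sub>R x) - f (r *\<^sub>R y)\<bar> \<le> \<bar>r\<bar> * norm (x - y)"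
        using BL1_lipschitz[OF f, of "r *\<^sub>R x" "r *\<^sub>R y"] by (simp flip: scaleR_diff_right)
      also have "\<dots> \<le> C * norm (x - y)" using r by (intro mult_right_mono) auto
      finally show ?thesis using r by (simp add: diff_divide_distrib[symmetric] divide_le_eq mult.commute)
    qed
  qed
  from bl_close_distrD[OF assms(1) X Y this] r
  show "\<bar>(\<integral>\<omega>. f (r *\<^sub>R X \<omega>) \<partial>M) - (\<integral>\<omega>. f (r *\<^sub>R Y \<omega>) \<partial>N)\<bar> \<le> C * e"
    by (simp add: diff_divide_distrib[symmetric] divide_le_eq mult.commute)
qed (use X Y in auto)

lemma bl_close_shift:
  fixes c :: "'b::{real_normed_vector, second_countable_topology}"
  assumes "bl_close e (distr M borel X) (distr N borel Y)"
    and X: "X \<in> borel_measurable M" and Y: "Y \<in> borel_measurable N"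
  shows "bl_close e (distr M borel (\<lambda>\<omega>. X \<omega> + c)) (distr N borel (\<lambda>\<omega>. Y \<omega> + c))"
proof (rule bl_close_distrI)
  fix f :: "'b \<Rightarrow> real" assume f: "f \<in> BL1"
  have "(\<lambda>x. f (x + c)) \<in> BL1"
    using f BL1_lipschitz[OF f] by (auto simp: BL1_def) (metis add_diff_cancel_right)
  from bl_close_distrD[OF assms(1) X Y this]
  show "\<bar>(\<integral>\<omega>. f (X \<omega> + c) \<partial>M) - (\<integral>\<omega>. f (Y \<omega> + c) \<partial>N)\<bar> \<le> e" .
qed (use X Y in auto)

lemma (in prob_space) bl_close_perturb:
  fixes X :: "'a \<Rightarrow> 'b::{real_normed_vector, second_countable_topology}"
  assumes X: "X \<in> borel_measurable M" and c: "norm c \<le> e"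
  shows "bl_close e (distr M borel (\<lambda>\<omega>. X \<omega> + c)) (distr M borel X)"
proof (rule bl_close_distrI)
  fix f :: "'b \<Rightarrow> real" assume f: "f \<in> BL1"
  show "\<bar>(\<integral>\<omega>. f (X \<omega> + c) \<partial>M) - (\<integral>\<omega>. f (X \<omega>) \<partial>M)\<bar> \<le> e"
  proof (rule abs_integral_diff_le)
    show "\<bar>f (X \<omega> + c) - f (X \<omega>)\<bar> \<le> e" for \<omega>
      using BL1_lipschitz[OF f, of "X \<omega> + c" "X \<omega>"] c by simp
  qed (use X integrable_BL1[OF f] in auto)
qed (use X in auto)

text \<open>Weak convergence treats one test function at a time; uniformity comes from a finite
  reduction. A partition of unity \<phi> over a finite net of a large ball approximates every
  function of \<open>BL1\<close> by a combination of the same finitely many functions, up to a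
  remainder \<rho> that lives outside the ball. Only the integrals of the \<phi> and of \<rho> have
  to converge.\<close>

lemma converges_in_distribution_bl_close:
  fixes Z :: "nat \<Rightarrow> 'w \<Rightarrow> 'a::euclidean_space"
  assumes "prob_space M" "prob_space N" and conv: "converges_in_distribution euclidean M Z N Z'" and e: "0 < e"
  shows "eventually (\<lambda>n. bl_close e (distr M borel (Z n)) (distr N borel Z')) sequentially"
proof -
  interpret M: prob_space M by fact
  interpret N: prob_space N by fact
  have Z[measurable]: "Z n \<in> borel_measurable M" for n
    using conv by (simp add: converges_in_distribution_def borel_of_euclidean)
  have Z'[measurable]: "Z' \<in> borel_measurable N"
    using conv by (simp add: converges_in_distribution_def borel_of_euclidean)
  have lim: "(\<lambda>n. \<integral>\<omega>. f (Z n \<omega>) \<partial>M) \<longlonglongrightarrow> (\<integral>\<omega>. f (Z' \<omega>) \<partial>N)"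
    if "continuous_on UNIV f" "\<And>x. \<bar>f x\<bar> \<le> 1" for f :: "'a \<Rightarrow> real"
    using conv that unfolding converges_in_distribution_def by (auto simp: bounded_iff)
  \<comment> \<open>Error budget: 4 \<delta> for approximating under the law of \<open>Z n\<close>,
    3 \<delta> under the law of \<open>Z'\<close>, and \<delta> for the finitely many
    integrals.\<close>
  define \<delta> where "\<delta> = e / 8"
  have \<delta>: "0 < \<delta>" using e by (simp add: \<delta>_def)
  obtain R :: nat where R: "N.prob {\<omega> \<in> space N. real R < norm (Z' \<omega>)} < \<delta>"
    using N.exists_norm_bound[OF Z' \<delta>] by blast
  obtain F where F: "finite F" "cball 0 (real R) \<subseteq> (\<Union>x\<in>F. ball (x::'a) \<delta>)"
    using seq_compact_imp_totally_bounded[of "cball (0::'a) (real R)"] \<delta>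
    by (auto simp: compact_eq_seq_compact_metric[symmetric])
  \<comment> \<open>A tent that is at least 1 within \<delta> of \<open>i\<close> and vanishes
    beyond 2 \<delta>.\<close>
  define \<psi> where "\<psi> i x = max 0 (2 - norm (x - i) / \<delta>)" for i x :: 'a
  define S where "S x = (\<Sum>i\<in>F. \<psi> i x)" for x
  \<comment> \<open>The denominator \<open>max 1 (S x)\<close> keeps the quotient continuous where
    \<open>S\<close> is small, and makes the \<phi> sum to 1 wherever \<open>S\<close> is at least
    1, in particular on the large ball.\<close>
  define \<phi> where "\<phi> i x = \<psi> i x / max 1 (S x)" for i x
  define \<rho> where "\<rho> x = 1 - (\<Sum>i\<in>F. \<phi> i x)" for x
  have \<psi>0: "0 \<le> \<psi> i x" for i x by (simp add: \<psi>_def)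
  have S0: "0 \<le> S x" for x unfolding S_def by (intro sum_nonneg \<psi>0)
  have \<phi>0: "0 \<le> \<phi> i x" for i x using \<psi>0 by (simp add: \<phi>_def)
  have sum\<phi>: "(\<Sum>i\<in>F. \<phi> i x) = S x / max 1 (S x)" for x by (simp add: \<phi>_def S_def sum_divide_distrib)
  have \<rho>01: "0 \<le> \<rho> x" "\<rho> x \<le> 1" for x using S0[of x] by (auto simp: \<rho>_def sum\<phi> divide_le_eq)
  have \<phi>1: "\<phi> i x \<le> 1" if "i \<in> F" for i x
  proof -
    have "\<phi> i x \<le> (\<Sum>i\<in>F. \<phi> i x)" using that F(1) \<phi>0 by (intro member_le_sum) auto
    then show ?thesis using \<rho>01(1)[of x] by (simp add: \<rho>_def)
  qed
  have \<rho>K: "\<rho> x = 0" if "norm x \<le> real R" for x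
  proof -
    have "x \<in> cball 0 (real R)" using that by simp
    then have "x \<in> (\<Union>i\<in>F. ball i \<delta>)" using F(2) by blast
    then obtain i where i: "i \<in> F" "norm (x - i) < \<delta>" by (auto simp: dist_norm norm_minus_commute)
    have "norm (x - i) / \<delta> \<le> 1" using i \<delta> by simp
    then have "1 \<le> \<psi> i x" by (simp add: \<psi>_def)
    also have "\<dots> \<le> S x" unfolding S_def using i F(1) \<psi>0 by (intro member_le_sum) auto
    finally show ?thesis by (simp add: \<rho>_def sum\<phi>)
  qed
  have c\<psi>: "continuous_on UNIV (\<psi> i)" for i unfolding \<psi>_def using \<delta> by (intro continuous_intros) auto
  have cS: "continuous_on UNIV S" unfolding S_def by (intro continuous_intros c\<psi>)
  have c\<phi>: "continuous_on UNIV (\<phi> i)" for i unfolding \<phi>_def by (intro continuous_intros c\<psi> cS) (auto simp: max_def)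
  have c\<rho>: "continuous_on UNIV \<rho>" unfolding \<rho>_def by (intro continuous_intros c\<phi>)
  note [measurable] = borel_measurable_continuous_onI[OF c\<phi>] borel_measurable_continuous_onI[OF c\<rho>]
  have approx: "\<bar>f x - (\<Sum>i\<in>F. f i * \<phi> i x)\<bar> \<le> 2 * \<delta> + \<rho> x" if f: "f \<in> BL1" for f x
  proof -
    have "f x - (\<Sum>i\<in>F. f i * \<phi> i x) = (\<Sum>i\<in>F. (f x - f i) * \<phi> i x) + f x * \<rho> x"
      by (simp add: \<rho>_def algebra_simps sum_subtractf sum_distrib_left)
    also have "\<bar>\<dots>\<bar> \<le> (\<Sum>i\<in>F. \<bar>(f x - f i) * \<phi> i x\<bar>) + \<bar>f x * \<rho> x\<bar>"
      by (intro order_trans[OF abs_triangle_ineq] add_mono sum_abs) auto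
    also have "\<dots> \<le> (\<Sum>i\<in>F. 2 * \<delta> * \<phi> i x) + 1 * \<rho> x"
    proof (intro add_mono sum_mono)
      fix i assume "i \<in> F"
      show "\<bar>(f x - f i) * \<phi> i x\<bar> \<le> 2 * \<delta> * \<phi> i x"
      proof (cases "norm (x - i) \<le> 2 * \<delta>")
        case True
        then have "\<bar>f x - f i\<bar> \<le> 2 * \<delta>" using BL1_lipschitz[OF f, of x i] by simp
        then show ?thesis using \<phi>0[of i x] by (simp add: abs_mult mult_right_mono)
      next
        case False
        then have "2 \<le> norm (x - i) / \<delta>" using \<delta> by (simp add: le_divide_eq)
        then have "\<psi> i x = 0" by (simp add: \<psi>_def)
        then show ?thesis by (simp add: \<phi>_def)
      qed
    next
      show "\<bar>f x * \<rho> x\<bar> \<le> 1 * \<rho> x" using BL1_bound[OF f, of x] \<rho>01(1)[of x] by (simp add: abs_mult mult_left_le_one_le)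
    qed
    also have "\<dots> = 2 * \<delta> * (\<Sum>i\<in>F. \<phi> i x) + \<rho> x" by (simp add: sum_distrib_left)
    also have "\<dots> \<le> 2 * \<delta> * 1 + \<rho> x" using \<delta> \<rho>01(1)[of x] by (intro add_right_mono mult_left_mono) (auto simp: \<rho>_def)
    finally show ?thesis by simp
  qed
  define E where "E = \<delta> / (real (card F) + 1)"
  have E: "0 < E" using \<delta> by (simp add: E_def)
  have ev\<phi>: "eventually (\<lambda>n. \<forall>i\<in>F. \<bar>(\<integral>\<omega>. \<phi> i (Z n \<omega>) \<partial>M) - (\<integral>\<omega>. \<phi> i (Z' \<omega>) \<partial>N)\<bar> < E) sequentially"
    unfolding eventually_ball_finite_distrib[OF F(1)]
  proof
    fix i assume "i \<in> F"
    then have "(\<lambda>n. \<integral>\<omega>. \<phi> i (Z n \<omega>) \<partial>M) \<longlonglongrightarrow> (\<integral>\<omega>. \<phi> i (Z' \<omega>) \<partial>N)"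
      using \<phi>0 \<phi>1 by (intro lim c\<phi>) (auto simp: abs_le_iff intro: order_trans[of _ 0])
    from tendstoD[OF this E] show "eventually (\<lambda>n. \<bar>(\<integral>\<omega>. \<phi> i (Z n \<omega>) \<partial>M) - (\<integral>\<omega>. \<phi> i (Z' \<omega>) \<partial>N)\<bar> < E) sequentially"
      by (simp add: dist_real_def)
  qed
  have "(\<lambda>n. \<integral>\<omega>. \<rho> (Z n \<omega>) \<partial>M) \<longlonglongrightarrow> (\<integral>\<omega>. \<rho> (Z' \<omega>) \<partial>N)"
    using \<rho>01 by (intro lim c\<rho>) (auto simp: abs_le_iff intro: order_trans[of _ 0])
  from tendstoD[OF this \<delta>] have ev\<rho>: "eventually (\<lambda>n. \<bar>(\<integral>\<omega>. \<rho> (Z n \<omega>) \<partial>M) - (\<integral>\<omega>. \<rho> (Z' \<omega>) \<partial>N)\<bar> < \<delta>) sequentially"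
    by (simp add: dist_real_def)
  have int\<rho>: "(\<integral>\<omega>. \<rho> (Z' \<omega>) \<partial>N) \<le> \<delta>"
  proof -
    have "(\<integral>\<omega>. \<rho> (Z' \<omega>) \<partial>N) \<le> (\<integral>\<omega>. indicator {\<omega> \<in> space N. real R < norm (Z' \<omega>)} \<omega> \<partial>N)"
      using \<rho>01 \<rho>K by (intro integral_mono N.integrable_bounded[of _ 1] integrable_real_indicator)
        (auto simp: indicator_def not_less N.emeasure_eq_measure)
    also have "\<dots> = N.prob {\<omega> \<in> space N. real R < norm (Z' \<omega>)}" by simp
    finally show ?thesis using R by simp
  qed
  have i\<phi>: "integrable M (\<lambda>\<omega>. \<phi> i (Z n \<omega>))" "integrable N (\<lambda>\<omega>. \<phi> i (Z' \<omega>))" if "i \<in> F" for i n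
    using \<phi>0 \<phi>1 that by (auto intro!: M.integrable_bounded[of _ 1] N.integrable_bounded[of _ 1])
  have i\<rho>: "integrable M (\<lambda>\<omega>. \<rho> (Z n \<omega>))" "integrable N (\<lambda>\<omega>. \<rho> (Z' \<omega>))" for n
    using \<rho>01 by (auto intro!: M.integrable_bounded[of _ 1] N.integrable_bounded[of _ 1])
  show ?thesis
    using ev\<phi> ev\<rho>
  proof eventually_elim
    case (elim n)
    show ?case
    proof (rule bl_close_distrI)
      fix f :: "'a \<Rightarrow> real" assume f: "f \<in> BL1"
      have a: "\<bar>(\<integral>\<omega>. f (Z n \<omega>) \<partial>M) - (\<integral>\<omega>. (\<Sum>i\<in>F. f i * \<phi> i (Z n \<omega>)) \<partial>M)\<bar> \<le> (\<integral>\<omega>. 2 * \<delta> + \<rho> (Z n \<omega>) \<partial>M)"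
      proof -
        have "\<bar>(\<integral>\<omega>. f (Z n \<omega>) \<partial>M) - (\<integral>\<omega>. (\<Sum>i\<in>F. f i * \<phi> i (Z n \<omega>)) \<partial>M)\<bar> = \<bar>\<integral>\<omega>. f (Z n \<omega>) - (\<Sum>i\<in>F. f i * \<phi> i (Z n \<omega>)) \<partial>M\<bar>"
          using i\<phi> M.integrable_BL1[OF f] by (subst Bochner_Integration.integral_diff) auto
        also have "\<dots> \<le> (\<integral>\<omega>. \<bar>f (Z n \<omega>) - (\<Sum>i\<in>F. f i * \<phi> i (Z n \<omega>))\<bar> \<partial>M)" using integral_abs_bound by blast
        also have "\<dots> \<le> (\<integral>\<omega>. 2 * \<delta> + \<rho> (Z n \<omega>) \<partial>M)"
          using i\<phi> i\<rho> M.integrable_BL1[OF f] approx[OF f] by (intro integral_mono) auto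
        finally show ?thesis .
      qed
      have b: "\<bar>(\<integral>\<omega>. f (Z' \<omega>) \<partial>N) - (\<integral>\<omega>. (\<Sum>i\<in>F. f i * \<phi> i (Z' \<omega>)) \<partial>N)\<bar> \<le> (\<integral>\<omega>. 2 * \<delta> + \<rho> (Z' \<omega>) \<partial>N)"
      proof -
        have "\<bar>(\<integral>\<omega>. f (Z' \<omega>) \<partial>N) - (\<integral>\<omega>. (\<Sum>i\<in>F. f i * \<phi> i (Z' \<omega>)) \<partial>N)\<bar> = \<bar>\<integral>\<omega>. f (Z' \<omega>) - (\<Sum>i\<in>F. f i * \<phi> i (Z' \<omega>)) \<partial>N\<bar>"
          using i\<phi> N.integrable_BL1[OF f] by (subst Bochner_Integration.integral_diff) auto
        also have "\<dots> \<le> (\<integral>\<omega>. \<bar>f (Z' \<omega>) - (\<Sum>i\<in>F. f i * \<phi> i (Z' \<omega>))\<bar> \<partial>N)" using integral_abs_bound by blast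
        also have "\<dots> \<le> (\<integral>\<omega>. 2 * \<delta> + \<rho> (Z' \<omega>) \<partial>N)"
          using i\<phi> i\<rho> N.integrable_BL1[OF f] approx[OF f] by (intro integral_mono) auto
        finally show ?thesis .
      qed
      have c: "\<bar>(\<integral>\<omega>. (\<Sum>i\<in>F. f i * \<phi> i (Z n \<omega>)) \<partial>M) - (\<integral>\<omega>. (\<Sum>i\<in>F. f i * \<phi> i (Z' \<omega>)) \<partial>N)\<bar> \<le> \<delta>"
      proof -
        have "(\<integral>\<omega>. (\<Sum>i\<in>F. f i * \<phi> i (Z n \<omega>)) \<partial>M) - (\<integral>\<omega>. (\<Sum>i\<in>F. f i * \<phi> i (Z' \<omega>)) \<partial>N)
            = (\<Sum>i\<in>F. f i * ((\<integral>\<omega>. \<phi> i (Z n \<omega>) \<partial>M) - (\<integral>\<omega>. \<phi> i (Z' \<omega>) \<partial>N)))"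
          using i\<phi> by (simp add: Bochner_Integration.integral_sum sum_subtractf right_diff_distrib)
        also have "\<bar>\<dots>\<bar> \<le> (\<Sum>i\<in>F. E)"
        proof (intro order_trans[OF sum_abs] sum_mono)
          fix i assume "i \<in> F"
          then show "\<bar>f i * ((\<integral>\<omega>. \<phi> i (Z n \<omega>) \<partial>M) - (\<integral>\<omega>. \<phi> i (Z' \<omega>) \<partial>N))\<bar> \<le> E"
            using BL1_bound[OF f, of i] elim(1) mult_mono[of "\<bar>f i\<bar>" 1 "\<bar>(\<integral>\<omega>. \<phi> i (Z n \<omega>) \<partial>M) - (\<integral>\<omega>. \<phi> i (Z' \<omega>) \<partial>N)\<bar>" E]
            by (auto simp: abs_mult)
        qed
        also have "\<dots> \<le> \<delta>" using \<delta> by (simp add: E_def field_simps)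
        finally show ?thesis .
      qed
      have "(\<integral>\<omega>. 2 * \<delta> + \<rho> (Z n \<omega>) \<partial>M) \<le> 4 * \<delta>" "(\<integral>\<omega>. 2 * \<delta> + \<rho> (Z' \<omega>) \<partial>N) \<le> 3 * \<delta>"
        using i\<rho> elim(2) int\<rho> by (auto simp: M.prob_space N.prob_space)
      moreover have "e = 8 * \<delta>" by (simp add: \<delta>_def)
      ultimately show "\<bar>(\<integral>\<omega>. f (Z n \<omega>) \<partial>M) - (\<integral>\<omega>. f (Z' \<omega>) \<partial>N)\<bar> \<le> e"
        using a b c by linarith
    qed auto
  qed
qed

text \<open>Lindeberg replacement, one coordinate at a time. In the induction step the new
  coordinate is integrated out, under \<open>\<mu> i\<close> in \<open>H\<close> and under
  \<open>\<nu> i\<close> in \<open>G\<close>. The two differ by at most \<open>e i\<close>, and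
  \<open>G\<close> still has the coordinatewise Lipschitz property that the induction hypothesis
  needs.\<close>

lemma bl_close_PiM:
  fixes F :: "('i \<Rightarrow> 'a::{real_normed_vector, second_countable_topology}) \<Rightarrow> real"
  assumes "finite I"
    and \<mu>: "\<And>i. prob_space (\<mu> i)" "\<And>i. sets (\<mu> i) = sets borel"
    and \<nu>: "\<And>i. prob_space (\<nu> i)" "\<And>i. sets (\<nu> i) = sets borel"
    and close: "\<And>i. i \<in> I \<Longrightarrow> bl_close (e i) (\<mu> i) (\<nu> i)"
    and "F \<in> borel_measurable (\<Pi>\<^sub>M i\<in>I. borel)"
    and "\<And>x. \<bar>F x\<bar> \<le> 1" and "\<And>x i a b. i \<in> I \<Longrightarrow> \<bar>F (x(i := a)) - F (x(i := b))\<bar> \<le> norm (a - b)"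
  shows "\<bar>(\<integral>x. F x \<partial>Pi\<^sub>M I \<mu>) - (\<integral>x. F x \<partial>Pi\<^sub>M I \<nu>)\<bar> \<le> (\<Sum>i\<in>I. e i)"
  using assms(1,6-9)
proof (induction I arbitrary: F rule: finite_induct)
  case empty
  have "Pi\<^sub>M {} \<mu> = Pi\<^sub>M {} \<nu>" by (simp add: PiM_empty)
  then show ?case by simp
next
  case (insert i I)
  interpret \<mu>: product_prob_space \<mu> UNIV
    using \<mu>(1) by (auto simp: product_prob_space_def product_prob_space_axioms_def product_sigma_finite_def prob_space_imp_sigma_finite)
  interpret \<nu>: product_prob_space \<nu> UNIV
    using \<nu>(1) by (auto simp: product_prob_space_def product_prob_space_axioms_def product_sigma_finite_def prob_space_imp_sigma_finite)
  interpret PI\<mu>: prob_space "Pi\<^sub>M I \<mu>" by (intro prob_space_PiM \<mu>)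
  interpret PI\<nu>: prob_space "Pi\<^sub>M I \<nu>" by (intro prob_space_PiM \<nu>)
  interpret Pi\<mu>: prob_space "Pi\<^sub>M (insert i I) \<mu>" by (intro prob_space_PiM \<mu>)
  interpret Pi\<nu>: prob_space "Pi\<^sub>M (insert i I) \<nu>" by (intro prob_space_PiM \<nu>)
  have sets\<mu>: "sets (Pi\<^sub>M J \<mu>) = sets (\<Pi>\<^sub>M i\<in>J. borel)" for J by (intro sets_PiM_cong \<mu>) auto
  have sets\<nu>: "sets (Pi\<^sub>M J \<nu>) = sets (\<Pi>\<^sub>M i\<in>J. borel)" for J by (intro sets_PiM_cong \<nu>) auto
  have F\<mu>: "F \<in> borel_measurable (Pi\<^sub>M (insert i I) \<mu>)" and F\<nu>: "F \<in> borel_measurable (Pi\<^sub>M (insert i I) \<nu>)"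
    using insert.prems(2) by (simp_all cong: measurable_cong_sets add: sets\<mu> sets\<nu>)
  have int: "integrable (Pi\<^sub>M (insert i I) \<mu>) F" "integrable (Pi\<^sub>M (insert i I) \<nu>) F"
    using F\<mu> F\<nu> insert.prems(3) by (auto intro: Pi\<mu>.integrable_bounded[of _ 1] Pi\<nu>.integrable_bounded[of _ 1])
  have upd: "(\<lambda>(x, y). F (x(i := y))) \<in> borel_measurable ((\<Pi>\<^sub>M i\<in>I. borel) \<Otimes>\<^sub>M borel)"
    using measurable_compose[OF measurable_add_dim insert.prems(2)] by (simp add: split_beta' fun_upd_def)
  have updx: "(\<lambda>y. F (x(i := y))) \<in> BL1" for x
    unfolding BL1_def mem_Collect_eq using insert.prems(3) insert.prems(4)[OF insertI1] by blast
  define G where "G x = (\<integral>y. F (x(i := y)) \<partial>\<nu> i)" for x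
  define H where "H x = (\<integral>y. F (x(i := y)) \<partial>\<mu> i)" for x
  have Gm: "G \<in> borel_measurable (\<Pi>\<^sub>M i\<in>I. borel)"
    unfolding G_def
  proof (rule sigma_finite_measure.borel_measurable_lebesgue_integral[OF prob_space_imp_sigma_finite[OF \<nu>(1)]])
    have "sets ((\<Pi>\<^sub>M i\<in>I. borel) \<Otimes>\<^sub>M \<nu> i) = sets ((\<Pi>\<^sub>M i\<in>I. borel) \<Otimes>\<^sub>M borel)"
      by (intro sets_pair_measure_cong \<nu> refl)
    from measurable_cong_sets[OF this refl] upd
    show "(\<lambda>(x, y). F (x(i := y))) \<in> borel_measurable ((\<Pi>\<^sub>M i\<in>I. borel) \<Otimes>\<^sub>M \<nu> i)" by blast
  qed
  have Hm: "H \<in> borel_measurable (\<Pi>\<^sub>M i\<in>I. borel)"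
    unfolding H_def
  proof (rule sigma_finite_measure.borel_measurable_lebesgue_integral[OF prob_space_imp_sigma_finite[OF \<mu>(1)]])
    have "sets ((\<Pi>\<^sub>M i\<in>I. borel) \<Otimes>\<^sub>M \<mu> i) = sets ((\<Pi>\<^sub>M i\<in>I. borel) \<Otimes>\<^sub>M borel)"
      by (intro sets_pair_measure_cong \<mu> refl)
    from measurable_cong_sets[OF this refl] upd
    show "(\<lambda>(x, y). F (x(i := y))) \<in> borel_measurable ((\<Pi>\<^sub>M i\<in>I. borel) \<Otimes>\<^sub>M \<mu> i)" by blast
  qed
  have intx: "integrable (\<nu> i) (\<lambda>y. F (x(i := y)))" "integrable (\<mu> i) (\<lambda>y. F (x(i := y)))" for x
    using prob_space.integrable_BL1[OF \<nu>(1)[of i] updx[of x], of "\<lambda>y. y"] prob_space.integrable_BL1[OF \<mu>(1)[of i] updx[of x], of "\<lambda>y. y"]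
    by (auto simp: measurable_ident_sets \<mu> \<nu>)
  have G1: "\<bar>G x\<bar> \<le> 1" and H1: "\<bar>H x\<bar> \<le> 1" for x
    using prob_space.abs_integral_diff_le[OF \<nu>(1) intx(1)[of x], of "\<lambda>_. 0" 1] prob_space.abs_integral_diff_le[OF \<mu>(1) intx(2)[of x], of "\<lambda>_. 0" 1] insert.prems(3)
    by (auto simp: G_def H_def)
  have GL: "\<bar>G (x(j := a)) - G (x(j := b))\<bar> \<le> norm (a - b)" if "j \<in> I" for x j a b
    unfolding G_def
  proof (rule prob_space.abs_integral_diff_le[OF \<nu>(1) intx(1) intx(1)])
    fix y
    have "j \<noteq> i" using that insert by auto
    then show "\<bar>F (x(j := a, i := y)) - F (x(j := b, i := y))\<bar> \<le> norm (a - b)"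
      unfolding fun_upd_twist[OF \<open>j \<noteq> i\<close>] using that by (intro insert.prems(4)) auto
  qed
  have "\<bar>(\<integral>x. H x \<partial>Pi\<^sub>M I \<mu>) - (\<integral>x. G x \<partial>Pi\<^sub>M I \<mu>)\<bar> \<le> e i"
  proof (rule PI\<mu>.abs_integral_diff_le)
    show "integrable (Pi\<^sub>M I \<mu>) H" "integrable (Pi\<^sub>M I \<mu>) G"
      using Gm Hm G1 H1 by (auto intro!: PI\<mu>.integrable_bounded[of _ 1] cong: measurable_cong_sets simp: sets\<mu>)
    show "\<bar>H x - G x\<bar> \<le> e i" for x
      using insert.prems(1)[of i] updx[of x] by (auto simp: bl_close_def G_def H_def)
  qed
  moreover have "\<bar>(\<integral>x. G x \<partial>Pi\<^sub>M I \<mu>) - (\<integral>x. G x \<partial>Pi\<^sub>M I \<nu>)\<bar> \<le> (\<Sum>i\<in>I. e i)"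
    by (intro insert.IH insert.prems(1) Gm G1 GL) auto
  moreover have "(\<integral>x. F x \<partial>Pi\<^sub>M (insert i I) \<mu>) = (\<integral>x. H x \<partial>Pi\<^sub>M I \<mu>)"
    unfolding H_def by (rule \<mu>.product_integral_insert[OF insert.hyps int(1)])
  moreover have "(\<integral>x. F x \<partial>Pi\<^sub>M (insert i I) \<nu>) = (\<integral>x. G x \<partial>Pi\<^sub>M I \<nu>)"
    unfolding G_def by (rule \<nu>.product_integral_insert[OF insert.hyps int(2)])
  ultimately show ?case using insert.hyps by simp
qed

section \<open>Regular variation\<close>

text \<open>Slow variation in additive form, as for \<open>h u = ln (l (exp u))\<close>. Truncation
  at 1 supplies the dominating function. The window must contain both w and w - v for w in [1,2] and
  v in [0,1].\<close>

lemma tendsto_integral_min_increment: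
  fixes h :: "real \<Rightarrow> real"
  assumes [measurable]: "h \<in> borel_measurable borel"
    and h: "\<And>v. ((\<lambda>u. h (u + v) - h u) \<longlongrightarrow> 0) at_top"
    and u: "filterlim u at_top sequentially"
  shows "(\<lambda>n. \<integral>w. indicator {0..3} w * min 1 \<bar>h (u n + w) - h (u n)\<bar> \<partial>lborel) \<longlonglongrightarrow> 0"
proof -
  have "(\<lambda>n. \<integral>w. indicator {0..3} w * min 1 \<bar>h (u n + w) - h (u n)\<bar> \<partial>lborel) \<longlonglongrightarrow> (\<integral>w. indicator {0..3::real} w * 0 \<partial>lborel)"
  proof (rule integral_dominated_convergence[where w = "indicator {0..3::real}"])
    show "AE w in lborel. (\<lambda>n. indicator {0..3} w * min 1 \<bar>h (u n + w) - h (u n)\<bar>) \<longlonglongrightarrow> indicator {0..3} w * (0::real)"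
    proof (rule AE_I2)
      fix w :: real
      have "(\<lambda>n. h (u n + w) - h (u n)) \<longlonglongrightarrow> 0" using h u by (rule filterlim_compose)
      then have "(\<lambda>n. min 1 \<bar>h (u n + w) - h (u n)\<bar>) \<longlonglongrightarrow> min 1 \<bar>0\<bar>" by (intro tendsto_intros)
      then show "(\<lambda>n. indicator {0..3} w * min 1 \<bar>h (u n + w) - h (u n)\<bar>) \<longlonglongrightarrow> indicator {0..3} w * (0::real)"
        by (intro tendsto_intros) simp
    qed
  qed (auto simp: indicator_def)
  then show ?thesis by simp
qed

text \<open>Going from \<open>u\<close> to \<open>u + v\<close> through \<open>u + w\<close> and averaging over \<open>w \<in> [1,2]\<close> makes dominated
  convergence applicable although \<open>v\<close> varies with \<open>u\<close>.\<close>
lemma slowly_varying_uniform: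
  fixes h :: "real \<Rightarrow> real"
  assumes meas[measurable]: "h \<in> borel_measurable borel"
    and h: "\<And>v. ((\<lambda>u. h (u + v) - h u) \<longlongrightarrow> 0) at_top"
    and e: "0 < e"
  shows "\<exists>U. \<forall>u\<ge>U. \<forall>v\<in>{0..1}. \<bar>h (u + v) - h u\<bar> \<le> e"
proof (rule ccontr)
  assume neg: "\<not> (\<exists>U. \<forall>u\<ge>U. \<forall>v\<in>{0..1}. \<bar>h (u + v) - h u\<bar> \<le> e)"
  have "\<forall>n. \<exists>u v. real n \<le> u \<and> v \<in> {0..1} \<and> e < \<bar>h (u + v) - h u\<bar>"
  proof
    fix n :: nat
    from neg have "\<not> (\<forall>u\<ge>real n. \<forall>v\<in>{0..1}. \<bar>h (u + v) - h u\<bar> \<le> e)" by blast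
    then show "\<exists>u v. real n \<le> u \<and> v \<in> {0..1} \<and> e < \<bar>h (u + v) - h u\<bar>" by (meson not_le)
  qed
  then obtain u v where uv: "\<And>n. real n \<le> u n" "\<And>n. v n \<in> {0..1}" "\<And>n. e < \<bar>h (u n + v n) - h (u n)\<bar>"
    by metis
  have ulim: "filterlim u at_top sequentially"
    by (rule filterlim_at_top_mono[OF filterlim_real_sequentially]) (use uv(1) in auto)
  have uvlim: "filterlim (\<lambda>n. u n + v n) at_top sequentially"
    by (rule filterlim_at_top_mono[OF ulim]) (use uv(2) in auto)
  define F where "F a w = indicator {0..3} w * min 1 \<bar>h (a + w) - h a\<bar>" for a w
  have F0: "0 \<le> F a w" for a w by (simp add: F_def)
  have Fm[measurable]: "F a \<in> borel_measurable borel" for a unfolding F_def by measurable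
  have intF: "integrable lborel (F a)" for a
    by (rule Bochner_Integration.integrable_bound[of lborel "indicator {0..3::real}"]) (auto simp: F_def indicator_def)
  have lim1: "(\<lambda>n. \<integral>w. F (u n) w \<partial>lborel) \<longlonglongrightarrow> 0"
    unfolding F_def by (rule tendsto_integral_min_increment[OF meas h ulim])
  have lim2: "(\<lambda>n. \<integral>w. F (u n + v n) w \<partial>lborel) \<longlonglongrightarrow> 0"
    unfolding F_def by (rule tendsto_integral_min_increment[OF meas h uvlim])
  have "min 1 e \<le> (\<integral>w. F (u n) w \<partial>lborel) + (\<integral>w. F (u n + v n) w \<partial>lborel)" for n
  proof -
    \<comment> \<open>The substitution replaces w by w - v, so that both integrands compare a base
      point with the same intermediate point u + w.\<close>
    have shift: "(\<integral>w. F (u n + v n) w \<partial>lborel) = (\<integral>w. F (u n + v n) (- v n + 1 * w) \<partial>lborel)"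
      by (subst lborel_integral_real_affine[of 1 _ "- v n"]) auto
    have ints: "integrable lborel (\<lambda>w. F (u n + v n) (- v n + 1 * w))"
      using lborel_integrable_real_affine[OF intF[of "u n + v n"], of 1 "- v n"] by simp
    have "min 1 e = (\<integral>w. indicator {1..2::real} w * min 1 e \<partial>lborel)" by simp
    also have "\<dots> \<le> (\<integral>w. F (u n) w + F (u n + v n) (- v n + 1 * w) \<partial>lborel)"
    proof (rule integral_mono)
      fix w :: real
      show "indicator {1..2} w * min 1 e \<le> F (u n) w + F (u n + v n) (- v n + 1 * w)"
      proof (cases "w \<in> {1..2}")
        case True
        then have "w \<in> {0..3}" "- v n + 1 * w \<in> {0..3}" using uv(2)[of n] by auto
        then have "F (u n) w + F (u n + v n) (- v n + 1 * w) = min 1 \<bar>h (u n + w) - h (u n)\<bar> + min 1 \<bar>h (u n + w) - h (u n + v n)\<bar>"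
          by (simp add: F_def)
        moreover have "min 1 e \<le> min 1 A + min 1 B" if "0 \<le> A" "0 \<le> B" "e < A + B" for A B :: real
          using that by (simp add: min_def)
        moreover have "e < \<bar>h (u n + w) - h (u n)\<bar> + \<bar>h (u n + w) - h (u n + v n)\<bar>" using uv(3)[of n] by simp
        ultimately show ?thesis using True by simp
      next
        case False
        then show ?thesis using F0 by (simp add: add_nonneg_nonneg)
      qed
    qed (use intF ints in auto)
    also have "\<dots> = (\<integral>w. F (u n) w \<partial>lborel) + (\<integral>w. F (u n + v n) w \<partial>lborel)"
      using intF ints by (simp add: shift)
    finally show ?thesis .
  qed
  moreover have "(\<lambda>n. (\<integral>w. F (u n) w \<partial>lborel) + (\<integral>w. F (u n + v n) w \<partial>lborel)) \<longlonglongrightarrow> 0 + 0"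
    by (intro tendsto_intros lim1 lim2)
  ultimately have "min 1 e \<le> 0 + 0" by (intro LIMSEQ_le_const) auto
  then show False using e by auto
qed

text \<open>Potter's bound in additive form: chain unit steps, each costing at most
  \<open>e\<close>, and add one for the fractional part.\<close>

lemma slowly_varying_potter:
  fixes h :: "real \<Rightarrow> real"
  assumes "h \<in> borel_measurable borel"
    and "\<And>v. ((\<lambda>u. h (u + v) - h u) \<longlongrightarrow> 0) at_top"
    and "0 < e"
  shows "\<exists>U. \<forall>u\<ge>U. \<forall>v\<ge>0. \<bar>h (u + v) - h u\<bar> \<le> e * (v + 1)"
proof -
  obtain U where U: "\<And>u v. u \<ge> U \<Longrightarrow> v \<in> {0..1} \<Longrightarrow> \<bar>h (u + v) - h u\<bar> \<le> e"
    using slowly_varying_uniform[OF assms] by blast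
  have *: "\<bar>h (u + real n) - h u\<bar> \<le> e * real n" if "u \<ge> U" for u n
  proof (induction n)
    case (Suc n)
    have "\<bar>h (u + real n + 1) - h (u + real n)\<bar> \<le> e" using that by (intro U) auto
    with Suc show ?case by (simp add: algebra_simps)
  qed simp
  have "\<bar>h (u + v) - h u\<bar> \<le> e * (v + 1)" if "u \<ge> U" "v \<ge> 0" for u v
  proof -
    define n where "n = nat \<lfloor>v\<rfloor>"
    have n: "real n \<le> v" "v - real n \<in> {0..1}" using that(2) by (auto simp: n_def) linarith
    have "\<bar>h (u + real n + (v - real n)) - h (u + real n)\<bar> \<le> e" using that(1) n(2) by (intro U) auto
    then have "\<bar>h (u + v) - h u\<bar> \<le> e * real n + e" using *[OF that(1), of n] by simp
    also have "\<dots> \<le> e * (v + 1)" using n assms(3) by (simp add: distrib_left)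
    finally show ?thesis .
  qed
  then show ?thesis by blast
qed

section \<open>Ratios of a regularly varying sequence\<close>

locale regularly_varying_sequence =
  fixes \<alpha> :: real and l :: "real \<Rightarrow> real" and b :: "nat \<Rightarrow> real"
  assumes \<alpha>: "0 < \<alpha>" and l: "slowly_varying l"
    and b: "\<And>n. 1 \<le> n \<Longrightarrow> b n = real n powr (1 / \<alpha>) * l (real n)" "\<And>n. 1 \<le> n \<Longrightarrow> 0 < b n"
begin

text \<open>In logarithmic coordinates ln (b n) = ln n / \<alpha> + h (ln n), so this is the
  additive Potter bound between u = ln k and u + v = ln n.\<close>

lemma log_ratio_bound:
  assumes "0 < e"
  obtains N where "1 \<le> N" "\<And>k n. N \<le> k \<Longrightarrow> k \<le> n \<Longrightarrow>
    \<bar>ln (b n / b k) - ln (real n / real k) / \<alpha>\<bar> \<le> e * (ln (real n / real k) + 1)"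
proof -
  obtain x0 where l0: "l \<in> borel_measurable (restrict_space borel {x0..})" "\<And>x. x \<ge> x0 \<Longrightarrow> 0 < l x"
    and l1: "\<And>c. 0 < c \<Longrightarrow> ((\<lambda>x. l (c * x) / l x) \<longlongrightarrow> 1) at_top"
    using l by (auto simp: slowly_varying_def)
  \<comment> \<open>\<open>l\<close> is controlled only from \<open>x0\<close> on; the value 1 below
    keeps the logarithm measurable on the whole line.\<close>
  define l' where "l' x = (if x \<in> {x0..} then l x else 1)" for x
  define h where "h u = ln (l' (exp u))" for u
  have [measurable]: "l' \<in> borel_measurable borel"
    unfolding l'_def using l0(1) by (subst measurable_restrict_space_iff[symmetric]) auto
  have hm: "h \<in> borel_measurable borel" unfolding h_def by measurable
  have hlim: "((\<lambda>u. h (u + v) - h u) \<longlongrightarrow> 0) at_top" for v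
  proof -
    have "((\<lambda>u. ln (l (exp v * exp u) / l (exp u))) \<longlongrightarrow> ln 1) at_top"
      by (intro tendsto_ln filterlim_compose[OF l1 exp_at_top]) auto
    moreover have "eventually (\<lambda>u. ln (l (exp v * exp u) / l (exp u)) = h (u + v) - h u) at_top"
    proof -
      have "eventually (\<lambda>u. exp u \<ge> x0) at_top" "eventually (\<lambda>u. exp u \<ge> x0 / exp v) at_top"
        using exp_at_top by (auto simp: filterlim_at_top)
      then show ?thesis
      proof eventually_elim
        case (elim u)
        have "x0 \<le> exp v * exp u" using elim(2) by (simp add: divide_le_eq mult.commute)
        then show ?case using elim l0(2)[of "exp u"] l0(2)[of "exp v * exp u"] by (simp add: h_def l'_def exp_add mult.commute ln_div)
      qed
    qed
    ultimately have "((\<lambda>u. h (u + v) - h u) \<longlongrightarrow> ln 1) at_top" by (rule Lim_transform_eventually)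
    then show ?thesis by (simp only: ln_one)
  qed
  obtain U where U: "\<And>u v. u \<ge> U \<Longrightarrow> v \<ge> 0 \<Longrightarrow> \<bar>h (u + v) - h u\<bar> \<le> e * (v + 1)"
    using slowly_varying_potter[OF hm hlim assms] by blast
  obtain N where N: "max 1 (max x0 (exp U)) \<le> real N" using real_arch_simple by blast
  show ?thesis
  proof (rule that)
    show "1 \<le> N" using N by simp
    fix k n assume kn: "N \<le> k" "k \<le> n"
    have k: "1 \<le> k" "real k \<ge> x0" "real k \<ge> exp U" "1 \<le> n" "real n \<ge> x0" "0 < real k" "0 < real n" using N kn by auto
    have lnb: "ln (b i) = ln (real i) / \<alpha> + h (ln (real i))" if "1 \<le> i" "real i \<ge> x0" for i
      using that l0(2)[of "real i"] by (simp add: b(1) ln_mult ln_powr h_def l'_def)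
    have "U \<le> ln (real k)" using k by (simp add: ln_ge_iff)
    moreover have "0 \<le> ln (real n / real k)" using k kn by simp
    ultimately have "\<bar>h (ln (real k) + ln (real n / real k)) - h (ln (real k))\<bar> \<le> e * (ln (real n / real k) + 1)" by (rule U)
    moreover have "ln (real k) + ln (real n / real k) = ln (real n)" using k by (simp add: ln_div)
    moreover have "ln (b n / b k) - ln (real n / real k) / \<alpha> = h (ln (real n)) - h (ln (real k))"
      using k b(2)[of n] b(2)[of k] lnb[of n] lnb[of k] by (simp add: ln_div diff_divide_distrib)
    ultimately show "\<bar>ln (b n / b k) - ln (real n / real k) / \<alpha>\<bar> \<le> e * (ln (real n / real k) + 1)" by simp
  qed
qed

text \<open>Giving away half of the exponent, \<open>e = 1 / (2 * \<alpha>)\<close>, absorbs the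
  slowly varying factor and still leaves a positive power of k/n.\<close>

lemma ratio_bound:
  obtains N where "1 \<le> N" "\<And>k n. N \<le> k \<Longrightarrow> k \<le> n \<Longrightarrow>
    b k / b n \<le> exp (1 / (2 * \<alpha>)) * (real k / real n) powr (1 / (2 * \<alpha>))"
proof -
  have "0 < 1 / (2 * \<alpha>)" using \<alpha> by simp
  from log_ratio_bound[OF this] obtain N where N: "1 \<le> N" "\<And>k n. N \<le> k \<Longrightarrow> k \<le> n \<Longrightarrow>
    \<bar>ln (b n / b k) - ln (real n / real k) / \<alpha>\<bar> \<le> 1 / (2 * \<alpha>) * (ln (real n / real k) + 1)" by blast
  show ?thesis
  proof (rule that[OF N(1)])
    fix k n assume kn: "N \<le> k" "k \<le> n"
    let ?L = "ln (real n / real k)"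
    have k: "1 \<le> k" "1 \<le> n" using kn N(1) by auto
    have "ln (b n / b k) \<ge> ?L / \<alpha> - 1 / (2 * \<alpha>) * (?L + 1)" using N(2)[OF kn] by linarith
    moreover have "?L / \<alpha> - 1 / (2 * \<alpha>) * (?L + 1) = ?L / (2 * \<alpha>) - 1 / (2 * \<alpha>)" using \<alpha> by (simp add: field_simps)
    moreover have "ln (b k / b n) = - ln (b n / b k)" using b(2)[OF k(1)] b(2)[OF k(2)] by (simp add: ln_div)
    moreover have "?L = - ln (real k / real n)" using k by (simp add: ln_div)
    ultimately have "ln (b k / b n) \<le> 1 / (2 * \<alpha>) + 1 / (2 * \<alpha>) * ln (real k / real n)" by simp
    then have "exp (ln (b k / b n)) \<le> exp (1 / (2 * \<alpha>) + 1 / (2 * \<alpha>) * ln (real k / real n))" by simp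
    then show "b k / b n \<le> exp (1 / (2 * \<alpha>)) * (real k / real n) powr (1 / (2 * \<alpha>))"
      using b(2)[OF k(1)] b(2)[OF k(2)] k by (simp add: exp_add powr_def)
  qed
qed

lemma b_at_top: "filterlim b at_top sequentially"
proof -
  obtain N where N: "1 \<le> N" "\<And>k n. N \<le> k \<Longrightarrow> k \<le> n \<Longrightarrow>
    b k / b n \<le> exp (1 / (2 * \<alpha>)) * (real k / real n) powr (1 / (2 * \<alpha>))" using ratio_bound by blast
  have ge: "b N / exp (1 / (2 * \<alpha>)) * (real n / real N) powr (1 / (2 * \<alpha>)) \<le> b n" if "N \<le> n" for n
  proof -
    have "b N / b n \<le> exp (1 / (2 * \<alpha>)) * (real N / real n) powr (1 / (2 * \<alpha>))" using N(2)[of N n] that by simp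
    moreover have "(real N / real n) powr (1 / (2 * \<alpha>)) = 1 / (real n / real N) powr (1 / (2 * \<alpha>))"
      using N(1) that by (simp add: powr_divide)
    moreover define Q where "Q = (real n / real N) powr (1 / (2 * \<alpha>))"
    ultimately have "b N / b n \<le> exp (1 / (2 * \<alpha>)) / Q" by simp
    moreover have "0 < Q" using N(1) that by (simp add: Q_def)
    ultimately have "b N * Q \<le> exp (1 / (2 * \<alpha>)) * b n"
      using b(2)[of n] N(1) that by (simp add: divide_le_eq le_divide_eq mult_ac)
    then show ?thesis by (simp add: Q_def divide_le_eq mult.commute)
  qed
  have "filterlim (\<lambda>n. b N / exp (1 / (2 * \<alpha>)) * (real n / real N) powr (1 / (2 * \<alpha>))) at_top sequentially"
    using b(2)[OF N(1)] N(1) \<alpha> by real_asymp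
  then show ?thesis
    by (rule filterlim_at_top_mono) (use ge in \<open>auto simp: eventually_sequentially\<close>)
qed

text \<open>Three ranges of k. For bounded k the ratio vanishes since \<open>b n\<close> tends to
  infinity. For larger k with k/n \<le> \<delta> both terms are small by \<open>ratio_bound\<close>.
  For k/n > \<delta> the logarithmic bound applies with ln (n/k) at most |ln \<delta>|.\<close>

lemma uniform_ratio:
  assumes e: "0 < e"
  shows "\<exists>N. \<forall>n\<ge>N. \<forall>k\<in>{1..n}. \<bar>b k / b n - (real k / real n) powr (1 / \<alpha>)\<bar> \<le> e"
proof -
  obtain N where N: "1 \<le> N" "\<And>k n. N \<le> k \<Longrightarrow> k \<le> n \<Longrightarrow>
    b k / b n \<le> exp (1 / (2 * \<alpha>)) * (real k / real n) powr (1 / (2 * \<alpha>))" using ratio_bound by blast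
  have "((\<lambda>x. exp (1 / (2 * \<alpha>)) * x powr (1 / (2 * \<alpha>))) \<longlongrightarrow> 0) (at_right 0)"
    "((\<lambda>x. x powr (1 / \<alpha>)) \<longlongrightarrow> 0) (at_right 0)" using \<alpha> by real_asymp+
  then have "eventually (\<lambda>x. exp (1 / (2 * \<alpha>)) * x powr (1 / (2 * \<alpha>)) < e \<and> x powr (1 / \<alpha>) < e \<and> 0 < x) (at_right 0)"
    using e by (intro eventually_conj order_tendstoD eventually_at_right_less) auto
  then obtain \<delta> where \<delta>: "exp (1 / (2 * \<alpha>)) * \<delta> powr (1 / (2 * \<alpha>)) < e" "\<delta> powr (1 / \<alpha>) < e" "0 < \<delta>"
    by (auto dest: eventually_happens)
  have small: "\<bar>b k / b n - (real k / real n) powr (1 / \<alpha>)\<bar> \<le> e"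
    if "1 \<le> k" "1 \<le> n" "real k / real n \<le> \<delta>" "b k / b n \<le> e" for k n
  proof -
    have "(real k / real n) powr (1 / \<alpha>) \<le> \<delta> powr (1 / \<alpha>)" using that \<alpha> by (intro powr_mono2) auto
    moreover have "0 \<le> b k / b n" using b(2)[OF that(1)] b(2)[OF that(2)] by simp
    moreover have "0 \<le> (real k / real n) powr (1 / \<alpha>)" by simp
    ultimately show ?thesis using that(4) \<delta>(2) by linarith
  qed
  \<comment> \<open>Chosen so that
    \<open>\<kappa> * (\<bar>ln \<delta>\<bar> + 1) = ln (1 + e)\<close>, which bounds the logarithm
    of the relative error in the third range.\<close>
  define \<kappa> where "\<kappa> = ln (1 + e) / (\<bar>ln \<delta>\<bar> + 1)"
  have \<kappa>: "0 < \<kappa>" using e by (simp add: \<kappa>_def add_pos_nonneg)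
  from log_ratio_bound[OF this] obtain N2 where N2: "1 \<le> N2" "\<And>k n. N2 \<le> k \<Longrightarrow> k \<le> n \<Longrightarrow>
    \<bar>ln (b n / b k) - ln (real n / real k) / \<alpha>\<bar> \<le> \<kappa> * (ln (real n / real k) + 1)" by blast
  define C where "C = (\<Sum>k\<in>{1..N}. b k)"
  have C: "b k \<le> C" if "1 \<le> k" "k \<le> N" for k
    unfolding C_def using that b(2) by (intro member_le_sum) (auto intro: less_imp_le)
  have "eventually (\<lambda>n. C / e \<le> b n) sequentially" using b_at_top by (simp add: filterlim_at_top)
  then obtain N3 where N3: "\<And>n. N3 \<le> n \<Longrightarrow> C / e \<le> b n" by (auto simp: eventually_sequentially)
  \<comment> \<open>From \<open>N4\<close> on, \<delta> n \<ge> N + N2. Thus k \<le> N forces k/n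
    \<le> \<delta>, and k/n > \<delta> forces k \<ge> N2.\<close>
  obtain N4 :: nat where N4: "real (N + N2) / \<delta> \<le> real N4" using real_arch_simple by blast
  have "\<bar>b k / b n - (real k / real n) powr (1 / \<alpha>)\<bar> \<le> e" if n: "max N3 N4 \<le> n" and k: "k \<in> {1..n}" for n k
  proof -
    have k1: "1 \<le> k" "1 \<le> n" "k \<le> n" using k by auto
    have n4: "real (N + N2) \<le> \<delta> * real n"
    proof -
      have "real (N + N2) \<le> real N4 * \<delta>" using N4 \<delta>(3) by (simp add: divide_le_eq)
      also have "\<dots> \<le> real n * \<delta>" using n \<delta>(3) by (intro mult_right_mono) auto
      finally show ?thesis by (simp add: mult.commute)
    qed
    consider "k \<le> N" | "N \<le> k" "real k / real n \<le> \<delta>" | "\<delta> < real k / real n" by linarith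
    then show ?thesis
    proof cases
      case 1
      have "real k / real n \<le> \<delta>" using 1 n4 k1 by (simp add: divide_le_eq)
      moreover have "b k \<le> e * b n" using C[OF k1(1) 1] N3[of n] n e by (simp add: divide_le_eq mult.commute)
      then have "b k / b n \<le> e" using b(2)[OF k1(2)] by (simp add: divide_le_eq)
      ultimately show ?thesis using k1 by (intro small) auto
    next
      case 2
      have "b k / b n \<le> exp (1 / (2 * \<alpha>)) * (real k / real n) powr (1 / (2 * \<alpha>))" using N(2)[OF 2(1) k1(3)] .
      also have "\<dots> \<le> exp (1 / (2 * \<alpha>)) * \<delta> powr (1 / (2 * \<alpha>))"
        using 2(2) \<alpha> by (intro mult_left_mono powr_mono2) auto
      finally show ?thesis using \<delta>(1) 2 k1 by (intro small) auto
    next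
      case 3
      define r where "r = (real k / real n) powr (1 / \<alpha>)"
      define x where "x = ln (b k / b n) - ln r"
      have "real N2 \<le> real k" using 3 n4 k1 by (simp add: less_divide_eq)
      then have "\<bar>ln (b n / b k) - ln (real n / real k) / \<alpha>\<bar> \<le> \<kappa> * (ln (real n / real k) + 1)"
        by (intro N2) (use k1 in auto)
      also have "\<dots> \<le> \<kappa> * (\<bar>ln \<delta>\<bar> + 1)"
      proof -
        have "ln \<delta> \<le> ln (real k / real n)" using 3 \<delta>(3) by simp
        then have "ln (real n / real k) \<le> \<bar>ln \<delta>\<bar>" using k1 by (simp add: ln_div)
        then show ?thesis using \<kappa> by simp
      qed
      also have "\<dots> = ln (1 + e)" by (simp add: \<kappa>_def)
      finally have "\<bar>ln (b n / b k) - ln (real n / real k) / \<alpha>\<bar> \<le> ln (1 + e)" .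
      moreover have "x = - (ln (b n / b k) - ln (real n / real k) / \<alpha>)"
        using k1 b(2)[OF k1(1)] b(2)[OF k1(2)] by (simp add: x_def r_def ln_div ln_powr diff_divide_distrib)
      ultimately have x: "\<bar>x\<bar> \<le> ln (1 + e)" by simp
      have r: "0 < r" "r \<le> 1" using k1 \<alpha> by (auto simp: r_def intro!: powr_le1)
      have "b k / b n = r * exp x"
        using r b(2)[OF k1(1)] b(2)[OF k1(2)] by (simp add: x_def exp_diff)
      then have "b k / b n - r = r * (exp x - 1)" by (simp add: algebra_simps)
      then have "\<bar>b k / b n - r\<bar> = r * \<bar>exp x - 1\<bar>" using r by (simp add: abs_mult)
      also have "\<dots> \<le> 1 * \<bar>exp x - 1\<bar>" using r by (intro mult_right_mono) auto
      also have "\<dots> \<le> e"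
      proof -
        have "exp x \<le> exp (ln (1 + e))" "exp (- ln (1 + e)) \<le> exp x" using x by auto
        then have "exp x \<le> 1 + e" "1 / (1 + e) \<le> exp x" using e by (auto simp: exp_minus inverse_eq_divide)
        moreover have "1 - e \<le> 1 / (1 + e)" using e by (simp add: field_simps)
        ultimately have "exp x \<le> 1 + e" "1 - e \<le> exp x" by (auto intro: order_trans)
        then show ?thesis by (simp add: abs_le_iff)
      qed
      finally show ?thesis by (simp add: r_def)
    qed
  qed
  then show ?thesis by blast
qed

end

section \<open>Hulls and stable processes\<close>

interpretation hausdorff: Metric_space "convex_bodies0 :: 'a::euclidean_space set set" hausdorff_dist
  by (rule Metric_space_convex_bodies0)

lemma convex_bodies0D:
  assumes "A \<in> convex_bodies0"
  shows "compact A" "convex A" "A \<noteq> {}" "closed A" "0 \<in> A"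
  using assms by (auto simp: convex_bodies0_def compact_imp_closed)

lemma infdist_convex_hull_le:
  fixes B :: "'a::euclidean_space set"
  assumes "convex B" "closed B" "B \<noteq> {}" "\<And>x. x \<in> P \<Longrightarrow> infdist x B \<le> e" "x \<in> convex hull P"
  shows "infdist x B \<le> e"
proof -
  have "convex hull P \<subseteq> {x. infdist x B \<le> e}"
    using assms by (intro hull_minimal convex_infdist_le) auto
  then show ?thesis using assms(5) by auto
qed

section \<open>Hulls of finitely many random points\<close>

text \<open>Adjoining 0 makes every finite family of points give a member of
  \<open>convex_bodies0\<close>, the only sets on which the test functions are controlled. The walk
  and the process start at 0, so their hulls are unchanged.\<close>

definition hull0 :: "'i set \<Rightarrow> ('i \<Rightarrow> 'a::real_vector) \<Rightarrow> 'a set" where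
  "hull0 I p = convex hull (insert 0 (p ` I))"

lemma hull0_in_convex_bodies0: "finite I \<Longrightarrow> hull0 I (p :: _ \<Rightarrow> 'a::euclidean_space) \<in> convex_bodies0"
  by (auto simp: hull0_def convex_bodies0_def finite_imp_compact_convex_hull hull_inc)

lemma infdist_hull0_le:
  assumes "finite J" "0 \<le> e" "\<And>i. i \<in> I \<Longrightarrow> \<exists>j\<in>J. norm (p i - q j) \<le> e" "x \<in> hull0 I p"
  shows "infdist x (hull0 J (q :: _ \<Rightarrow> 'a::euclidean_space)) \<le> e"
proof (rule infdist_convex_hull_le)
  note B = convex_bodies0D[OF hull0_in_convex_bodies0[OF assms(1), of q]]
  show "convex (hull0 J q)" "closed (hull0 J q)" "hull0 J q \<noteq> {}" using B by auto
  show "x \<in> convex hull (insert 0 (p ` I))" using assms(4) by (simp add: hull0_def)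
  fix y assume "y \<in> insert 0 (p ` I)"
  then consider "y = 0" | i where "i \<in> I" "y = p i" by auto
  then show "infdist y (hull0 J q) \<le> e"
  proof cases
    case 1
    then show ?thesis using B(5) assms(2) by simp
  next
    case 2
    then obtain j where j: "j \<in> J" "norm (p i - q j) \<le> e" using assms(3) by blast
    then have "q j \<in> hull0 J q" by (auto simp: hull0_def intro!: hull_inc)
    then have "infdist y (hull0 J q) \<le> dist y (q j)" by (rule infdist_le)
    then show ?thesis using j 2 by (simp add: dist_norm)
  qed
qed

lemma hausdorff_dist_hull0_le:
  fixes p :: "'i \<Rightarrow> 'a::euclidean_space" and q :: "'j \<Rightarrow> 'a"
  assumes "finite I" "finite J" "0 \<le> e" "\<And>i. i \<in> I \<Longrightarrow> \<exists>j\<in>J. norm (p i - q j) \<le> e" "\<And>j. j \<in> J \<Longrightarrow> \<exists>i\<in>I. norm (p i - q j) \<le> e"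
  shows "hausdorff_dist (hull0 I p) (hull0 J q) \<le> e"
proof (rule hausdorff_dist_le)
  show "infdist x (hull0 J q) \<le> e" if "x \<in> hull0 I p" for x
    using infdist_hull0_le[OF assms(2,3,4) that] .
  show "infdist x (hull0 I p) \<le> e" if "x \<in> hull0 J q" for x
    using infdist_hull0_le[OF assms(1,3) _ that, of p] assms(5) by (simp add: norm_minus_commute)
qed (use convex_bodies0D[OF hull0_in_convex_bodies0[OF assms(1), of p]] convex_bodies0D[OF hull0_in_convex_bodies0[OF assms(2), of q]] in auto)

lemma hausdorff_dist_hull0_le_sum:
  fixes p q :: "'i \<Rightarrow> 'a::euclidean_space"
  assumes "finite I"
  shows "hausdorff_dist (hull0 I p) (hull0 I q) \<le> (\<Sum>i\<in>I. norm (p i - q i))"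
proof (rule hausdorff_dist_hull0_le)
  have "norm (p i - q i) \<le> (\<Sum>i\<in>I. norm (p i - q i))" if "i \<in> I" for i
    using assms that by (intro member_le_sum) auto
  then show "\<exists>j\<in>I. norm (p i - q j) \<le> (\<Sum>i\<in>I. norm (p i - q i))" "\<exists>j\<in>I. norm (p j - q i) \<le> (\<Sum>i\<in>I. norm (p i - q i))"
    if "i \<in> I" for i using that by blast+
qed (auto intro: sum_nonneg assms)

text \<open>The hull functional is continuous for the product topology, as the Hausdorff distance is
  at most the sum of the displacements. The index type \<open>nat\<close> matters: for countably
  many coordinates, coordinatewise measurability gives Borel measurability into the function
  space.\<close>

lemma borel_measurable_lipschitz_hull0:
  fixes p :: "nat \<Rightarrow> 'w \<Rightarrow> 'a::euclidean_space"
  assumes I: "finite I" and p: "\<And>i. i \<in> I \<Longrightarrow> p i \<in> borel_measurable M"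
    and h: "\<And>A B. A \<in> convex_bodies0 \<Longrightarrow> B \<in> convex_bodies0 \<Longrightarrow> \<bar>h A - h B\<bar> \<le> hausdorff_dist A B"
  shows "(\<lambda>\<omega>. h (hull0 I (\<lambda>i. p i \<omega>)) :: real) \<in> borel_measurable M"
proof -
  have "continuous_on UNIV (\<lambda>x :: nat \<Rightarrow> 'a. h (hull0 I x))"
  proof (rule continuous_on_sequentiallyI)
    fix u :: "nat \<Rightarrow> nat \<Rightarrow> 'a" and a assume lim: "u \<longlonglongrightarrow> a"
    have coord: "(\<lambda>n. u n i) \<longlonglongrightarrow> a i" for i
      using continuous_on_tendsto_compose[OF continuous_on_product_coordinates lim, of i] by simp
    have "(\<lambda>n. \<Sum>i\<in>I. norm (u n i - a i)) \<longlonglongrightarrow> (\<Sum>i\<in>I. norm (a i - a i))"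
      by (intro tendsto_intros coord)
    then have lim0: "(\<lambda>n. \<Sum>i\<in>I. norm (u n i - a i)) \<longlonglongrightarrow> 0" by simp
    have "norm (h (hull0 I (u n)) - h (hull0 I a)) \<le> (\<Sum>i\<in>I. norm (u n i - a i))" for n
      using h[OF hull0_in_convex_bodies0[OF I] hull0_in_convex_bodies0[OF I], of "u n" a]
        hausdorff_dist_hull0_le_sum[OF I, of "u n" a] by simp
    then have "(\<lambda>n. h (hull0 I (u n)) - h (hull0 I a)) \<longlonglongrightarrow> 0"
      by (intro Lim_null_comparison[OF _ lim0] always_eventually) blast
    then show "(\<lambda>n. h (hull0 I (u n))) \<longlonglongrightarrow> h (hull0 I a)" by (rule LIM_zero_cancel)
  qed
  then have m: "(\<lambda>x :: nat \<Rightarrow> 'a. h (hull0 I x)) \<in> borel_measurable borel"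
    by (rule borel_measurable_continuous_onI)
  have "(\<lambda>\<omega> i. if i \<in> I then p i \<omega> else 0) \<in> borel_measurable M"
  proof (rule measurable_coordinatewise_then_product)
    show "(\<lambda>\<omega>. if i \<in> I then p i \<omega> else 0) \<in> borel_measurable M" for i
      using p by (cases "i \<in> I") auto
  qed
  from measurable_compose[OF this m]
  have "(\<lambda>\<omega>. h (hull0 I (\<lambda>i. if i \<in> I then p i \<omega> else 0))) \<in> borel_measurable M" .
  also have "(\<lambda>\<omega>. h (hull0 I (\<lambda>i. if i \<in> I then p i \<omega> else 0))) = (\<lambda>\<omega>. h (hull0 I (\<lambda>i. p i \<omega>)))"
    by (simp add: hull0_def)
  finally show ?thesis .
qed

lemma measurable_hull0:
  fixes p :: "nat \<Rightarrow> 'w \<Rightarrow> 'a::euclidean_space"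
  assumes I: "finite I" and p: "\<And>i. i \<in> I \<Longrightarrow> p i \<in> borel_measurable M"
  shows "(\<lambda>\<omega>. hull0 I (\<lambda>i. p i \<omega>)) \<in> M \<rightarrow>\<^sub>M borel_of hausdorff_topology"
  by (rule hausdorff.measurable_borel_of_mtopologyI)
     (use hull0_in_convex_bodies0[OF I] in \<open>auto intro!: borel_measurable_lipschitz_hull0 I p\<close>)

lemma (in Metric_space) lipschitz_tendsto:
  fixes h :: "'a \<Rightarrow> real"
  assumes h: "\<And>x y. x \<in> M \<Longrightarrow> y \<in> M \<Longrightarrow> \<bar>h x - h y\<bar> \<le> d x y"
    and s: "\<And>n. s n \<in> M" and a: "a \<in> M" and lim: "(\<lambda>n. d (s n) a) \<longlonglongrightarrow> 0"
  shows "(\<lambda>n. h (s n)) \<longlonglongrightarrow> h a"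
proof -
  have "norm (h (s n) - h a) \<le> d (s n) a" for n using h[OF s a, of n] by simp
  then have "(\<lambda>n. h (s n) - h a) \<longlonglongrightarrow> 0"
    by (intro Lim_null_comparison[OF _ lim] always_eventually) blast
  then show ?thesis by (rule LIM_zero_cancel)
qed

text \<open>One-sided limits bound the path near each time, and finitely many such neighbourhoods
  cover the compact interval.\<close>

lemma cadlag_bounded:
  fixes f :: "real \<Rightarrow> 'a::real_normed_vector"
  assumes "cadlag f"
  shows "bounded (f ` {0..1})"
proof -
  have loc: "\<exists>U. open U \<and> t \<in> U \<and> bounded (f ` (U \<inter> {0..1}))" if t: "t \<in> {0..1}" for t
  proof -
    have "eventually (\<lambda>s. dist (f s) (f t) < 1) (at_right t)"
      using assms t tendstoD[of f "f t" "at_right t" 1] by (auto simp: cadlag_def)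
    then obtain b where b: "b > t" "\<And>s. t < s \<Longrightarrow> s < b \<Longrightarrow> dist (f s) (f t) < 1"
      by (auto simp: eventually_at_right_field)
    \<comment> \<open>At time 0 there is no left limit; any negative \<open>a\<close> will do,
      because only \<open>s \<ge> 0\<close> counts.\<close>
    obtain a l where a: "a < t" "\<And>s. a < s \<Longrightarrow> s < t \<Longrightarrow> 0 \<le> s \<Longrightarrow> dist (f s) l < 1"
    proof (cases "t = 0")
      case True
      then show ?thesis using that[of "-1" 0] by auto
    next
      case False
      then have "0 < t" using t by simp
      then obtain l where "(f \<longlongrightarrow> l) (at_left t)" using assms unfolding cadlag_def by blast
      then have "eventually (\<lambda>s. dist (f s) l < 1) (at_left t)" by (rule tendstoD) simp
      then show ?thesis using that by (auto simp: eventually_at_left_field)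
    qed
    have "f ` ({a<..<b} \<inter> {0..1}) \<subseteq> cball (f t) 1 \<union> cball l 1"
    proof (clarsimp simp del: mem_cball)
      fix s assume s: "a < s" "s < b" "0 \<le> s" "s \<le> 1" "f s \<notin> cball l 1"
      then have "\<not> s < t" using a(2)[of s] by (auto simp: dist_commute)
      then show "f s \<in> cball (f t) 1" using b(2)[of s] s by (cases "s = t") (auto simp: dist_commute)
    qed
    then have "bounded (f ` ({a<..<b} \<inter> {0..1}))"
      by (rule bounded_subset[rotated]) auto
    then show ?thesis using a(1) b(1) by (intro exI[of _ "{a<..<b}"]) auto
  qed
  then obtain U where U: "\<And>t. t \<in> {0..1} \<Longrightarrow> open (U t) \<and> t \<in> U t \<and> bounded (f ` (U t \<inter> {0..1}))" by metis
  obtain T where T: "T \<subseteq> {0..1}" "finite T" "{0..1} \<subseteq> (\<Union>t\<in>T. U t)"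
  proof (rule compactE_image[of "{0..1::real}" "{0..1}" U])
    show "{0..1} \<subseteq> (\<Union>t\<in>{0..1}. U t)" using U by blast
  qed (use U in auto)
  have "f ` {0..1} \<subseteq> (\<Union>t\<in>T. f ` (U t \<inter> {0..1}))" using T(3) by blast
  moreover have "bounded (\<Union>t\<in>T. f ` (U t \<inter> {0..1}))" using T U by (intro bounded_UN) auto
  ultimately show ?thesis by (rule bounded_subset[rotated])
qed

text \<open>The closeness is bounded by the mean of min 2 (|r - r'| |Z|), which vanishes by
  dominated convergence. Here 2 is the largest oscillation of a function in \<open>BL1\<close>, and
  the truncation is what admits heavy tails.\<close>

lemma (in prob_space) bl_close_scaleR_random_vector:
  fixes Z :: "'a \<Rightarrow> 'b::euclidean_space"
  assumes Z[measurable]: "Z \<in> borel_measurable M" and e: "0 < e"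
  shows "\<exists>\<eta>>0. \<forall>r r'. \<bar>r - r'\<bar> \<le> \<eta> \<longrightarrow> bl_close e (distr M borel (\<lambda>\<omega>. r *\<^sub>R Z \<omega>)) (distr M borel (\<lambda>\<omega>. r' *\<^sub>R Z \<omega>))"
proof -
  have "(\<lambda>n. min 2 (inverse (real (Suc n)) * a)) \<longlonglongrightarrow> min 2 (0 * a)" for a
    by (intro tendsto_intros LIMSEQ_inverse_real_of_nat)
  then have "(\<lambda>n. \<integral>\<omega>. min 2 (inverse (real (Suc n)) * norm (Z \<omega>)) \<partial>M) \<longlonglongrightarrow> (\<integral>\<omega>. min 2 (0 * norm (Z \<omega>)) \<partial>M)"
    by (intro integral_dominated_convergence[where w = "\<lambda>_. 2"]) (auto simp del: of_nat_Suc)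
  then have "eventually (\<lambda>n. (\<integral>\<omega>. min 2 (inverse (real (Suc n)) * norm (Z \<omega>)) \<partial>M) < e) sequentially"
    using e by (intro order_tendstoD) auto
  then obtain n where n: "(\<integral>\<omega>. min 2 (inverse (real (Suc n)) * norm (Z \<omega>)) \<partial>M) < e"
    by (auto simp: eventually_sequentially)
  have "bl_close e (distr M borel (\<lambda>\<omega>. r *\<^sub>R Z \<omega>)) (distr M borel (\<lambda>\<omega>. r' *\<^sub>R Z \<omega>))"
    if r: "\<bar>r - r'\<bar> \<le> inverse (real (Suc n))" for r r'
  proof (rule bl_close_distrI)
    fix f :: "'b \<Rightarrow> real" assume f: "f \<in> BL1"
    have i: "integrable M (\<lambda>\<omega>. f (r *\<^sub>R Z \<omega>))" "integrable M (\<lambda>\<omega>. f (r' *\<^sub>R Z \<omega>))"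
      by (auto intro!: integrable_BL1[OF f])
    have "\<bar>(\<integral>\<omega>. f (r *\<^sub>R Z \<omega>) \<partial>M) - (\<integral>\<omega>. f (r' *\<^sub>R Z \<omega>) \<partial>M)\<bar> = \<bar>\<integral>\<omega>. f (r *\<^sub>R Z \<omega>) - f (r' *\<^sub>R Z \<omega>) \<partial>M\<bar>"
      using i by simp
    also have "\<dots> \<le> (\<integral>\<omega>. \<bar>f (r *\<^sub>R Z \<omega>) - f (r' *\<^sub>R Z \<omega>)\<bar> \<partial>M)" using integral_abs_bound by blast
    also have "\<dots> \<le> (\<integral>\<omega>. min 2 (inverse (real (Suc n)) * norm (Z \<omega>)) \<partial>M)"
    proof (rule integral_mono)
      show "integrable M (\<lambda>\<omega>. min 2 (inverse (real (Suc n)) * norm (Z \<omega>)))"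
        by (rule integrable_bounded[of _ 2]) auto
      fix \<omega>
      have "\<bar>f (r *\<^sub>R Z \<omega>) - f (r' *\<^sub>R Z \<omega>)\<bar> \<le> \<bar>r - r'\<bar> * norm (Z \<omega>)"
        using BL1_lipschitz[OF f, of "r *\<^sub>R Z \<omega>" "r' *\<^sub>R Z \<omega>"] by (simp flip: scaleR_diff_left)
      also have "\<dots> \<le> inverse (real (Suc n)) * norm (Z \<omega>)" using r by (intro mult_right_mono) auto
      finally show "\<bar>f (r *\<^sub>R Z \<omega>) - f (r' *\<^sub>R Z \<omega>)\<bar> \<le> min 2 (inverse (real (Suc n)) * norm (Z \<omega>))"
        using BL1_bound[OF f, of "r *\<^sub>R Z \<omega>"] BL1_bound[OF f, of "r' *\<^sub>R Z \<omega>"] by (intro min.boundedI) linarith+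
    qed (use i in auto)
    finally show "\<bar>(\<integral>\<omega>. f (r *\<^sub>R Z \<omega>) \<partial>M) - (\<integral>\<omega>. f (r' *\<^sub>R Z \<omega>) \<partial>M)\<bar> \<le> e" using n by simp
  qed auto
  then show ?thesis by (intro exI[of _ "inverse (real (Suc n))"]) auto
qed

section \<open>Stable processes: self-similarity, tails and dyadic hulls\<close>

locale stable_process = prob_space N for N :: "'v measure" +
  fixes \<alpha> :: real and X :: "real \<Rightarrow> 'v \<Rightarrow> 'a::euclidean_space"
  assumes \<alpha>: "0 < \<alpha>" and stable: "stable_levy_process N \<alpha> X"
begin

lemma levy: "levy_process N X"
  using stable by (simp add: stable_levy_process_def)

lemma X_measurable: "0 \<le> t \<Longrightarrow> X t \<in> borel_measurable N"
  and X_zero: "\<omega> \<in> space N \<Longrightarrow> X 0 \<omega> = 0"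
  and X_cadlag: "\<omega> \<in> space N \<Longrightarrow> cadlag (\<lambda>t. X t \<omega>)"
  using levy by (auto simp: levy_process_def)

lemma distr_increment:
  assumes "0 \<le> s" "s \<le> t"
  shows "distr N borel (\<lambda>\<omega>. X t \<omega> - X s \<omega>) = distr N borel (X (t - s))"
proof -
  have "\<forall>s\<ge>0. \<forall>t\<ge>0. distr N borel (\<lambda>\<omega>. X (s + t) \<omega> - X s \<omega>) = distr N borel (X t)"
    using levy by (simp add: levy_process_def)
  from this[rule_format, of s "t - s"] assms show ?thesis by simp
qed

lemma indep_increments:
  assumes "0 \<le> t 0" "mono t"
  shows "indep_vars (\<lambda>_. borel) (\<lambda>i \<omega>. X (t (Suc i)) \<omega> - X (t i) \<omega>) {..<(n::nat)}"
  using levy assms by (auto simp: levy_process_def)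

lemma distr_self_similar:
  assumes "0 \<le> t"
  shows "distr N borel (X t) = distr N borel (\<lambda>\<omega>. (t powr (1 / \<alpha>)) *\<^sub>R X 1 \<omega>)"
proof (cases "t = 0")
  \<comment> \<open>Stability speaks only of positive factors; at time 0 both sides are constantly
    0, by \<open>0 powr (1 / \<alpha>) = 0\<close>.\<close>
  case True
  then show ?thesis using X_zero by (intro distr_cong) auto
next
  case False
  let ?P = "\<Pi>\<^sub>M t\<in>{0::real..}. (borel :: 'a measure)"
  have t: "0 < t" using False assms by simp
  have "distr N ?P (\<lambda>\<omega>. \<lambda>s\<in>{0..}. X (t * s) \<omega>) = distr N ?P (\<lambda>\<omega>. \<lambda>s\<in>{0..}. (t powr (1 / \<alpha>)) *\<^sub>R X s \<omega>)"
    using stable t by (simp add: stable_levy_process_def)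
  then have eq: "distr (distr N ?P (\<lambda>\<omega>. \<lambda>s\<in>{0..}. X (t * s) \<omega>)) borel (\<lambda>x. x 1) =
      distr (distr N ?P (\<lambda>\<omega>. \<lambda>s\<in>{0..}. (t powr (1 / \<alpha>)) *\<^sub>R X s \<omega>)) borel (\<lambda>x. x 1)"
    by (rule arg_cong)
  have m1: "(\<lambda>\<omega>. \<lambda>s\<in>{0..}. X (t * s) \<omega>) \<in> N \<rightarrow>\<^sub>M ?P"
    using t X_measurable by (intro measurable_restrict) auto
  have m2: "(\<lambda>\<omega>. \<lambda>s\<in>{0..}. (t powr (1 / \<alpha>)) *\<^sub>R X s \<omega>) \<in> N \<rightarrow>\<^sub>M ?P"
    using X_measurable by (intro measurable_restrict borel_measurable_scaleR) auto
  have m3: "(\<lambda>x. x 1) \<in> ?P \<rightarrow>\<^sub>M borel" by (rule measurable_component_singleton) simp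
  show ?thesis
    using eq unfolding distr_distr[OF m3 m1] distr_distr[OF m3 m2] by (simp add: comp_def)
qed

lemma bl_close_X:
  assumes e: "0 < e"
  shows "\<exists>\<eta>>0. \<forall>s\<ge>0. \<forall>t\<ge>0. \<bar>s powr (1 / \<alpha>) - t powr (1 / \<alpha>)\<bar> \<le> \<eta> \<longrightarrow> bl_close e (distr N borel (X s)) (distr N borel (X t))"
proof -
  have "X 1 \<in> borel_measurable N" by (rule X_measurable) simp
  from bl_close_scaleR_random_vector[OF this e] obtain \<eta> where
    \<eta>: "\<eta> > 0" "\<forall>r r'. \<bar>r - r'\<bar> \<le> \<eta> \<longrightarrow> bl_close e (distr N borel (\<lambda>\<omega>. r *\<^sub>R X 1 \<omega>)) (distr N borel (\<lambda>\<omega>. r' *\<^sub>R X 1 \<omega>))"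
    by blast
  have "bl_close e (distr N borel (X s)) (distr N borel (X t))"
    if "0 \<le> s" "0 \<le> t" "\<bar>s powr (1 / \<alpha>) - t powr (1 / \<alpha>)\<bar> \<le> \<eta>" for s t
    using \<eta>(2)[rule_format, OF that(3)]
    by (simp only: distr_self_similar[OF that(1)] distr_self_similar[OF that(2)])
  with \<eta>(1) show ?thesis by blast
qed

lemma path_bounded: "\<omega> \<in> space N \<Longrightarrow> bounded ((\<lambda>t. X t \<omega>) ` {0..1})"
  using cadlag_bounded X_cadlag by blast

text \<open>Were the tail of \<open>X 1\<close> heavier, the maximum of the \<open>2 ^ K\<close> independent increments over a dyadic
  grid would be unbounded in \<open>K\<close>, contradicting boundedness of the paths.\<close>
lemma tail_bound:
  assumes \<delta>: "0 < \<delta>"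
  shows "\<exists>C>0. \<forall>K::nat. prob {\<omega> \<in> space N. \<delta> < (1 / 2 ^ K) powr (1 / \<alpha>) * norm (X 1 \<omega>)} \<le> C / 2 ^ K"
proof -
  have [measurable]: "X t \<in> borel_measurable N" if "0 \<le> t" for t using X_measurable that .
  have Xg[measurable]: "X (real i / 2 ^ K) \<in> borel_measurable N" for i K by simp
  have X1[measurable]: "X 1 \<in> borel_measurable N" by simp
  \<comment> \<open>Only dyadic times are used, so this is a countable union. As \<open>n\<close>
    grows the events shrink to the empty set because every path is bounded.\<close>
  define G where "G n = (\<Union>K. \<Union>i\<in>{..2^K}. {\<omega> \<in> space N. real n < norm (X (real i / 2 ^ K) \<omega>)})" for n :: nat
  have Gm[measurable]: "G n \<in> sets N" for n unfolding G_def by measurable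
  have "(\<lambda>n. prob (G n)) \<longlonglongrightarrow> prob (\<Inter>n. G n)"
    by (rule finite_Lim_measure_decseq) (auto simp: decseq_def G_def intro: le_less_trans of_nat_mono)
  moreover have "(\<Inter>n. G n) = {}"
  proof (rule ccontr)
    assume "(\<Inter>n. G n) \<noteq> {}"
    then obtain \<omega> where \<omega>: "\<And>n. \<omega> \<in> G n" by blast
    then have "\<omega> \<in> space N" by (auto simp: G_def)
    then obtain B where "\<forall>x\<in>(\<lambda>t. X t \<omega>) ` {0..1}. norm x \<le> B"
      using path_bounded unfolding bounded_iff by blast
    then have B: "norm (X t \<omega>) \<le> B" if "t \<in> {0..1}" for t using that by blast
    obtain n where "B < real n" using reals_Archimedean2 by blast
    obtain K i where "i \<le> 2 ^ K" "real n < norm (X (real i / 2 ^ K) \<omega>)"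
      using \<omega>[of n] by (auto simp: G_def)
    moreover then have "real i / 2 ^ K \<in> {0..1}"
      by (simp add: divide_le_eq_1)
    ultimately show False using B \<open>B < real n\<close> by fastforce
  qed
  ultimately have "eventually (\<lambda>n. prob (G n) < 1 / 2) sequentially" by (intro order_tendstoD) auto
  then obtain n where n: "prob (G n) < 1 / 2" by (auto simp: eventually_sequentially)
  \<comment> \<open>Two grid values of norm at most \<open>n\<close> differ by at most
    \<open>2 n\<close>; the maximum with 1 keeps \<open>c\<close> positive.\<close>
  define c where "c = max 1 (2 * real n)"
  define p where "p K = prob {\<omega> \<in> space N. c < norm (X (1 / 2 ^ K) \<omega>)}" for K :: nat
  have pK: "p K \<le> 1 / 2 ^ K" for K
  proof -
    define t where "t i = real i / 2 ^ K" for i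
    define \<Delta> where "\<Delta> i \<omega> = X (t (Suc i)) \<omega> - X (t i) \<omega>" for i \<omega>
    have t0: "0 \<le> t i" for i by (simp add: t_def)
    have tm: "mono t" by (auto simp: mono_def t_def divide_right_mono)
    have \<Delta>m[measurable]: "\<Delta> i \<in> borel_measurable N" for i unfolding \<Delta>_def using t0 by simp
    have ind: "indep_vars (\<lambda>_. borel) \<Delta> {..<2^K}"
      using indep_increments[OF t0 tm, of "2^K"] by (simp add: \<Delta>_def[abs_def])
    have law: "distr N borel (\<Delta> i) = distr N borel (X (1 / 2 ^ K))" for i
      using distr_increment[OF t0 monoD[OF tm, of i "Suc i"]]
      by (simp add: \<Delta>_def[abs_def]) (simp add: t_def add_divide_distrib)
    have P\<Delta>: "prob (\<Delta> i -` cball 0 c \<inter> space N) = 1 - p K" for i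
    proof -
      have "prob (\<Delta> i -` cball 0 c \<inter> space N) = measure (distr N borel (\<Delta> i)) (cball 0 c)"
        by (subst measure_distr) auto
      also have "\<dots> = prob (X (1 / 2 ^ K) -` cball 0 c \<inter> space N)"
        unfolding law by (subst measure_distr) auto
      also have "X (1 / 2 ^ K) -` cball 0 c \<inter> space N = space N - {\<omega> \<in> space N. c < norm (X (1 / 2 ^ K) \<omega>)}"
        by auto
      also have "prob \<dots> = 1 - p K" unfolding p_def by (rule prob_compl) measurable
      finally show ?thesis .
    qed
    have "prob (\<Inter>i\<in>{..<2^K}. \<Delta> i -` cball 0 c \<inter> space N) = (\<Prod>i\<in>{..<(2::nat)^K}. prob (\<Delta> i -` cball 0 c \<inter> space N))"
      by (rule indep_varsD[OF ind]) (auto simp: lessThan_empty_iff)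
    then have eq: "prob (\<Inter>i\<in>{..<2^K}. \<Delta> i -` cball 0 c \<inter> space N) = (1 - p K) ^ (2 ^ K)"
      by (simp add: P\<Delta>)
    have "space N - G n \<subseteq> (\<Inter>i\<in>{..<2^K}. \<Delta> i -` cball 0 c \<inter> space N)"
    proof clarsimp
      fix \<omega> i assume \<omega>: "\<omega> \<in> space N" "\<omega> \<notin> G n" and i: "i < (2::nat) ^ K"
      have "norm (X (t j) \<omega>) \<le> real n" if "j \<le> 2 ^ K" for j
        using \<omega> that by (force simp: G_def t_def not_less[symmetric])
      from this[of i] this[of "Suc i"] i
      have "norm (\<Delta> i \<omega>) \<le> 2 * real n" by (auto simp: \<Delta>_def intro: order_trans[OF norm_triangle_ineq4])
      then show "norm (\<Delta> i \<omega>) \<le> c" by (simp add: c_def)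
    qed
    then have "prob (space N - G n) \<le> (1 - p K) ^ (2 ^ K)"
      unfolding eq[symmetric]
    proof (rule finite_measure_mono)
      show "(\<Inter>i\<in>{..<2^K}. \<Delta> i -` cball 0 c \<inter> space N) \<in> sets N"
        by (rule sets.finite_INT) (simp_all add: lessThan_empty_iff measurable_sets[OF \<Delta>m])
    qed
    moreover have "prob (space N - G n) = 1 - prob (G n)" by (rule prob_compl) measurable
    ultimately have half: "1 / 2 \<le> (1 - p K) ^ (2 ^ K)" using n by simp
    \<comment> \<open>Outside \<open>G n\<close> none of the 2^K independent increments exceeds
      \<open>c\<close>, so (1 - p)^(2^K) is at least 1/2. With 1 - p \<le> exp (- p) this yields 2^K
      p \<le> ln 2.\<close>
    have "1 - p K \<le> exp (- p K)" using exp_ge_add_one_self[of "- p K"] by simp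
    moreover have "0 \<le> 1 - p K" unfolding p_def by simp
    ultimately have "(1 - p K) ^ (2 ^ K) \<le> exp (- p K) ^ (2 ^ K)" by (intro power_mono)
    also have "\<dots> = exp (- (2 ^ K * p K))" by (simp flip: exp_of_nat_mult)
    finally have "1 / 2 \<le> exp (- (2 ^ K * p K))" using half by simp
    then have "ln (1 / 2) \<le> ln (exp (- (2 ^ K * p K)))" by (subst ln_le_cancel_iff) auto
    then have "2 ^ K * p K \<le> ln 2" by (simp add: ln_div)
    also have "\<dots> \<le> 1" using ln_2_less_1 by simp
    finally show ?thesis by (simp add: field_simps)
  qed
  have c: "0 < c" by (simp add: c_def)
  have p_eq: "p K = prob {\<omega> \<in> space N. c < (1 / 2 ^ K) powr (1 / \<alpha>) * norm (X 1 \<omega>)}" for K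
  proof -
    have "p K = measure (distr N borel (X (1 / 2 ^ K))) {x. c < norm x}"
      unfolding p_def by (subst measure_distr) (auto simp: vimage_def Int_def conj_commute intro!: arg_cong[where f = prob])
    also have "\<dots> = prob {\<omega> \<in> space N. c < (1 / 2 ^ K) powr (1 / \<alpha>) * norm (X 1 \<omega>)}"
      by (subst distr_self_similar, simp, subst measure_distr)
         (auto simp: vimage_def Int_def conj_commute intro!: arg_cong[where f = prob])
    finally show ?thesis .
  qed
  have "((\<lambda>k::nat. c * (1 / 2 ^ k) powr (1 / \<alpha>)) \<longlongrightarrow> 0) sequentially"
    using \<alpha> c by real_asymp
  then have "eventually (\<lambda>k. c * (1 / 2 ^ k) powr (1 / \<alpha>) < \<delta>) sequentially" using \<delta> by (intro order_tendstoD)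
  \<comment> \<open>Self-similarity trades the threshold for time: passing from \<open>c\<close> to
    the smaller threshold \<delta> costs \<open>k0\<close> dyadic levels, hence the factor
    \<open>2 ^ k0\<close>. For \<open>K < k0\<close> the bound exceeds 1.\<close>
  then obtain k0 :: nat where k0: "c * (1 / 2 ^ k0) powr (1 / \<alpha>) < \<delta>" by (auto simp: eventually_sequentially)
  have "prob {\<omega> \<in> space N. \<delta> < (1 / 2 ^ K) powr (1 / \<alpha>) * norm (X 1 \<omega>)} \<le> 2 ^ k0 / 2 ^ K" for K
  proof (cases "k0 \<le> K")
    case True
    define j where "j = K - k0"
    have K: "K = k0 + j" using True by (simp add: j_def)
    have split: "(1 / 2 ^ K) powr (1 / \<alpha>) = (1 / 2 ^ k0) powr (1 / \<alpha>) * (1 / 2 ^ j) powr (1 / \<alpha>)"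
      by (simp add: K power_add powr_mult[symmetric])
    have "prob {\<omega> \<in> space N. \<delta> < (1 / 2 ^ K) powr (1 / \<alpha>) * norm (X 1 \<omega>)} \<le> p j"
      unfolding p_eq
    proof (rule finite_measure_mono)
      show "{\<omega> \<in> space N. \<delta> < (1 / 2 ^ K) powr (1 / \<alpha>) * norm (X 1 \<omega>)} \<subseteq> {\<omega> \<in> space N. c < (1 / 2 ^ j) powr (1 / \<alpha>) * norm (X 1 \<omega>)}"
      proof clarsimp
        fix \<omega> assume "\<delta> < (1 / 2 ^ K) powr (1 / \<alpha>) * norm (X 1 \<omega>)"
        then have "(1 / 2 ^ k0) powr (1 / \<alpha>) * c < (1 / 2 ^ k0) powr (1 / \<alpha>) * ((1 / 2 ^ j) powr (1 / \<alpha>) * norm (X 1 \<omega>))"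
          using k0 unfolding split by (simp only: mult.assoc mult.commute[of c])
        then show "c < (1 / 2 ^ j) powr (1 / \<alpha>) * norm (X 1 \<omega>)" by (rule mult_left_less_imp_less) simp
      qed
    qed measurable
    also have "\<dots> \<le> 1 / 2 ^ j" by (rule pK)
    also have "\<dots> = 2 ^ k0 / 2 ^ K" by (simp add: K power_add)
    finally show ?thesis .
  next
    case False
    then have "(2::real) ^ K \<le> 2 ^ k0" by (intro power_increasing) auto
    then have "1 \<le> (2::real) ^ k0 / 2 ^ K" by simp
    then show ?thesis using prob_le_1 order_trans by blast
  qed
  then show ?thesis by (intro exI[of _ "2 ^ k0"]) auto
qed

lemma path_hull_in_convex_bodies0:
  assumes "\<omega> \<in> space N"
  shows "path_hull X \<omega> \<in> convex_bodies0"
proof -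
  have "compact (closure ((\<lambda>t. X t \<omega>) ` {0..1}))" using path_bounded[OF assms] by (simp add: compact_closure)
  moreover have "0 \<in> (\<lambda>t. X t \<omega>) ` {0..1}" using X_zero[OF assms] by (intro image_eqI[of _ _ 0]) auto
  then have "0 \<in> closure ((\<lambda>t. X t \<omega>) ` {0..1})" by (rule closure_subset[THEN subsetD])
  then have "0 \<in> path_hull X \<omega>" unfolding path_hull_def by (rule hull_inc)
  ultimately show ?thesis
    unfolding convex_bodies0_def path_hull_def by (intro CollectI conjI compact_convex_hull convex_convex_hull)
qed

text \<open>By compactness it suffices to approach the points of a finite net of the closed range.
  Each is near some path value, which right-continuity approximates by values at dyadic
  times.\<close>

lemma dyadic_hull_tendsto:
  assumes \<omega>: "\<omega> \<in> space N"
  shows "(\<lambda>K. hausdorff_dist (hull0 {..2^K} (\<lambda>i. X (real i / 2 ^ K) \<omega>)) (path_hull X \<omega>)) \<longlonglongrightarrow> 0"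
proof (rule tendstoI)
  fix e :: real assume e: "0 < e"
  define \<epsilon> where "\<epsilon> = e / 4"
  have \<epsilon>: "0 < \<epsilon>" using e by (simp add: \<epsilon>_def)
  define C where "C = closure ((\<lambda>t. X t \<omega>) ` {0..1})"
  define D where "D K = hull0 {..2^K} (\<lambda>i. X (real i / 2 ^ K) \<omega>)" for K
  have C: "compact C" unfolding C_def using path_bounded[OF \<omega>] by (simp add: compact_closure)
  have D: "D K \<in> convex_bodies0" for K unfolding D_def by (rule hull0_in_convex_bodies0) simp
  have H: "path_hull X \<omega> \<in> convex_bodies0" by (rule path_hull_in_convex_bodies0[OF \<omega>])
  obtain F where F: "finite F" "F \<subseteq> C" "C \<subseteq> (\<Union>x\<in>F. ball x \<epsilon>)"
    using seq_compact_imp_totally_bounded[of C] C \<epsilon> by (auto simp: compact_eq_seq_compact_metric)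
  have near: "eventually (\<lambda>K. infdist x (D K) \<le> 2 * \<epsilon>) sequentially" if x: "x \<in> F" for x
  proof -
    obtain t where t: "t \<in> {0..1}" "dist (X t \<omega>) x < \<epsilon>"
      using F(2) x \<epsilon> by (fastforce simp: C_def closure_approachable)
    \<comment> \<open>Rounding up approaches \<open>t\<close> from the right, where the path is
      continuous, and stays within the grid since \<open>t \<le> 1\<close>.\<close>
    define s where "s K = real_of_int \<lceil>t * 2 ^ K\<rceil> / 2 ^ K" for K :: nat
    have s_ge: "t \<le> s K" and s_le: "s K \<le> t + 1 / 2 ^ K" for K
      using le_of_int_ceiling[of "t * 2 ^ K"] of_int_ceiling_le_add_one[of "t * 2 ^ K"]
      by (auto simp: s_def field_simps)
    have slim: "s \<longlonglongrightarrow> t"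
    proof (rule tendsto_sandwich[of "\<lambda>_. t" _ _ "\<lambda>K. t + 1 / 2 ^ K"])
      show "(\<lambda>K. t + 1 / 2 ^ K) \<longlonglongrightarrow> t" by real_asymp
    qed (use s_ge s_le in auto)
    have "((\<lambda>t. X t \<omega>) \<longlongrightarrow> X t \<omega>) (at_right t)" using X_cadlag[OF \<omega>] t by (auto simp: cadlag_def)
    then have "continuous (at t within {t..}) (\<lambda>t. X t \<omega>)"
      by (simp add: continuous_within at_within_Ici_at_right)
    then have "(\<lambda>K. X (s K) \<omega>) \<longlonglongrightarrow> X t \<omega>"
      using slim s_ge by (auto simp: continuous_within_sequentially comp_def)
    then have "eventually (\<lambda>K. dist (X (s K) \<omega>) (X t \<omega>) < \<epsilon>) sequentially" using \<epsilon> by (rule tendstoD)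
    then show ?thesis
    proof eventually_elim
      case (elim K)
      define i where "i = nat \<lceil>t * 2 ^ K\<rceil>"
      have si: "s K = real i / 2 ^ K" using t by (simp add: s_def i_def)
      have "t * 2 ^ K \<le> real_of_int (2 ^ K)" using t by simp
      then have "\<lceil>t * 2 ^ K\<rceil> \<le> 2 ^ K" by (simp only: ceiling_le_iff)
      then have "i \<le> 2 ^ K" by (simp add: i_def nat_le_iff)
      then have "X (s K) \<omega> \<in> D K" unfolding D_def hull0_def si by (intro hull_inc) auto
      then have "infdist x (D K) \<le> dist x (X (s K) \<omega>)" by (rule infdist_le)
      also have "\<dots> \<le> dist (X t \<omega>) x + dist (X (s K) \<omega>) (X t \<omega>)"
        using dist_triangle[of x "X (s K) \<omega>" "X t \<omega>"] by (simp add: dist_commute)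
      finally show ?case using elim t by simp
    qed
  qed
  have "eventually (\<lambda>K. \<forall>x\<in>F. infdist x (D K) \<le> 2 * \<epsilon>) sequentially"
    using near F(1) by (simp add: eventually_ball_finite_distrib)
  then show "eventually (\<lambda>K. dist (hausdorff_dist (hull0 {..2^K} (\<lambda>i. X (real i / 2 ^ K) \<omega>)) (path_hull X \<omega>)) 0 < e) sequentially"
  proof eventually_elim
    case (elim K)
    have "hausdorff_dist (D K) (path_hull X \<omega>) \<le> 3 * \<epsilon>"
    proof (rule hausdorff_dist_le)
      fix x assume "x \<in> D K"
      have "X (real i / 2 ^ K) \<omega> \<in> C" if "i \<le> 2 ^ K" for i
      proof -
        have "real i \<le> 2 ^ K" using that by (metis of_nat_le_iff of_nat_numeral of_nat_power)
        then show ?thesis unfolding C_def by (intro closure_subset[THEN subsetD] imageI) (simp add: divide_le_eq_1)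
      qed
      then have "(\<lambda>i. X (real i / 2 ^ K) \<omega>) ` {..2^K} \<subseteq> path_hull X \<omega>"
        by (auto simp: path_hull_def C_def intro!: hull_inc)
      then have "D K \<subseteq> path_hull X \<omega>"
        unfolding D_def hull0_def using convex_bodies0D[OF H] by (intro hull_minimal) auto
      then show "infdist x (path_hull X \<omega>) \<le> 3 * \<epsilon>" using \<open>x \<in> D K\<close> \<epsilon> by (auto simp: subset_iff)
    next
      fix y assume y: "y \<in> path_hull X \<omega>"
      show "infdist y (D K) \<le> 3 * \<epsilon>"
      proof (rule infdist_convex_hull_le)
        show "y \<in> convex hull C" using y by (simp add: path_hull_def C_def)
        fix x assume "x \<in> C"
        then obtain z where z: "z \<in> F" "dist z x < \<epsilon>" using F(3) by auto
        have "infdist x (D K) \<le> infdist z (D K) + dist x z" by (rule infdist_triangle)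
        then show "infdist x (D K) \<le> 3 * \<epsilon>" using z elim by (auto simp: dist_commute)
      qed (use convex_bodies0D[OF D] in auto)
    qed (use convex_bodies0D[OF D] convex_bodies0D[OF H] in auto)
    then show ?case using \<epsilon> hausdorff_dist_nonneg[of "D K" "path_hull X \<omega>"] by (simp add: D_def \<epsilon>_def)
  qed
qed

text \<open>Each Lipschitz functional of the path hull is a pointwise limit of functionals of
  finitely many values of \<open>X\<close>.\<close>

lemma measurable_path_hull: "path_hull X \<in> N \<rightarrow>\<^sub>M borel_of hausdorff_topology"
proof (rule hausdorff.measurable_borel_of_mtopologyI)
  show "path_hull X \<in> space N \<rightarrow> convex_bodies0" using path_hull_in_convex_bodies0 by auto
  fix h :: "'a set \<Rightarrow> real"
  assume h: "\<And>x y. x \<in> convex_bodies0 \<Longrightarrow> y \<in> convex_bodies0 \<Longrightarrow> \<bar>h x - h y\<bar> \<le> hausdorff_dist x y"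
  show "(\<lambda>\<omega>. h (path_hull X \<omega>)) \<in> borel_measurable N"
  proof (rule borel_measurable_LIMSEQ_real)
    fix \<omega> assume \<omega>: "\<omega> \<in> space N"
    show "(\<lambda>K. h (hull0 {..2^K} (\<lambda>i. X (real i / 2 ^ K) \<omega>))) \<longlonglongrightarrow> h (path_hull X \<omega>)"
      by (rule hausdorff.lipschitz_tendsto[OF h])
         (auto intro: hull0_in_convex_bodies0 path_hull_in_convex_bodies0[OF \<omega>] dyadic_hull_tendsto[OF \<omega>])
  next
    show "(\<lambda>\<omega>. h (hull0 {..2^K} (\<lambda>i. X (real i / 2 ^ K) \<omega>))) \<in> borel_measurable N" for K :: nat
      by (rule borel_measurable_lipschitz_hull0) (auto intro: X_measurable h)
  qed
qed

end

section \<open>Random walks\<close>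

lemma (in prob_space) integral_indep_sum_BL1:
  fixes U V :: "'a \<Rightarrow> 'b::{real_normed_vector, second_countable_topology}"
  assumes ind: "indep_var borel U borel V" and f: "f \<in> BL1"
  shows "(\<integral>\<omega>. f (U \<omega> + V \<omega>) \<partial>M) = (\<integral>u. \<integral>v. f (u + v) \<partial>distr M borel V \<partial>distr M borel U)"
proof -
  note [measurable] = BL1_borel_measurable[OF f]
  have UV[measurable]: "U \<in> borel_measurable M" "V \<in> borel_measurable M"
    and eq: "distr M borel U \<Otimes>\<^sub>M distr M borel V = distr M (borel \<Otimes>\<^sub>M borel) (\<lambda>\<omega>. (U \<omega>, V \<omega>))"
    using ind unfolding indep_var_distribution_eq by auto
  interpret U: prob_space "distr M borel U" by (rule prob_space_distr) simp
  interpret V: prob_space "distr M borel V" by (rule prob_space_distr) simp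
  interpret P: pair_prob_space "distr M borel U" "distr M borel V" ..
  have int: "integrable (distr M borel U \<Otimes>\<^sub>M distr M borel V) (\<lambda>(u, v). f (u + v))"
    by (rule P.integrable_bounded[of _ 1]) (auto simp: BL1_bound[OF f])
  have "(\<integral>\<omega>. f (U \<omega> + V \<omega>) \<partial>M) = (\<integral>x. (\<lambda>(u, v). f (u + v)) x \<partial>distr M (borel \<Otimes>\<^sub>M borel) (\<lambda>\<omega>. (U \<omega>, V \<omega>)))"
    by (subst integral_distr) auto
  also have "\<dots> = (\<integral>u. \<integral>v. f (u + v) \<partial>distr M borel V \<partial>distr M borel U)"
    unfolding eq[symmetric] using P.integral_fst'[OF int] by simp
  finally show ?thesis .
qed

lemma (in prob_space) distr_indep_sum:
  fixes U V :: "'a \<Rightarrow> 'b::{real_normed_vector, second_countable_topology}"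
  assumes ind: "indep_var borel U borel V"
  shows "distr M borel (\<lambda>\<omega>. U \<omega> + V \<omega>) = distr (distr M borel U \<Otimes>\<^sub>M distr M borel V) borel (\<lambda>(x, y). x + y)"
proof -
  have [measurable]: "U \<in> borel_measurable M" "V \<in> borel_measurable M"
    and eq: "distr M borel U \<Otimes>\<^sub>M distr M borel V = distr M (borel \<Otimes>\<^sub>M borel) (\<lambda>\<omega>. (U \<omega>, V \<omega>))"
    using ind unfolding indep_var_distribution_eq by auto
  show ?thesis unfolding eq by (subst distr_distr) (auto simp: comp_def)
qed

text \<open>Integrating out one summand maps \<open>BL1\<close> to itself, so the two laws can be
  exchanged one after the other.\<close>

lemma bl_close_indep_sum:
  fixes U V :: "'w \<Rightarrow> 'b::{real_normed_vector, second_countable_topology}" and U' V' :: "'v \<Rightarrow> 'b"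
  assumes M: "prob_space M" and N: "prob_space N"
    and ind: "prob_space.indep_var M borel U borel V" and ind': "prob_space.indep_var N borel U' borel V'"
    and UU': "bl_close e (distr M borel U) (distr N borel U')" and VV': "bl_close e' (distr M borel V) (distr N borel V')"
  shows "bl_close (e + e') (distr M borel (\<lambda>\<omega>. U \<omega> + V \<omega>)) (distr N borel (\<lambda>\<omega>. U' \<omega> + V' \<omega>))"
proof -
  interpret M: prob_space M by fact
  interpret N: prob_space N by fact
  have m[measurable]: "U \<in> borel_measurable M" "V \<in> borel_measurable M" "U' \<in> borel_measurable N" "V' \<in> borel_measurable N"
    using ind ind' unfolding M.indep_var_distribution_eq N.indep_var_distribution_eq by auto
  let ?U = "distr M borel U" and ?V = "distr M borel V" and ?U' = "distr N borel U'" and ?V' = "distr N borel V'"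
  have V: "prob_space ?V" and V': "prob_space ?V'" and U: "prob_space ?U"
    by (auto intro: M.prob_space_distr N.prob_space_distr)
  interpret U: prob_space ?U by fact
  show ?thesis
  proof (rule bl_close_distrI)
    fix f :: "'b \<Rightarrow> real" assume f: "f \<in> BL1"
    note [measurable] = BL1_borel_measurable[OF f]
    have fu: "(\<lambda>v. f (u + v)) \<in> BL1" for u
      using BL1_bound[OF f] BL1_lipschitz[OF f] by (auto simp: BL1_def) (metis add_diff_cancel_left)
    define g where "g \<rho> u = (\<integral>v. f (u + v) \<partial>\<rho>)" for \<rho> and u :: 'b
    have g: "g \<rho> \<in> BL1" if \<rho>: "prob_space \<rho>" and s: "sets \<rho> = sets borel" for \<rho>
    proof -
      interpret \<rho>: prob_space \<rho> by fact
      have i: "integrable \<rho> (\<lambda>v. f (u + v))" for u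
        using \<rho>.integrable_BL1[OF fu, of "\<lambda>v. v" u] s by (simp add: measurable_ident_sets)
      have "\<bar>g \<rho> u\<bar> \<le> 1" for u
        using \<rho>.abs_integral_diff_le[OF i, of "\<lambda>_. 0" u 1] BL1_bound[OF f] by (simp add: g_def)
      moreover have "\<bar>g \<rho> u - g \<rho> u'\<bar> \<le> norm (u - u')" for u u'
        unfolding g_def by (rule \<rho>.abs_integral_diff_le[OF i i]) (use BL1_lipschitz[OF f] in \<open>metis add_diff_cancel_right\<close>)
      ultimately show ?thesis by (simp add: BL1_def)
    qed
    have gV: "g ?V \<in> BL1" and gV': "g ?V' \<in> BL1" using g V V' by auto
    have "\<bar>(\<integral>u. g ?V u \<partial>?U) - (\<integral>u. g ?V' u \<partial>?U)\<bar> \<le> e'"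
    proof (rule U.abs_integral_diff_le)
      show "integrable ?U (g ?V)" "integrable ?U (g ?V')"
        using U.integrable_BL1[OF gV, of "\<lambda>v. v"] U.integrable_BL1[OF gV', of "\<lambda>v. v"] by (auto simp: measurable_ident_sets)
      show "\<bar>g ?V u - g ?V' u\<bar> \<le> e'" for u
        using VV' fu[of u] by (auto simp: bl_close_def g_def)
    qed
    moreover have "\<bar>(\<integral>u. g ?V' u \<partial>?U) - (\<integral>u. g ?V' u \<partial>?U')\<bar> \<le> e"
      using UU' gV' by (auto simp: bl_close_def)
    ultimately show "\<bar>(\<integral>\<omega>. f (U \<omega> + V \<omega>) \<partial>M) - (\<integral>\<omega>. f (U' \<omega> + V' \<omega>) \<partial>N)\<bar> \<le> e + e'"
      unfolding M.integral_indep_sum_BL1[OF ind f] N.integral_indep_sum_BL1[OF ind' f] by (simp add: g_def)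
  qed auto
qed

section \<open>The centred random walk and the independence of its blocks\<close>

locale random_walk = prob_space M for M :: "'w measure" +
  fixes Y :: "nat \<Rightarrow> 'w \<Rightarrow> 'a::euclidean_space" and a :: "nat \<Rightarrow> 'a"
  assumes indep: "indep_vars (\<lambda>_. borel) Y {1..}"
    and ident: "\<And>i. 1 \<le> i \<Longrightarrow> distr M borel (Y i) = distr M borel (Y 1)"
    and a0: "a 0 = 0"
begin

definition T :: "nat \<Rightarrow> 'w \<Rightarrow> 'a" where
  "T k \<omega> = walk Y k \<omega> - a k"

lemma Y_measurable: "1 \<le> i \<Longrightarrow> Y i \<in> borel_measurable M"
  using indep by (auto simp: indep_vars_def)

lemma sum_Y_measurable: "A \<subseteq> {1..} \<Longrightarrow> (\<lambda>\<omega>. \<Sum>i\<in>A. Y i \<omega>) \<in> borel_measurable M"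
  by (intro borel_measurable_sum Y_measurable) auto

lemma walk_measurable[measurable]: "walk Y k \<in> borel_measurable M"
  unfolding walk_def[abs_def] by (intro sum_Y_measurable) auto

lemma T_measurable[measurable]: "T k \<in> borel_measurable M"
  unfolding T_def by measurable

lemma T_zero [simp]: "T 0 \<omega> = 0"
  by (simp add: T_def walk_def a0)

lemma T_diff:
  assumes "j \<le> k"
  shows "T k \<omega> - T j \<omega> = (\<Sum>i\<in>{j<..k}. Y i \<omega>) - (a k - a j)"
proof -
  have "{1..k} = {1..j} \<union> {j<..k}" using assms by auto
  then have "(\<Sum>i=1..k. Y i \<omega>) = (\<Sum>i\<in>{1..j} \<union> {j<..k}. Y i \<omega>)" by (simp only:)
  also have "\<dots> = (\<Sum>i=1..j. Y i \<omega>) + (\<Sum>i\<in>{j<..k}. Y i \<omega>)" by (rule sum.union_disjoint) auto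
  finally show ?thesis by (simp add: T_def walk_def)
qed

lemma indep_sums:
  assumes "A \<inter> B = {}" "A \<subseteq> {1..}" "B \<subseteq> {1..}"
  shows "indep_var borel (\<lambda>\<omega>. \<Sum>i\<in>A. Y i \<omega>) borel (\<lambda>\<omega>. \<Sum>i\<in>B. Y i \<omega>)"
proof -
  have m: "(\<lambda>x. \<Sum>i\<in>C. x i) \<in> borel_measurable (\<Pi>\<^sub>M i\<in>C. (borel :: 'a measure))" for C :: "nat set"
    by (intro borel_measurable_sum measurable_component_singleton) auto
  have "indep_var borel ((\<lambda>x. \<Sum>i\<in>A. x i) \<circ> (\<lambda>\<omega>. restrict (\<lambda>i. Y i \<omega>) A)) borel ((\<lambda>x. \<Sum>i\<in>B. x i) \<circ> (\<lambda>\<omega>. restrict (\<lambda>i. Y i \<omega>) B))"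
    by (rule indep_var_compose[OF indep_var_restrict[OF indep assms] m m])
  moreover have "((\<lambda>x. \<Sum>i\<in>C. x i) \<circ> (\<lambda>\<omega>. restrict (\<lambda>i. Y i \<omega>) C)) = (\<lambda>\<omega>. \<Sum>i\<in>C. Y i \<omega>)" for C
    by (auto simp: fun_eq_iff intro!: sum.cong)
  ultimately show ?thesis by simp
qed

text \<open>The law of a sum of independent pieces depends only on their laws; \<open>step\<close>,
  used for the block and for the initial segment, extends equality by one summand.\<close>

lemma distr_block_sum: "distr M borel (\<lambda>\<omega>. \<Sum>i\<in>{j<..j + n}. Y i \<omega>) = distr M borel (walk Y n)"
proof (induction n)
  case 0
  then show ?case by (simp add: walk_def)
next
  case (Suc n)
  have step: "distr M borel (\<lambda>\<omega>. \<Sum>i\<in>{j<..j + Suc n}. Y i \<omega>) = distr (distr M borel (\<lambda>\<omega>. \<Sum>i\<in>{j<..j + n}. Y i \<omega>) \<Otimes>\<^sub>M distr M borel (Y 1)) borel (\<lambda>(x, y). x + y)" for j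
  proof -
    have "{j<..j + Suc n} = {j<..j + n} \<union> {j + Suc n}" by auto
    then have "(\<lambda>\<omega>. \<Sum>i\<in>{j<..j + Suc n}. Y i \<omega>) = (\<lambda>\<omega>. (\<Sum>i\<in>{j<..j + n}. Y i \<omega>) + (\<Sum>i\<in>{j + Suc n}. Y i \<omega>))"
      by (simp add: sum.union_disjoint add.commute)
    then have "distr M borel (\<lambda>\<omega>. \<Sum>i\<in>{j<..j + Suc n}. Y i \<omega>) =
        distr M borel (\<lambda>\<omega>. (\<Sum>i\<in>{j<..j + n}. Y i \<omega>) + (\<Sum>i\<in>{j + Suc n}. Y i \<omega>))" by simp
    also have "\<dots> = distr (distr M borel (\<lambda>\<omega>. \<Sum>i\<in>{j<..j + n}. Y i \<omega>) \<Otimes>\<^sub>M distr M borel (\<lambda>\<omega>. \<Sum>i\<in>{j + Suc n}. Y i \<omega>)) borel (\<lambda>(x, y). x + y)"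
      by (intro distr_indep_sum indep_sums) auto
    also have "distr M borel (\<lambda>\<omega>. \<Sum>i\<in>{j + Suc n}. Y i \<omega>) = distr M borel (Y 1)"
      using ident[of "j + Suc n"] by simp
    finally show ?thesis .
  qed
  have w: "walk Y n = (\<lambda>\<omega>. \<Sum>i\<in>{0<..0 + n}. Y i \<omega>)" for n
    by (auto simp: walk_def fun_eq_iff atLeastSucAtMost_greaterThanAtMost intro!: sum.cong)
  show ?case unfolding w step using Suc.IH unfolding w by simp
qed

text \<open>The increments of the centred walk are stationary only up to a constant, the defect of
  additivity of \<open>a\<close>, which \<open>centering_additive\<close> controls later.\<close>

lemma distr_T_diff:
  assumes "j \<le> k"
  shows "distr M borel (\<lambda>\<omega>. T k \<omega> - T j \<omega>) = distr M borel (\<lambda>\<omega>. T (k - j) \<omega> + (a (k - j) + a j - a k))"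
proof -
  have "distr M borel (\<lambda>\<omega>. T k \<omega> - T j \<omega>) = distr M borel (\<lambda>\<omega>. (\<Sum>i\<in>{j<..j + (k - j)}. Y i \<omega>) - (a k - a j))"
    using assms by (simp add: T_diff)
  also have "\<dots> = distr (distr M borel (\<lambda>\<omega>. \<Sum>i\<in>{j<..j + (k - j)}. Y i \<omega>)) borel (\<lambda>x. x - (a k - a j))"
    by (subst distr_distr) (auto simp: comp_def intro!: sum_Y_measurable)
  also have "\<dots> = distr (distr M borel (walk Y (k - j))) borel (\<lambda>x. x - (a k - a j))"
    by (simp only: distr_block_sum)
  also have "\<dots> = distr M borel (\<lambda>\<omega>. walk Y (k - j) \<omega> - (a k - a j))"
    by (subst distr_distr) (auto simp: comp_def)
  also have "(\<lambda>\<omega>. walk Y (k - j) \<omega> - (a k - a j)) = (\<lambda>\<omega>. T (k - j) \<omega> + (a (k - j) + a j - a k))"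
    by (simp add: T_def algebra_simps)
  finally show ?thesis .
qed

lemma indep_T_diff:
  assumes "i \<le> j" "j \<le> k"
  shows "indep_var borel (\<lambda>\<omega>. T j \<omega> - T i \<omega>) borel (\<lambda>\<omega>. T k \<omega> - T j \<omega>)"
proof -
  have "indep_var borel ((\<lambda>x. x - (a j - a i)) \<circ> (\<lambda>\<omega>. \<Sum>l\<in>{i<..j}. Y l \<omega>)) borel ((\<lambda>x. x - (a k - a j)) \<circ> (\<lambda>\<omega>. \<Sum>l\<in>{j<..k}. Y l \<omega>))"
    by (rule indep_var_compose[OF indep_sums]) auto
  then show ?thesis using assms by (simp add: T_diff comp_def)
qed

lemma indep_vars_T_diff:
  assumes "mono t"
  shows "indep_vars (\<lambda>_. borel) (\<lambda>i \<omega>. T (t (Suc i)) \<omega> - T (t i) \<omega>) (I :: nat set)"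
proof -
  let ?K = "\<lambda>i. {t i<..t (Suc i)}"
  have disj: "disjoint_family_on ?K I"
    unfolding disjoint_family_on_def
  proof (intro ballI impI)
    fix i j :: nat assume "i \<noteq> j"
    then consider "i < j" | "j < i" by linarith
    then show "?K i \<inter> ?K j = {}"
    proof cases
      case 1
      then have "t (Suc i) \<le> t j" using assms by (simp add: monoD)
      then show ?thesis by auto
    next
      case 2
      then have "t (Suc j) \<le> t i" using assms by (simp add: monoD)
      then show ?thesis by auto
    qed
  qed
  have r: "indep_vars (\<lambda>j. \<Pi>\<^sub>M i\<in>?K j. borel) (\<lambda>j \<omega>. restrict (\<lambda>i. Y i \<omega>) (?K j)) I"
    by (rule indep_vars_restrict[OF indep _ disj]) auto
  have "indep_vars (\<lambda>_. borel) (\<lambda>j \<omega>. (\<Sum>i\<in>?K j. restrict (\<lambda>i. Y i \<omega>) (?K j) i) - (a (t (Suc j)) - a (t j))) I"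
    by (rule indep_vars_compose2[OF r])
       (intro borel_measurable_diff borel_measurable_sum measurable_component_singleton, auto)
  moreover have "(\<Sum>i\<in>?K j. restrict (\<lambda>i. Y i \<omega>) (?K j) i) - (a (t (Suc j)) - a (t j)) = T (t (Suc j)) \<omega> - T (t j) \<omega>" for j \<omega>
  proof -
    have "t j \<le> t (Suc j)" using assms by (simp add: monoD)
    moreover have "(\<Sum>i\<in>?K j. restrict (\<lambda>i. Y i \<omega>) (?K j) i) = (\<Sum>i\<in>?K j. Y i \<omega>)" by (intro sum.cong) auto
    ultimately show ?thesis by (simp add: T_diff)
  qed
  ultimately show ?thesis by simp
qed

lemma indep_past_future:
  assumes P: "P \<in> sets (\<Pi>\<^sub>M i\<in>{j<..k}. borel)" and Q: "Q \<in> sets (\<Pi>\<^sub>M i\<in>{k<..m}. borel)"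
  shows "prob {\<omega> \<in> space M. restrict (\<lambda>i. Y i \<omega>) {j<..k} \<in> P \<and> restrict (\<lambda>i. Y i \<omega>) {k<..m} \<in> Q} =
    prob {\<omega> \<in> space M. restrict (\<lambda>i. Y i \<omega>) {j<..k} \<in> P} * prob {\<omega> \<in> space M. restrict (\<lambda>i. Y i \<omega>) {k<..m} \<in> Q}"
proof -
  have "indep_var (\<Pi>\<^sub>M i\<in>{j<..k}. borel) (\<lambda>\<omega>. restrict (\<lambda>i. Y i \<omega>) {j<..k}) (\<Pi>\<^sub>M i\<in>{k<..m}. borel) (\<lambda>\<omega>. restrict (\<lambda>i. Y i \<omega>) {k<..m})"
    by (rule indep_var_restrict[OF indep]) auto
  from indep_varD[OF this P Q] show ?thesis
    by (simp add: vimage_def Int_def conj_ac)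
qed

section \<open>First exits and maximal inequalities\<close>

text \<open>The event that \<open>k\<close> is the first exit time, after \<open>j\<close>, from the
  ball of radius \<open>c\<close> around the start. These events are disjoint in \<open>k\<close>
  and determined by the steps up to \<open>k\<close>, hence independent of the later steps.\<close>

definition crossing :: "real \<Rightarrow> nat \<Rightarrow> nat \<Rightarrow> 'w set" where
  "crossing c j k = {\<omega> \<in> space M. c < norm (T k \<omega> - T j \<omega>) \<and> (\<forall>i\<in>{j..<k}. norm (T i \<omega> - T j \<omega>) \<le> c)}"

lemma crossing_measurable[measurable]: "crossing c j k \<in> sets M"
  unfolding crossing_def by measurable

lemma disjoint_crossing: "disjoint_family_on (crossing c j) {j..m}"
  unfolding disjoint_family_on_def crossing_def
proof (intro ballI impI)
  fix k l assume "k \<in> {j..m}" "l \<in> {j..m}" "k \<noteq> l"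
  then consider "k < l" "j \<le> k" | "l < k" "j \<le> l" by fastforce
  then show "{\<omega> \<in> space M. c < norm (T k \<omega> - T j \<omega>) \<and> (\<forall>i\<in>{j..<k}. norm (T i \<omega> - T j \<omega>) \<le> c)} \<inter>
    {\<omega> \<in> space M. c < norm (T l \<omega> - T j \<omega>) \<and> (\<forall>i\<in>{j..<l}. norm (T i \<omega> - T j \<omega>) \<le> c)} = {}"
    by cases (fastforce simp: not_le[symmetric])+
qed

lemma crossing_exists:
  assumes "\<omega> \<in> space M" "k \<in> {j..m}" "c < norm (T k \<omega> - T j \<omega>)"
  obtains l where "l \<in> {j..k}" "\<omega> \<in> crossing c j l"
proof -
  define l where "l = (LEAST i. j \<le> i \<and> c < norm (T i \<omega> - T j \<omega>))"
  have l: "j \<le> l \<and> c < norm (T l \<omega> - T j \<omega>)"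
    unfolding l_def by (rule LeastI[of _ k]) (use assms in auto)
  have "l \<le> k" unfolding l_def by (rule Least_le) (use assms in auto)
  moreover have "norm (T i \<omega> - T j \<omega>) \<le> c" if "i \<in> {j..<l}" for i
    using not_less_Least[of i "\<lambda>i. j \<le> i \<and> c < norm (T i \<omega> - T j \<omega>)"] that by (auto simp: l_def not_less)
  ultimately show ?thesis using that[of l] l assms(1) by (auto simp: crossing_def)
qed

lemma crossing_Union:
  "(\<Union>k\<in>{j..m}. crossing c j k) = {\<omega> \<in> space M. \<exists>k\<in>{j..m}. c < norm (T k \<omega> - T j \<omega>)}"
proof (intro set_eqI iffI)
  fix \<omega> assume "\<omega> \<in> {\<omega> \<in> space M. \<exists>k\<in>{j..m}. c < norm (T k \<omega> - T j \<omega>)}"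
  then obtain k where k: "\<omega> \<in> space M" "k \<in> {j..m}" "c < norm (T k \<omega> - T j \<omega>)" by auto
  from crossing_exists[OF this] obtain l where "l \<in> {j..k}" "\<omega> \<in> crossing c j l" .
  then show "\<omega> \<in> (\<Union>k\<in>{j..m}. crossing c j k)" using k(2) by auto
qed (auto simp: crossing_def)

lemma prob_crossing_Union:
  "prob {\<omega> \<in> space M. \<exists>k\<in>{j..m}. c < norm (T k \<omega> - T j \<omega>)} = (\<Sum>k\<in>{j..m}. prob (crossing c j k))"
  unfolding crossing_Union[symmetric]
  by (rule finite_measure_finite_Union[OF _ _ disjoint_crossing]) auto

lemma prob_crossing_future:
  assumes jk: "j \<le> k" and k: "k \<le> m" and Q: "Q \<in> sets (\<Pi>\<^sub>M i\<in>{k<..m}. borel)"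
  shows "prob (crossing c j k \<inter> {\<omega> \<in> space M. restrict (\<lambda>i. Y i \<omega>) {k<..m} \<in> Q}) =
    prob (crossing c j k) * prob {\<omega> \<in> space M. restrict (\<lambda>i. Y i \<omega>) {k<..m} \<in> Q}"
proof -
  let ?S = "\<Pi>\<^sub>M i\<in>{j<..k}. (borel :: 'a measure)"
  define F where "F i x = norm ((\<Sum>l\<in>{j<..i}. x l) - (a i - a j))" for i and x :: "nat \<Rightarrow> 'a"
  have Fm[measurable]: "F i \<in> borel_measurable ?S" if "i \<le> k" for i
  proof -
    have [measurable]: "(\<lambda>x. \<Sum>l\<in>{j<..i}. x l) \<in> borel_measurable ?S"
      using that by (intro borel_measurable_sum measurable_component_singleton) auto
    show ?thesis unfolding F_def by measurable
  qed
  define P where "P = {x \<in> space ?S. c < F k x \<and> (\<forall>i\<in>{j..<k}. F i x \<le> c)}"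
  have P: "P \<in> sets ?S"
  proof -
    have 1: "{x \<in> space ?S. c < F k x} \<in> sets ?S" using Fm[of k] by measurable
    have 2: "{x \<in> space ?S. \<forall>i\<in>{j..<k}. F i x \<le> c} \<in> sets ?S"
      using Fm by (intro sets.sets_Collect_finite_All borel_measurable_le) auto
    show ?thesis unfolding P_def using sets.sets_Collect_conj[OF 2 1] .
  qed
  have F: "F i (restrict (\<lambda>i. Y i \<omega>) {j<..k}) = norm (T i \<omega> - T j \<omega>)" if "j \<le> i" "i \<le> k" for i \<omega>
  proof -
    have "(\<Sum>l\<in>{j<..i}. restrict (\<lambda>i. Y i \<omega>) {j<..k} l) = (\<Sum>l\<in>{j<..i}. Y l \<omega>)"
      using that by (intro sum.cong) auto
    then show ?thesis using that by (simp add: F_def T_diff)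
  qed
  have "crossing c j k = {\<omega> \<in> space M. restrict (\<lambda>i. Y i \<omega>) {j<..k} \<in> P}"
    using jk by (auto simp: crossing_def P_def F space_PiM)
  then show ?thesis using indep_past_future[OF P Q] by (simp add: Int_def conj_ac)
qed

text \<open>Rewrites a condition on the increments after \<open>k\<close> as a measurable condition
  on the later steps, the form that \<open>prob_crossing_future\<close> takes. The predicate
  \<open>c\<close> matches the events as they are written; the sets \<open>C\<close> carry the
  measurability.\<close>

lemma future_event:
  assumes "A \<subseteq> {k..m}" "finite A" "\<And>l x. c l x \<longleftrightarrow> x \<in> C l" "\<And>l. C l \<in> sets borel"
  obtains Q where "Q \<in> sets (\<Pi>\<^sub>M i\<in>{k<..m}. borel)"
    "{\<omega> \<in> space M. \<exists>l\<in>A. c l (T l \<omega> - T k \<omega>)} = {\<omega> \<in> space M. restrict (\<lambda>i. Y i \<omega>) {k<..m} \<in> Q}"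
proof -
  let ?S = "\<Pi>\<^sub>M i\<in>{k<..m}. (borel :: 'a measure)"
  define F where "F i x = (\<Sum>l\<in>{k<..i}. x l) - (a i - a k)" for i and x :: "nat \<Rightarrow> 'a"
  have Fm: "F i \<in> borel_measurable ?S" if "i \<le> m" for i
    unfolding F_def using that by (intro borel_measurable_diff borel_measurable_sum measurable_component_singleton) auto
  define Q where "Q = {x \<in> space ?S. \<exists>l\<in>A. F l x \<in> C l}"
  have "{x \<in> space ?S. F l x \<in> C l} \<in> sets ?S" if "l \<in> A" for l
  proof -
    have "l \<le> m" using that assms(1) by auto
    from measurable_sets[OF Fm[OF this] assms(4)[of l]] show ?thesis by (simp add: vimage_def Int_def conj_commute)
  qed
  then have Q: "Q \<in> sets ?S"
    unfolding Q_def using assms(2) by (intro sets.sets_Collect_finite_Ex) auto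
  have F: "F i (restrict (\<lambda>i. Y i \<omega>) {k<..m}) = T i \<omega> - T k \<omega>" if "i \<in> A" for i \<omega>
  proof -
    have "(\<Sum>l\<in>{k<..i}. restrict (\<lambda>i. Y i \<omega>) {k<..m} l) = (\<Sum>l\<in>{k<..i}. Y l \<omega>)"
      using that assms(1) by (intro sum.cong) auto
    then show ?thesis using that assms(1) by (subst T_diff) (auto simp: F_def)
  qed
  have "{\<omega> \<in> space M. \<exists>l\<in>A. c l (T l \<omega> - T k \<omega>)} = {\<omega> \<in> space M. restrict (\<lambda>i. Y i \<omega>) {k<..m} \<in> Q}"
    by (auto simp: Q_def F space_PiM assms(3))
  with Q show ?thesis using that by blast
qed

text \<open>After the first exit from radius 2c the walk moves by at most c until time
  \<open>m\<close> with probability at least 1/2, independently of the past, and then it ends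
  outside radius c.\<close>

lemma ottaviani:
  assumes "j \<le> m" and half: "\<And>k. k \<in> {j..m} \<Longrightarrow> prob {\<omega> \<in> space M. c < norm (T m \<omega> - T k \<omega>)} \<le> 1 / 2"
  shows "prob {\<omega> \<in> space M. \<exists>k\<in>{j..m}. 2 * c < norm (T k \<omega> - T j \<omega>)} \<le> 2 * prob {\<omega> \<in> space M. c < norm (T m \<omega> - T j \<omega>)}"
proof -
  define B where "B k = {\<omega> \<in> space M. norm (T m \<omega> - T k \<omega>) \<le> c}" for k
  have Bm: "B k \<in> sets M" for k unfolding B_def by measurable
  have Bhalf: "1 / 2 \<le> prob (B k)" if "k \<in> {j..m}" for k
  proof -
    have "B k = space M - {\<omega> \<in> space M. c < norm (T m \<omega> - T k \<omega>)}" by (auto simp: B_def)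
    then have "prob (B k) = 1 - prob {\<omega> \<in> space M. c < norm (T m \<omega> - T k \<omega>)}" by (simp add: prob_compl)
    then show ?thesis using half[OF that] by simp
  qed
  have "(1 / 2) * prob {\<omega> \<in> space M. \<exists>k\<in>{j..m}. 2 * c < norm (T k \<omega> - T j \<omega>)} = (\<Sum>k\<in>{j..m}. prob (crossing (2 * c) j k) * (1 / 2))"
    by (simp add: prob_crossing_Union sum_divide_distrib)
  also have "\<dots> \<le> (\<Sum>k\<in>{j..m}. prob (crossing (2 * c) j k) * prob (B k))"
    using Bhalf by (intro sum_mono mult_left_mono) auto
  also have "\<dots> = (\<Sum>k\<in>{j..m}. prob (crossing (2 * c) j k \<inter> B k))"
  proof (intro sum.cong refl)
    fix k assume k: "k \<in> {j..m}"
    obtain Q where "Q \<in> sets (\<Pi>\<^sub>M i\<in>{k<..m}. borel)"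
      "{\<omega> \<in> space M. \<exists>l\<in>{m}. norm (T l \<omega> - T k \<omega>) \<le> c} = {\<omega> \<in> space M. restrict (\<lambda>i. Y i \<omega>) {k<..m} \<in> Q}"
      using future_event[of "{m}" k m "\<lambda>_ x. norm x \<le> c" "\<lambda>_. cball 0 c"] k by auto
    then show "prob (crossing (2 * c) j k) * prob (B k) = prob (crossing (2 * c) j k \<inter> B k)"
      using prob_crossing_future[of j k m Q "2 * c"] k by (simp add: B_def)
  qed
  also have "\<dots> = prob (\<Union>k\<in>{j..m}. crossing (2 * c) j k \<inter> B k)"
    using disjoint_crossing[of "2 * c" j m] Bm
    by (intro finite_measure_finite_Union[symmetric]) (auto simp: disjoint_family_on_def)
  also have "\<dots> \<le> prob {\<omega> \<in> space M. c < norm (T m \<omega> - T j \<omega>)}"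
  proof (rule finite_measure_mono)
    show "(\<Union>k\<in>{j..m}. crossing (2 * c) j k \<inter> B k) \<subseteq> {\<omega> \<in> space M. c < norm (T m \<omega> - T j \<omega>)}"
    proof
      fix \<omega> assume "\<omega> \<in> (\<Union>k\<in>{j..m}. crossing (2 * c) j k \<inter> B k)"
      then obtain k where "\<omega> \<in> space M" "2 * c < norm (T k \<omega> - T j \<omega>)" "norm (T m \<omega> - T k \<omega>) \<le> c"
        by (auto simp: crossing_def B_def)
      moreover have "norm (T k \<omega> - T j \<omega>) \<le> norm (T m \<omega> - T j \<omega>) + norm (T m \<omega> - T k \<omega>)"
        using norm_triangle_ineq4[of "T m \<omega> - T j \<omega>" "T m \<omega> - T k \<omega>"] by simp
      ultimately show "\<omega> \<in> {\<omega> \<in> space M. c < norm (T m \<omega> - T j \<omega>)}" by simp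
    qed
  qed measurable
  finally show ?thesis by simp
qed

text \<open>After the first exit from the ball around the start the walk starts afresh, so being far from
  both end points at some time requires two independent large excursions.\<close>
lemma two_excursions:
  assumes q: "\<And>k. k \<in> {j..m} \<Longrightarrow> prob {\<omega> \<in> space M. \<exists>l\<in>{k..m}. c < norm (T l \<omega> - T k \<omega>)} \<le> q"
  shows "prob {\<omega> \<in> space M. \<exists>k\<in>{j..m}. 2 * c < norm (T k \<omega> - T j \<omega>) \<and> 2 * c < norm (T m \<omega> - T k \<omega>)} \<le>
    prob {\<omega> \<in> space M. \<exists>k\<in>{j..m}. 2 * c < norm (T k \<omega> - T j \<omega>)} * q"
proof -
  define B where "B k = {\<omega> \<in> space M. \<exists>l\<in>{k..m}. c < norm (T l \<omega> - T k \<omega>)}" for k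
  have Bm: "B k \<in> sets M" for k unfolding B_def by measurable
  have "prob {\<omega> \<in> space M. \<exists>k\<in>{j..m}. 2 * c < norm (T k \<omega> - T j \<omega>) \<and> 2 * c < norm (T m \<omega> - T k \<omega>)} \<le>
      prob (\<Union>k\<in>{j..m}. crossing (2 * c) j k \<inter> B k)"
  proof (rule finite_measure_mono)
    show "{\<omega> \<in> space M. \<exists>k\<in>{j..m}. 2 * c < norm (T k \<omega> - T j \<omega>) \<and> 2 * c < norm (T m \<omega> - T k \<omega>)} \<subseteq> (\<Union>k\<in>{j..m}. crossing (2 * c) j k \<inter> B k)"
    proof
      fix \<omega> assume "\<omega> \<in> {\<omega> \<in> space M. \<exists>k\<in>{j..m}. 2 * c < norm (T k \<omega> - T j \<omega>) \<and> 2 * c < norm (T m \<omega> - T k \<omega>)}"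
      then obtain k where \<omega>: "\<omega> \<in> space M" and k: "k \<in> {j..m}" "2 * c < norm (T k \<omega> - T j \<omega>)" "2 * c < norm (T m \<omega> - T k \<omega>)" by auto
      obtain l where l: "l \<in> {j..k}" "\<omega> \<in> crossing (2 * c) j l" using crossing_exists[OF \<omega> k(1,2)] .
      \<comment> \<open>Both \<open>k\<close> and \<open>m\<close> come after the first exit
        \<open>l\<close> and their positions are more than 2c apart, so one of them is more than c
        away from the position at \<open>l\<close>.\<close>
      have "norm (T m \<omega> - T k \<omega>) \<le> norm (T m \<omega> - T l \<omega>) + norm (T k \<omega> - T l \<omega>)"
        using norm_triangle_ineq4[of "T m \<omega> - T l \<omega>" "T k \<omega> - T l \<omega>"] by simp
      then have "c < norm (T m \<omega> - T l \<omega>) \<or> c < norm (T k \<omega> - T l \<omega>)" using k(3) by linarith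
      then have "\<omega> \<in> B l" using l(1) k(1) \<omega> by (auto simp: B_def)
      then show "\<omega> \<in> (\<Union>k\<in>{j..m}. crossing (2 * c) j k \<inter> B k)" using l k(1) by auto
    qed
    show "(\<Union>k\<in>{j..m}. crossing (2 * c) j k \<inter> B k) \<in> sets M" using Bm by auto
  qed
  also have "\<dots> = (\<Sum>k\<in>{j..m}. prob (crossing (2 * c) j k \<inter> B k))"
    using disjoint_crossing[of "2 * c" j m] Bm
    by (intro finite_measure_finite_Union) (auto simp: disjoint_family_on_def)
  also have "\<dots> = (\<Sum>k\<in>{j..m}. prob (crossing (2 * c) j k) * prob (B k))"
  proof (intro sum.cong refl)
    fix k assume k: "k \<in> {j..m}"
    obtain Q where "Q \<in> sets (\<Pi>\<^sub>M i\<in>{k<..m}. borel)"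
      "{\<omega> \<in> space M. \<exists>l\<in>{k..m}. c < norm (T l \<omega> - T k \<omega>)} = {\<omega> \<in> space M. restrict (\<lambda>i. Y i \<omega>) {k<..m} \<in> Q}"
      by (rule future_event[of "{k..m}" k m "\<lambda>_ x. c < norm x" "\<lambda>_. - cball 0 c"]) auto
    then show "prob (crossing (2 * c) j k \<inter> B k) = prob (crossing (2 * c) j k) * prob (B k)"
      using prob_crossing_future[of j k m Q "2 * c"] k by (simp add: B_def)
  qed
  also have "\<dots> \<le> (\<Sum>k\<in>{j..m}. prob (crossing (2 * c) j k) * q)"
    using q by (intro sum_mono mult_left_mono) (auto simp: B_def)
  also have "\<dots> = prob {\<omega> \<in> space M. \<exists>k\<in>{j..m}. 2 * c < norm (T k \<omega> - T j \<omega>)} * q"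
    by (simp add: prob_crossing_Union sum_distrib_right)
  finally show ?thesis .
qed

text \<open>The constants: Ottaviani turns the tail r at level c into 2r for maxima at level 2c, and
  the two excursions double the level once more while multiplying the probabilities.\<close>

lemma far_from_both_ends:
  assumes "j \<le> m" "0 \<le> c" and r: "r \<le> 1 / 2"
    and le: "\<And>k l. j \<le> k \<Longrightarrow> k \<le> l \<Longrightarrow> l \<le> m \<Longrightarrow> prob {\<omega> \<in> space M. c < norm (T l \<omega> - T k \<omega>)} \<le> r"
  shows "prob {\<omega> \<in> space M. \<exists>k\<in>{j..m}. 4 * c < norm (T k \<omega> - T j \<omega>) \<and> 4 * c < norm (T m \<omega> - T k \<omega>)} \<le> 4 * r\<^sup>2"
proof -
  have max: "prob {\<omega> \<in> space M. \<exists>l\<in>{k..m}. 2 * c < norm (T l \<omega> - T k \<omega>)} \<le> 2 * r" if k: "k \<in> {j..m}" for k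
  proof -
    have "prob {\<omega> \<in> space M. \<exists>l\<in>{k..m}. 2 * c < norm (T l \<omega> - T k \<omega>)} \<le> 2 * prob {\<omega> \<in> space M. c < norm (T m \<omega> - T k \<omega>)}"
    proof (rule ottaviani)
      show "prob {\<omega> \<in> space M. c < norm (T m \<omega> - T i \<omega>)} \<le> 1 / 2" if "i \<in> {k..m}" for i
        using le[of i m] r that k by auto
    qed (use k in auto)
    also have "\<dots> \<le> 2 * r" using le[of k m] k by auto
    finally show ?thesis .
  qed
  have r0: "0 \<le> r" using le[of j j] assms(1) by (intro order_trans[OF measure_nonneg]) auto
  have "prob {\<omega> \<in> space M. \<exists>k\<in>{j..m}. 2 * (2 * c) < norm (T k \<omega> - T j \<omega>) \<and> 2 * (2 * c) < norm (T m \<omega> - T k \<omega>)}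
      \<le> prob {\<omega> \<in> space M. \<exists>k\<in>{j..m}. 2 * (2 * c) < norm (T k \<omega> - T j \<omega>)} * (2 * r)"
    by (rule two_excursions) (rule max)
  also have "\<dots> \<le> (2 * r) * (2 * r)"
  proof (rule mult_right_mono)
    have "prob {\<omega> \<in> space M. \<exists>k\<in>{j..m}. 2 * (2 * c) < norm (T k \<omega> - T j \<omega>)} \<le> prob {\<omega> \<in> space M. \<exists>k\<in>{j..m}. 2 * c < norm (T k \<omega> - T j \<omega>)}"
    proof (rule finite_measure_mono)
      have "2 * c < x" if "2 * (2 * c) < x" for x using that assms(2) by linarith
      then show "{\<omega> \<in> space M. \<exists>k\<in>{j..m}. 2 * (2 * c) < norm (T k \<omega> - T j \<omega>)} \<subseteq> {\<omega> \<in> space M. \<exists>k\<in>{j..m}. 2 * c < norm (T k \<omega> - T j \<omega>)}"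
        by blast
    qed measurable
    also have "\<dots> \<le> 2 * r" using assms(1) by (intro max) auto
    finally show "prob {\<omega> \<in> space M. \<exists>k\<in>{j..m}. 2 * (2 * c) < norm (T k \<omega> - T j \<omega>)} \<le> 2 * r" .
  qed (use r0 in auto)
  finally show ?thesis by (simp add: power2_eq_square)
qed

end

section \<open>Translates of a stable law\<close>

context stable_process
begin

lemma integral_self_similar:
  fixes g :: "'a \<Rightarrow> real"
  assumes "0 \<le> t" and [measurable]: "g \<in> borel_measurable borel"
  shows "(\<integral>\<omega>. g (X t \<omega>) \<partial>N) = (\<integral>\<omega>. g ((t powr (1 / \<alpha>)) *\<^sub>R X 1 \<omega>) \<partial>N)"
proof -
  have [measurable]: "X t \<in> borel_measurable N" "X 1 \<in> borel_measurable N" using assms X_measurable by auto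
  have "(\<integral>\<omega>. g (X t \<omega>) \<partial>N) = (\<integral>x. g x \<partial>distr N borel (X t))" by (subst integral_distr) auto
  also have "\<dots> = (\<integral>x. g x \<partial>distr N borel (\<lambda>\<omega>. (t powr (1 / \<alpha>)) *\<^sub>R X 1 \<omega>))"
    by (simp only: distr_self_similar[OF assms(1)])
  also have "\<dots> = (\<integral>\<omega>. g ((t powr (1 / \<alpha>)) *\<^sub>R X 1 \<omega>) \<partial>N)" by (subst integral_distr) auto
  finally show ?thesis .
qed

text \<open>A law close to its translate by \<open>c\<close> is close to the translates by small multiples of \<open>c\<close>,
  which escape to infinity unless \<open>c\<close> is small.\<close>
lemma bl_close_translate_small:
  assumes \<epsilon>: "0 < \<epsilon>"
  shows "\<exists>e>0. \<forall>t\<in>{0..1}. \<forall>c. bl_close e (distr N borel (\<lambda>\<omega>. X t \<omega> + c)) (distr N borel (X t)) \<longrightarrow> norm c < \<epsilon>"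
proof -
  have X1[measurable]: "X 1 \<in> borel_measurable N" using X_measurable by simp
  obtain R :: nat where R: "prob {\<omega> \<in> space N. real R < norm (X 1 \<omega>)} < 1 / 4"
    using exists_norm_bound[OF X1, of "1 / 4"] by auto
  \<comment> \<open>So large that m translations by a vector of norm at least \<epsilon> carry the
    ball of radius R outside the ball of radius R + 1, where the test function \<open>f\<close>
    vanishes.\<close>
  obtain m :: nat where m: "(2 * real R + 1) / \<epsilon> < real m" using reals_Archimedean2 by blast
  have "0 < (2 * real R + 1) / \<epsilon>" using \<epsilon> by (simp add: add_pos_nonneg)
  then have m0: "0 < real m" using m by linarith
  \<comment> \<open>The m translations cost 1/4 altogether, while the integral of \<open>f\<close>
    falls from at least 3/4 to at most 1/4.\<close>
  define e where "e = 1 / (4 * real m)"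
  have e: "0 < e" using m0 by (simp add: e_def)
  have "norm c < \<epsilon>" if t: "t \<in> {0..1}" and close: "bl_close e (distr N borel (\<lambda>\<omega>. X t \<omega> + c)) (distr N borel (X t))" for t c
  proof (rule ccontr)
    assume "\<not> norm c < \<epsilon>"
    have Xt[measurable]: "X t \<in> borel_measurable N" using X_measurable t by simp
    have iter: "bl_close (real i * e) (distr N borel (\<lambda>\<omega>. X t \<omega> + real i *\<^sub>R c)) (distr N borel (X t))" for i :: nat
    proof (induction i)
      case 0
      show ?case by (simp add: bl_close_def)
    next
      case (Suc i)
      have "bl_close e (distr N borel (\<lambda>\<omega>. X t \<omega> + c + real i *\<^sub>R c)) (distr N borel (\<lambda>\<omega>. X t \<omega> + real i *\<^sub>R c))"
        by (rule bl_close_shift[OF close]) auto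
      from bl_close_trans[OF this Suc] show ?case by (simp add: algebra_simps)
    qed
    define f where "f x = max 0 (min 1 (real R + 1 - norm x))" for x :: 'a
    have f: "f \<in> BL1"
    proof -
      have "\<bar>f x - f y\<bar> \<le> norm (x - y)" for x y
      proof -
        have "\<bar>f x - f y\<bar> \<le> \<bar>norm x - norm y\<bar>" unfolding f_def max_def min_def by auto
        also have "\<dots> \<le> norm (x - y)" by (rule norm_triangle_ineq3)
        finally show ?thesis .
      qed
      then show ?thesis by (auto simp: BL1_def f_def)
    qed
    have fm[measurable]: "f \<in> borel_measurable borel" by (rule BL1_borel_measurable[OF f])
    \<comment> \<open>\<open>X t\<close> has the law of \<open>r *\<^sub>R X 1\<close> with
      \<open>r \<le> 1\<close>, so the single radius \<open>R\<close> found for \<open>X 1\<close>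
      serves all \<open>t\<close> in [0,1].\<close>
    define r where "r = t powr (1 / \<alpha>)"
    have r: "0 \<le> r" "r \<le> 1" using t \<alpha> by (auto simp: r_def intro!: powr_le1)
    have rX: "norm (r *\<^sub>R X 1 \<omega>) \<le> norm (X 1 \<omega>)" for \<omega> using r by (simp add: mult_left_le_one_le)
    let ?B = "{\<omega> \<in> space N. real R < norm (X 1 \<omega>)}"
    have "(\<integral>\<omega>. 1 - indicator ?B \<omega> \<partial>N) \<le> (\<integral>\<omega>. f (r *\<^sub>R X 1 \<omega>) \<partial>N)"
    proof (rule integral_mono)
      show "1 - indicat_real ?B \<omega> \<le> f (r *\<^sub>R X 1 \<omega>)" if "\<omega> \<in> space N" for \<omega>
        using rX[of \<omega>] that by (auto simp: f_def indicator_def)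
    qed (auto intro!: integrable_BL1[OF f] integrable_bounded[of _ 1] simp: indicator_def)
    moreover have "(\<integral>\<omega>. 1 - indicat_real ?B \<omega> \<partial>N) = 1 - prob ?B"
      by (subst Bochner_Integration.integral_diff) (auto simp: prob_space emeasure_eq_measure)
    ultimately have lower: "3 / 4 \<le> (\<integral>\<omega>. f (X t \<omega>) \<partial>N)"
      using integral_self_similar[of t f] t R by (simp add: r_def)
    have mc: "2 * real R + 1 \<le> real m * norm c"
    proof -
      have "2 * real R + 1 \<le> real m * \<epsilon>" using m \<epsilon> by (simp add: divide_less_eq)
      also have "\<dots> \<le> real m * norm c" using \<open>\<not> norm c < \<epsilon>\<close> by (intro mult_left_mono) auto
      finally show ?thesis .
    qed
    have "(\<integral>\<omega>. f (r *\<^sub>R X 1 \<omega> + real m *\<^sub>R c) \<partial>N) \<le> (\<integral>\<omega>. indicat_real ?B \<omega> \<partial>N)"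
    proof (rule integral_mono)
      show "f (r *\<^sub>R X 1 \<omega> + real m *\<^sub>R c) \<le> indicat_real ?B \<omega>" if "\<omega> \<in> space N" for \<omega>
      proof (cases "real R < norm (X 1 \<omega>)")
        case False
        have "norm (real m *\<^sub>R c) \<le> norm (r *\<^sub>R X 1 \<omega> + real m *\<^sub>R c) + norm (r *\<^sub>R X 1 \<omega>)"
          using norm_triangle_ineq4[of "r *\<^sub>R X 1 \<omega> + real m *\<^sub>R c" "r *\<^sub>R X 1 \<omega>"] by simp
        then have "real R + 1 \<le> norm (r *\<^sub>R X 1 \<omega> + real m *\<^sub>R c)"
          using mc rX[of \<omega>] False by simp
        then show ?thesis by (simp add: f_def)
      qed (use that in \<open>auto simp: f_def\<close>)
    qed (auto intro!: integrable_BL1[OF f] simp: emeasure_eq_measure)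
    then have "(\<integral>\<omega>. f (r *\<^sub>R X 1 \<omega> + real m *\<^sub>R c) \<partial>N) \<le> 1 / 4" using R by simp
    then have upper: "(\<integral>\<omega>. f (X t \<omega> + real m *\<^sub>R c) \<partial>N) \<le> 1 / 4"
      using integral_self_similar[of t "\<lambda>x. f (x + real m *\<^sub>R c)"] t by (simp add: r_def)
    have "\<bar>(\<integral>\<omega>. f (X t \<omega> + real m *\<^sub>R c) \<partial>N) - (\<integral>\<omega>. f (X t \<omega>) \<partial>N)\<bar> \<le> real m * e"
      by (rule bl_close_distrD[OF iter _ _ f]) auto
    moreover have "real m * e = 1 / 4" using m0 by (simp add: e_def)
    ultimately show False using lower upper by linarith
  qed
  with e show ?thesis by blast
qed

end

section \<open>Laws and tails of the increments of the walk\<close>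

locale stable_walk = random_walk M Y a + regularly_varying_sequence \<alpha> l b + N: stable_process N \<alpha> X
  for M :: "'w measure" and Y :: "nat \<Rightarrow> 'w \<Rightarrow> 'a::euclidean_space" and a :: "nat \<Rightarrow> 'a"
    and \<alpha> :: real and l :: "real \<Rightarrow> real" and b :: "nat \<Rightarrow> real"
    and N :: "'v measure" and X :: "real \<Rightarrow> 'v \<Rightarrow> 'a" +
  assumes conv: "converges_in_distribution euclidean M (\<lambda>n \<omega>. T n \<omega> /\<^sub>R b n) N (X 1)"
begin

lemma X1_measurable[measurable]: "X 1 \<in> borel_measurable N"
  by (rule N.X_measurable) simp

text \<open>Convergence at the final time is transported to all \<open>k \<le> n\<close> by writing
  \<open>T k / b n\<close> as \<open>b k / b n\<close> times \<open>T k / b k\<close>. The finitely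
  many small \<open>k\<close>, for which \<open>T k / b k\<close> need not be close to its limit,
  are negligible on both sides.\<close>

lemma walk_close:
  assumes e: "0 < e"
  shows "\<exists>n0. \<forall>n\<ge>n0. \<forall>k\<le>n. bl_close e (distr M borel (\<lambda>\<omega>. T k \<omega> /\<^sub>R b n)) (distr N borel (X (real k / real n)))"
proof -
  define \<epsilon> where "\<epsilon> = e / 3"
  have \<epsilon>: "0 < \<epsilon>" using e by (simp add: \<epsilon>_def)
  have "eventually (\<lambda>k. bl_close (\<epsilon> / 2) (distr M borel (\<lambda>\<omega>. T k \<omega> /\<^sub>R b k)) (distr N borel (X 1))) sequentially"
    using \<epsilon> by (intro converges_in_distribution_bl_close[OF prob_space_axioms N.prob_space_axioms conv]) auto
  then obtain K0 where K0: "\<And>k. K0 \<le> k \<Longrightarrow> bl_close (\<epsilon> / 2) (distr M borel (\<lambda>\<omega>. T k \<omega> /\<^sub>R b k)) (distr N borel (X 1))"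
    by (auto simp: eventually_sequentially)
  define K where "K = max K0 1"
  obtain \<eta> where \<eta>: "0 < \<eta>" "\<And>r r'. \<bar>r - r'\<bar> \<le> \<eta> \<Longrightarrow> bl_close \<epsilon> (distr N borel (\<lambda>\<omega>. r *\<^sub>R X 1 \<omega>)) (distr N borel (\<lambda>\<omega>. r' *\<^sub>R X 1 \<omega>))"
    using N.bl_close_scaleR_random_vector[OF X1_measurable \<epsilon>] by blast
  have "\<forall>k. \<exists>\<eta>>0. \<forall>r r'. \<bar>r - r'\<bar> \<le> \<eta> \<longrightarrow> bl_close \<epsilon> (distr M borel (\<lambda>\<omega>. r *\<^sub>R T k \<omega>)) (distr M borel (\<lambda>\<omega>. r' *\<^sub>R T k \<omega>))"
    using bl_close_scaleR_random_vector[OF T_measurable \<epsilon>] by blast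
  then obtain \<eta>' where \<eta>': "\<And>k. 0 < \<eta>' k" "\<And>k r r'. \<bar>r - r'\<bar> \<le> \<eta>' k \<Longrightarrow> bl_close \<epsilon> (distr M borel (\<lambda>\<omega>. r *\<^sub>R T k \<omega>)) (distr M borel (\<lambda>\<omega>. r' *\<^sub>R T k \<omega>))"
    by metis
  obtain n1 where n1: "\<And>n k. n1 \<le> n \<Longrightarrow> k \<in> {1..n} \<Longrightarrow> \<bar>b k / b n - (real k / real n) powr (1 / \<alpha>)\<bar> \<le> min 1 \<eta>"
  proof -
    have "0 < min 1 \<eta>" using \<eta>(1) by simp
    from uniform_ratio[OF this] show thesis using that by blast
  qed
  have binv: "(\<lambda>n. inverse (b n)) \<longlonglongrightarrow> 0"
    by (rule tendsto_inverse_0_at_top[OF b_at_top])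
  have "eventually (\<lambda>n. \<forall>k\<in>{..<K}. inverse (b n) < \<eta>' k) sequentially"
    using \<eta>'(1) binv by (intro eventually_ball_finite ballI order_tendstoD) auto
  moreover have "(\<lambda>n. (real K / real n) powr (1 / \<alpha>)) \<longlonglongrightarrow> 0"
  proof -
    have "0 < real K" by (simp add: K_def)
    then show ?thesis using N.\<alpha> by real_asymp
  qed
  then have "eventually (\<lambda>n. (real K / real n) powr (1 / \<alpha>) < \<eta>) sequentially" using \<eta>(1) by (rule order_tendstoD)
  moreover have "eventually (\<lambda>n. max n1 1 \<le> n) sequentially" by (rule eventually_ge_at_top)
  ultimately have "eventually (\<lambda>n. \<forall>k\<le>n. bl_close e (distr M borel (\<lambda>\<omega>. T k \<omega> /\<^sub>R b n)) (distr N borel (X (real k / real n)))) sequentially"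
  proof eventually_elim
    case (elim n)
    have n: "1 \<le> n" "n1 \<le> n" and bn: "0 < b n" using elim(3) b(2)[of n] by auto
    show ?case
    proof (intro allI impI)
      fix k assume k: "k \<le> n"
      let ?s = "(real k / real n) powr (1 / \<alpha>)"
      have ss: "distr N borel (X (real k / real n)) = distr N borel (\<lambda>\<omega>. ?s *\<^sub>R X 1 \<omega>)"
        by (rule N.distr_self_similar) simp
      have "bl_close (\<epsilon> + \<epsilon>) (distr M borel (\<lambda>\<omega>. T k \<omega> /\<^sub>R b n)) (distr N borel (\<lambda>\<omega>. ?s *\<^sub>R X 1 \<omega>))"
      proof (cases "k < K")
        case True
        have 1: "bl_close \<epsilon> (distr M borel (\<lambda>\<omega>. inverse (b n) *\<^sub>R T k \<omega>)) (distr M borel (\<lambda>\<omega>. 0 *\<^sub>R T k \<omega>))"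
          using elim(1) True bn by (intro \<eta>'(2)) (auto intro: less_imp_le)
        have 2: "bl_close 0 (distr M borel (\<lambda>\<omega>. 0 *\<^sub>R T k \<omega>)) (distr N borel (\<lambda>\<omega>. 0 *\<^sub>R X 1 \<omega>))"
          by (rule bl_close_distrI) (auto simp: prob_space N.prob_space)
        have "?s \<le> (real K / real n) powr (1 / \<alpha>)"
          using True N.\<alpha> by (intro powr_mono2 divide_right_mono) auto
        then have 3: "bl_close \<epsilon> (distr N borel (\<lambda>\<omega>. 0 *\<^sub>R X 1 \<omega>)) (distr N borel (\<lambda>\<omega>. ?s *\<^sub>R X 1 \<omega>))"
          using elim(2) by (intro \<eta>(2)) auto
        from bl_close_trans[OF bl_close_trans[OF 1 2] 3] show ?thesis by simp
      next
        case False
        then have k1: "1 \<le> k" "K0 \<le> k" by (auto simp: K_def)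
        have bk: "0 < b k" using b(2)[OF k1(1)] .
        have ratio: "\<bar>b k / b n - ?s\<bar> \<le> min 1 \<eta>" using n1[OF n(2)] k k1 by simp
        have "?s \<le> 1" using k n N.\<alpha> by (intro powr_le1) auto
        moreover have "0 \<le> ?s" by simp
        moreover have "\<bar>b k / b n - ?s\<bar> \<le> 1" using ratio by simp
        \<comment> \<open>The scaling factor at most 2 doubles the closeness error, which is why
          \<open>K0\<close> was chosen for \<open>\<epsilon> / 2\<close>.\<close>
        ultimately have r2: "\<bar>b k / b n\<bar> \<le> 2" by linarith
        have 1: "bl_close (2 * (\<epsilon> / 2)) (distr M borel (\<lambda>\<omega>. (b k / b n) *\<^sub>R (T k \<omega> /\<^sub>R b k))) (distr N borel (\<lambda>\<omega>. (b k / b n) *\<^sub>R X 1 \<omega>))"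
          by (rule bl_close_scaleR[OF K0[OF k1(2)] _ _ r2]) auto
        have 2: "bl_close \<epsilon> (distr N borel (\<lambda>\<omega>. (b k / b n) *\<^sub>R X 1 \<omega>)) (distr N borel (\<lambda>\<omega>. ?s *\<^sub>R X 1 \<omega>))"
          using ratio by (intro \<eta>(2)) auto
        have "(\<lambda>\<omega>. (b k / b n) *\<^sub>R (T k \<omega> /\<^sub>R b k)) = (\<lambda>\<omega>. T k \<omega> /\<^sub>R b n)"
          using bk bn by (simp add: field_simps)
        with bl_close_trans[OF 1 2] show ?thesis by simp
      qed
      then show "bl_close e (distr M borel (\<lambda>\<omega>. T k \<omega> /\<^sub>R b n)) (distr N borel (X (real k / real n)))"
        unfolding ss by (rule bl_close_mono) (use \<epsilon> in \<open>simp add: \<epsilon>_def\<close>)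
    qed
  qed
  then show ?thesis by (simp add: eventually_sequentially)
qed

lemma distr_T_diff_scaled:
  assumes "j \<le> k"
  shows "distr M borel (\<lambda>\<omega>. (T k \<omega> - T j \<omega>) /\<^sub>R s) = distr M borel (\<lambda>\<omega>. T (k - j) \<omega> /\<^sub>R s + (a (k - j) + a j - a k) /\<^sub>R s)"
proof -
  have "distr (distr M borel (\<lambda>\<omega>. T k \<omega> - T j \<omega>)) borel (\<lambda>x. x /\<^sub>R s) =
      distr (distr M borel (\<lambda>\<omega>. T (k - j) \<omega> + (a (k - j) + a j - a k))) borel (\<lambda>x. x /\<^sub>R s)"
    by (simp only: distr_T_diff[OF assms])
  then show ?thesis
    by (subst (asm) (1 2) distr_distr) (auto simp: comp_def scaleR_add_right)
qed

text \<open>After division by \<open>b n\<close>, adding to \<open>T j\<close> the independent block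
  from \<open>j\<close> to \<open>k\<close> compares \<open>T k\<close> with \<open>X t + c\<close>,
  where \<open>c\<close> is the defect of additivity; directly, \<open>T k\<close> is close to
  \<open>X t\<close>. So the law of \<open>X t\<close> is close to its translate by
  \<open>c\<close>, which forces \<open>c\<close> to be small.\<close>

lemma centering_additive:
  assumes \<epsilon>: "0 < \<epsilon>"
  shows "\<exists>n0. \<forall>n\<ge>n0. \<forall>k\<le>n. \<forall>j\<le>k. norm ((a (k - j) + a j - a k) /\<^sub>R b n) < \<epsilon>"
proof -
  obtain e where e: "0 < e" "\<And>t c. t \<in> {0..1} \<Longrightarrow> bl_close e (distr N borel (\<lambda>\<omega>. X t \<omega> + c)) (distr N borel (X t)) \<Longrightarrow> norm c < \<epsilon>"
    using N.bl_close_translate_small[OF \<epsilon>] by blast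
  obtain n0 where n0: "\<And>n k. n0 \<le> n \<Longrightarrow> k \<le> n \<Longrightarrow> bl_close (e / 3) (distr M borel (\<lambda>\<omega>. T k \<omega> /\<^sub>R b n)) (distr N borel (X (real k / real n)))"
    using walk_close[of "e / 3"] e(1) by auto
  have "norm ((a (k - j) + a j - a k) /\<^sub>R b n) < \<epsilon>" if n: "max 1 n0 \<le> n" and k: "k \<le> n" and j: "j \<le> k" for n k j
  proof -
    let ?c = "(a (k - j) + a j - a k) /\<^sub>R b n"
    define s where "s = real j / real n"
    define t where "t = real k / real n"
    have st: "0 \<le> s" "s \<le> t" "t \<le> 1" "t - s = real (k - j) / real n" "0 \<le> t"
      using n k j by (auto simp: s_def t_def divide_right_mono diff_divide_distrib of_nat_diff)
    note [measurable] = N.X_measurable[OF st(1)] N.X_measurable[OF st(5)]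
    have Xd[measurable]: "X (t - s) \<in> borel_measurable N" using st by (intro N.X_measurable) auto
    have A: "bl_close (e / 3) (distr M borel (\<lambda>\<omega>. T j \<omega> /\<^sub>R b n)) (distr N borel (X s))"
      unfolding s_def using n k j by (intro n0) auto
    have "bl_close (e / 3) (distr M borel (\<lambda>\<omega>. T (k - j) \<omega> /\<^sub>R b n)) (distr N borel (X (t - s)))"
      unfolding st(4) using n k j by (intro n0) auto
    then have "bl_close (e / 3) (distr M borel (\<lambda>\<omega>. T (k - j) \<omega> /\<^sub>R b n + ?c)) (distr N borel (\<lambda>\<omega>. X (t - s) \<omega> + ?c))"
      by (rule bl_close_shift) auto
    moreover have "distr N borel (\<lambda>\<omega>. X (t - s) \<omega> + ?c) = distr N borel (\<lambda>\<omega>. (X t \<omega> - X s \<omega>) + ?c)"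
    proof -
      have "distr (distr N borel (X (t - s))) borel (\<lambda>x. x + ?c) = distr (distr N borel (\<lambda>\<omega>. X t \<omega> - X s \<omega>)) borel (\<lambda>x. x + ?c)"
        by (simp only: N.distr_increment[OF st(1,2)])
      then show ?thesis by (subst (asm) (1 2) distr_distr) (auto simp: comp_def)
    qed
    ultimately have B: "bl_close (e / 3) (distr M borel (\<lambda>\<omega>. (T k \<omega> - T j \<omega>) /\<^sub>R b n)) (distr N borel (\<lambda>\<omega>. (X t \<omega> - X s \<omega>) + ?c))"
      by (simp only: distr_T_diff_scaled[OF j])
    have iM: "indep_var borel (\<lambda>\<omega>. T j \<omega> /\<^sub>R b n) borel (\<lambda>\<omega>. (T k \<omega> - T j \<omega>) /\<^sub>R b n)"
    proof -
      have "indep_var borel ((\<lambda>x. x /\<^sub>R b n) \<circ> (\<lambda>\<omega>. T j \<omega> - T 0 \<omega>)) borel ((\<lambda>x. x /\<^sub>R b n) \<circ> (\<lambda>\<omega>. T k \<omega> - T j \<omega>))"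
        by (rule indep_var_compose[OF indep_T_diff]) (use j in auto)
      then show ?thesis by (simp add: comp_def)
    qed
    have iN: "N.indep_var borel (\<lambda>\<omega>. X s \<omega> - X 0 \<omega>) borel (\<lambda>\<omega>. (X t \<omega> - X s \<omega>) + ?c)"
    proof -
      \<comment> \<open>The times 0, s, t, continued constantly to be monotone; two increments are
        needed.\<close>
      define \<tau> :: "nat \<Rightarrow> real" where "\<tau> i = (if i = 0 then 0 else if i = 1 then s else t)" for i
      have "mono \<tau>" using st by (auto simp: mono_def \<tau>_def)
      then have "N.indep_vars (\<lambda>_. borel) (\<lambda>i \<omega>. X (\<tau> (Suc i)) \<omega> - X (\<tau> i) \<omega>) {..<2::nat}"
        by (intro N.indep_increments) (simp add: \<tau>_def)
      from N.indep_var_restrict[OF this, of "{0}" "{1}"]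
      have "N.indep_var (\<Pi>\<^sub>M i\<in>{0}. borel) (\<lambda>\<omega>. \<lambda>i\<in>{0}. X (\<tau> (Suc i)) \<omega> - X (\<tau> i) \<omega>) (\<Pi>\<^sub>M i\<in>{1}. borel) (\<lambda>\<omega>. \<lambda>i\<in>{1}. X (\<tau> (Suc i)) \<omega> - X (\<tau> i) \<omega>)"
        by auto
      from N.indep_var_compose[OF this, of "\<lambda>x. x 0" borel "\<lambda>x. x 1" borel]
      have "N.indep_var borel (\<lambda>\<omega>. X s \<omega> - X 0 \<omega>) borel (\<lambda>\<omega>. X t \<omega> - X s \<omega>)"
        by (simp add: \<tau>_def comp_def)
      from N.indep_var_compose[OF this, of "\<lambda>x. x" borel "\<lambda>x. x + ?c" borel]
      show ?thesis by (simp add: comp_def)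
    qed
    have "distr N borel (X s) = distr N borel (\<lambda>\<omega>. X s \<omega> - X 0 \<omega>)"
      by (intro distr_cong) (auto simp: N.X_zero)
    with A have A': "bl_close (e / 3) (distr M borel (\<lambda>\<omega>. T j \<omega> /\<^sub>R b n)) (distr N borel (\<lambda>\<omega>. X s \<omega> - X 0 \<omega>))" by simp
    have "bl_close (e / 3 + e / 3) (distr M borel (\<lambda>\<omega>. T j \<omega> /\<^sub>R b n + (T k \<omega> - T j \<omega>) /\<^sub>R b n)) (distr N borel (\<lambda>\<omega>. (X s \<omega> - X 0 \<omega>) + ((X t \<omega> - X s \<omega>) + ?c)))"
      by (rule bl_close_indep_sum[OF prob_space_axioms N.prob_space_axioms iM iN A' B])
    moreover have "distr N borel (\<lambda>\<omega>. (X s \<omega> - X 0 \<omega>) + ((X t \<omega> - X s \<omega>) + ?c)) = distr N borel (\<lambda>\<omega>. X t \<omega> + ?c)"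
      by (intro distr_cong) (auto simp: N.X_zero)
    ultimately have "bl_close (e / 3 + e / 3) (distr M borel (\<lambda>\<omega>. T k \<omega> /\<^sub>R b n)) (distr N borel (\<lambda>\<omega>. X t \<omega> + ?c))"
      by (simp add: algebra_simps)
    moreover have "bl_close (e / 3) (distr M borel (\<lambda>\<omega>. T k \<omega> /\<^sub>R b n)) (distr N borel (X t))"
      unfolding t_def using n k by (intro n0) auto
    ultimately have "bl_close (e / 3 + e / 3 + e / 3) (distr N borel (\<lambda>\<omega>. X t \<omega> + ?c)) (distr N borel (X t))"
      using bl_close_trans bl_close_sym by blast
    then show ?thesis using st by (intro e(2)[of t]) auto
  qed
  then show ?thesis by blast
qed

lemma increments_close:
  assumes e: "0 < e"
  shows "\<exists>n0. \<forall>n\<ge>n0. \<forall>k\<le>n. \<forall>j\<le>k. bl_close e (distr M borel (\<lambda>\<omega>. (T k \<omega> - T j \<omega>) /\<^sub>R b n)) (distr N borel (X (real (k - j) / real n)))"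
proof -
  obtain n0 where n0: "\<And>n k. n0 \<le> n \<Longrightarrow> k \<le> n \<Longrightarrow> bl_close (e / 2) (distr M borel (\<lambda>\<omega>. T k \<omega> /\<^sub>R b n)) (distr N borel (X (real k / real n)))"
    using walk_close[of "e / 2"] e by auto
  obtain n1 where n1: "\<And>n k j. n1 \<le> n \<Longrightarrow> k \<le> n \<Longrightarrow> j \<le> k \<Longrightarrow> norm ((a (k - j) + a j - a k) /\<^sub>R b n) < e / 2"
    using centering_additive[of "e / 2"] e by auto
  have "bl_close e (distr M borel (\<lambda>\<omega>. (T k \<omega> - T j \<omega>) /\<^sub>R b n)) (distr N borel (X (real (k - j) / real n)))"
    if n: "max n0 n1 \<le> n" "k \<le> n" "j \<le> k" for n k j
  proof -
    have "bl_close (e / 2) (distr M borel (\<lambda>\<omega>. T (k - j) \<omega> /\<^sub>R b n + (a (k - j) + a j - a k) /\<^sub>R b n)) (distr M borel (\<lambda>\<omega>. T (k - j) \<omega> /\<^sub>R b n))"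
      using n1[of n k j] n by (intro bl_close_perturb) auto
    moreover have "bl_close (e / 2) (distr M borel (\<lambda>\<omega>. T (k - j) \<omega> /\<^sub>R b n)) (distr N borel (X (real (k - j) / real n)))"
      using n by (intro n0) auto
    ultimately show ?thesis unfolding distr_T_diff_scaled[OF n(3)] using bl_close_trans by fastforce
  qed
  then show ?thesis by blast
qed

text \<open>The constant \<open>C\<close> is uniform in \<open>K\<close>, while \<open>n0\<close>
  may depend on \<open>K\<close>; hence \<open>K\<close> can be chosen first and \<open>n\<close>
  sent to infinity afterwards. The summand 1 in the length accounts for the rounding of the
  grid.\<close>

lemma increment_tail:
  assumes c: "0 < c"
  shows "\<exists>C>0. \<forall>K\<ge>1. \<exists>n0. \<forall>n\<ge>n0. \<forall>k\<le>n. \<forall>j\<le>k. real (k - j) \<le> real n / 2 ^ K + 1 \<longrightarrow>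
    prob {\<omega> \<in> space M. c * b n < norm (T k \<omega> - T j \<omega>)} \<le> C / 2 ^ K"
proof -
  obtain C0 where C0: "0 < C0" "\<And>K::nat. N.prob {\<omega> \<in> space N. c / 2 < (1 / 2 ^ K) powr (1 / \<alpha>) * norm (X 1 \<omega>)} \<le> C0 / 2 ^ K"
    using N.tail_bound[of "c / 2"] c by auto
  \<comment> \<open>A Lipschitz constant of the cutoff \<open>g\<close> below that is at least 1, so
    that \<open>g / s\<close> belongs to \<open>BL1\<close>.\<close>
  define s where "s = max 1 (2 / c)"
  have s: "1 \<le> s" "2 / c \<le> s" by (auto simp: s_def)
  \<comment> \<open>A continuous cutoff between the indicators of norm > c and of norm >
    c/2.\<close>
  define g where "g x = min 1 (max 0 (norm x / (c / 2) - 1))" for x :: 'a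
  have g01: "0 \<le> g x" "g x \<le> 1" for x by (auto simp: g_def)
  have g1: "g x = 1" if "c < norm x" for x using that c by (simp add: g_def min_def max_def field_simps)
  have g0: "g x = 0" if "norm x \<le> c / 2" for x using that c by (simp add: g_def min_def max_def field_simps)
  have gs: "(\<lambda>x. g x / s) \<in> BL1"
  proof -
    have "\<bar>g x - g y\<bar> \<le> s * norm (x - y)" for x y
    proof -
      have "\<bar>g x - g y\<bar> \<le> \<bar>norm x / (c / 2) - norm y / (c / 2)\<bar>" unfolding g_def by (auto simp: min_def max_def)
      also have "norm x / (c / 2) - norm y / (c / 2) = (2 / c) * (norm x - norm y)" by (simp add: algebra_simps diff_divide_distrib)
      also have "\<bar>\<dots>\<bar> = (2 / c) * \<bar>norm x - norm y\<bar>" unfolding abs_mult using c by simp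
      also have "\<dots> \<le> s * norm (x - y)" using s norm_triangle_ineq3 by (intro mult_mono) auto
      finally show ?thesis .
    qed
    then have "\<bar>g x / s - g y / s\<bar> \<le> norm (x - y)" for x y
      using s by (simp add: divide_le_eq mult.commute flip: diff_divide_distrib)
    moreover have "\<bar>g x / s\<bar> \<le> 1" for x using g01[of x] s by (simp add: divide_le_eq)
    ultimately show ?thesis by (simp add: BL1_def)
  qed
  have gm[measurable]: "g \<in> borel_measurable borel" unfolding g_def by measurable
  have "\<exists>n0. \<forall>n\<ge>n0. \<forall>k\<le>n. \<forall>j\<le>k. real (k - j) \<le> real n / 2 ^ K + 1 \<longrightarrow>
    prob {\<omega> \<in> space M. c * b n < norm (T k \<omega> - T j \<omega>)} \<le> (2 * C0 + 1) / 2 ^ K" if K: "1 \<le> K" for K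
  proof -
    \<comment> \<open>After multiplication by \<open>s\<close> this error is
      \<open>1 / 2 ^ K\<close>, the same order as the tail.\<close>
    define e where "e = 1 / (s * 2 ^ K)"
    have e: "0 < e" using s by (simp add: e_def)
    obtain n0 where n0: "\<And>n k j. n0 \<le> n \<Longrightarrow> k \<le> n \<Longrightarrow> j \<le> k \<Longrightarrow>
        bl_close e (distr M borel (\<lambda>\<omega>. (T k \<omega> - T j \<omega>) /\<^sub>R b n)) (distr N borel (X (real (k - j) / real n)))"
      using increments_close[OF e] by blast
    have "prob {\<omega> \<in> space M. c * b n < norm (T k \<omega> - T j \<omega>)} \<le> (2 * C0 + 1) / 2 ^ K"
      if n: "max n0 (2 ^ K) \<le> n" and k: "k \<le> n" and j: "j \<le> k" and kj: "real (k - j) \<le> real n / 2 ^ K + 1" for n k j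
    proof -
      have "(1::nat) \<le> 2 ^ K" by simp
      then have n1: "1 \<le> n" using n by linarith
      have bn: "0 < b n" using b(2)[OF n1] .
      define u where "u = real (k - j) / real n"
      have "(2::real) ^ K \<le> real n" using n by (metis max.bounded_iff of_nat_le_iff of_nat_numeral of_nat_power)
      then have "1 \<le> real n / 2 ^ K" by simp
      then have "real (k - j) \<le> 2 * (real n / 2 ^ K)" using kj by linarith
      then have u: "0 \<le> u" "u \<le> 2 / 2 ^ K" using n1 by (auto simp: u_def field_simps)
      \<comment> \<open>For n \<ge> 2^K the length bound is at most twice n / 2^K, one dyadic level
        coarser; this doubles \<open>C0\<close>.\<close>
      have K2: "(2::real) / 2 ^ K = 1 / 2 ^ (K - 1)" using K by (cases K) auto
      have Xu[measurable]: "X u \<in> borel_measurable N" using u by (intro N.X_measurable) auto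
      have m: "(\<lambda>\<omega>. (T k \<omega> - T j \<omega>) /\<^sub>R b n) \<in> borel_measurable M" by measurable
      have "prob {\<omega> \<in> space M. c * b n < norm (T k \<omega> - T j \<omega>)} = (\<integral>\<omega>. indicat_real {\<omega> \<in> space M. c * b n < norm (T k \<omega> - T j \<omega>)} \<omega> \<partial>M)" by simp
      also have "\<dots> \<le> (\<integral>\<omega>. g ((T k \<omega> - T j \<omega>) /\<^sub>R b n) \<partial>M)"
      proof (rule integral_mono)
        show "indicat_real {\<omega> \<in> space M. c * b n < norm (T k \<omega> - T j \<omega>)} \<omega> \<le> g ((T k \<omega> - T j \<omega>) /\<^sub>R b n)" for \<omega>
        proof -
          have "norm ((T k \<omega> - T j \<omega>) /\<^sub>R b n) = norm (T k \<omega> - T j \<omega>) / b n"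
            using bn by (simp only: norm_scaleR) (simp add: divide_inverse mult.commute)
          then have "c < norm ((T k \<omega> - T j \<omega>) /\<^sub>R b n) \<longleftrightarrow> c * b n < norm (T k \<omega> - T j \<omega>)"
            using bn by (simp add: pos_less_divide_eq)
          then show ?thesis
            using g1[of "(T k \<omega> - T j \<omega>) /\<^sub>R b n"] g01(1)[of "(T k \<omega> - T j \<omega>) /\<^sub>R b n"]
            by (cases "c * b n < norm (T k \<omega> - T j \<omega>)") (simp_all del: scaleR_diff_right add: indicator_def)
        qed
        show "integrable M (\<lambda>\<omega>. g ((T k \<omega> - T j \<omega>) /\<^sub>R b n))"
          using g01 by (intro integrable_bounded[of _ 1]) auto
      qed (auto simp: emeasure_eq_measure)
      also have "\<dots> = s * (\<integral>\<omega>. g ((T k \<omega> - T j \<omega>) /\<^sub>R b n) / s \<partial>M)" using s by simp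
      also have "\<dots> \<le> s * ((\<integral>\<omega>. g (X u \<omega>) / s \<partial>N) + e)"
      proof (rule mult_left_mono)
        have "\<bar>(\<integral>\<omega>. g ((T k \<omega> - T j \<omega>) /\<^sub>R b n) / s \<partial>M) - (\<integral>\<omega>. g (X u \<omega>) / s \<partial>N)\<bar> \<le> e"
          unfolding u_def by (rule bl_close_distrD[OF n0 m _ gs]) (use n k j Xu in \<open>auto simp: u_def\<close>)
        then show "(\<integral>\<omega>. g ((T k \<omega> - T j \<omega>) /\<^sub>R b n) / s \<partial>M) \<le> (\<integral>\<omega>. g (X u \<omega>) / s \<partial>N) + e" by linarith
      qed (use s in auto)
      also have "\<dots> = (\<integral>\<omega>. g (X u \<omega>) \<partial>N) + 1 / 2 ^ K" using s by (simp add: e_def distrib_left)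
      also have "(\<integral>\<omega>. g (X u \<omega>) \<partial>N) = (\<integral>\<omega>. g ((u powr (1 / \<alpha>)) *\<^sub>R X 1 \<omega>) \<partial>N)"
        by (rule N.integral_self_similar[OF u(1) gm])
      also have "\<dots> \<le> (\<integral>\<omega>. indicat_real {\<omega> \<in> space N. c / 2 < (1 / 2 ^ (K - 1)) powr (1 / \<alpha>) * norm (X 1 \<omega>)} \<omega> \<partial>N)"
      proof (rule integral_mono)
        fix \<omega> assume \<omega>: "\<omega> \<in> space N"
        have "u powr (1 / \<alpha>) \<le> (1 / 2 ^ (K - 1)) powr (1 / \<alpha>)" using u N.\<alpha> K2 by (intro powr_mono2) auto
        then have le: "norm ((u powr (1 / \<alpha>)) *\<^sub>R X 1 \<omega>) \<le> (1 / 2 ^ (K - 1)) powr (1 / \<alpha>) * norm (X 1 \<omega>)"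
          by (simp add: mult_right_mono)
        show "g ((u powr (1 / \<alpha>)) *\<^sub>R X 1 \<omega>) \<le> indicat_real {\<omega> \<in> space N. c / 2 < (1 / 2 ^ (K - 1)) powr (1 / \<alpha>) * norm (X 1 \<omega>)} \<omega>"
        proof (cases "norm ((u powr (1 / \<alpha>)) *\<^sub>R X 1 \<omega>) \<le> c / 2")
          case True
          then show ?thesis by (simp add: g0)
        next
          case False
          then have "c / 2 < (1 / 2 ^ (K - 1)) powr (1 / \<alpha>) * norm (X 1 \<omega>)" using le by linarith
          then show ?thesis using \<omega> g01 by simp
        qed
      next
        show "integrable N (\<lambda>\<omega>. g ((u powr (1 / \<alpha>)) *\<^sub>R X 1 \<omega>))"
          using g01 by (intro N.integrable_bounded[of _ 1]) auto
      qed (auto simp: N.emeasure_eq_measure)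
      also have "\<dots> = N.prob {\<omega> \<in> space N. c / 2 < (1 / 2 ^ (K - 1)) powr (1 / \<alpha>) * norm (X 1 \<omega>)}" by simp
      also have "\<dots> \<le> C0 / 2 ^ (K - 1)" by (rule C0(2))
      also have "\<dots> = 2 * C0 / 2 ^ K" using K by (cases K) auto
      finally show ?thesis by (simp add: add_divide_distrib)
    qed
    then show ?thesis by blast
  qed
  then show ?thesis using C0(1) by (intro exI[of _ "2 * C0 + 1"]) auto
qed

end

section \<open>Dyadic grids of the walk\<close>

lemma exists_covering_block:
  fixes t :: "nat \<Rightarrow> nat"
  assumes "t 0 \<le> k" "k \<le> t (Suc m)"
  shows "\<exists>i\<le>m. t i \<le> k \<and> k \<le> t (Suc i)"
  using assms(2)
proof (induction m)
  case 0
  then show ?case using assms(1) by auto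
next
  case (Suc m)
  show ?case
  proof (cases "k \<le> t (Suc m)")
    case True
    then show ?thesis using Suc.IH le_Suc_eq by blast
  next
    case False
    then show ?thesis using Suc.prems by (intro exI[of _ "Suc m"]) auto
  qed
qed

lemma real_div_bounds:
  fixes x m :: nat
  assumes "0 < m"
  shows "real (x div m) \<le> real x / real m" "real x / real m < real (x div m) + 1"
proof -
  have "real (x div m) = of_int \<lfloor>real x / real m\<rfloor>" by (simp add: floor_divide_of_nat_eq)
  then show "real (x div m) \<le> real x / real m" "real x / real m < real (x div m) + 1"
    by simp_all
qed

text \<open>Changing one summand moves each partial sum by at most the size of the change; this is
  the coordinatewise Lipschitz condition of \<open>bl_close_PiM\<close>.\<close>

lemma lipschitz_hull0_partial_sums:
  fixes x :: "nat \<Rightarrow> 'a::euclidean_space"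
  assumes g: "\<And>A B. A \<in> convex_bodies0 \<Longrightarrow> B \<in> convex_bodies0 \<Longrightarrow> \<bar>g A - g B\<bar> \<le> hausdorff_dist A B"
  shows "\<bar>g (hull0 {..m} (\<lambda>i. \<Sum>l<i. (x(k := u)) l)) - g (hull0 {..m} (\<lambda>i. \<Sum>l<i. (x(k := v)) l))\<bar> \<le> norm (u - v)"
proof -
  have "norm ((\<Sum>l<i. (x(k := u)) l) - (\<Sum>l<i. (x(k := v)) l)) \<le> norm (u - v)" for i
  proof -
    have "(\<Sum>l<i. (x(k := u)) l) - (\<Sum>l<i. (x(k := v)) l) = (\<Sum>l<i. if l = k then u - v else 0)"
      by (subst sum_subtractf[symmetric]) (intro sum.cong, auto)
    then show ?thesis by simp
  qed
  then have "\<exists>j\<in>{..m}. norm ((\<Sum>l<i. (x(k := u)) l) - (\<Sum>l<j. (x(k := v)) l)) \<le> norm (u - v)"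
    "\<exists>j\<in>{..m}. norm ((\<Sum>l<j. (x(k := u)) l) - (\<Sum>l<i. (x(k := v)) l)) \<le> norm (u - v)"
    if "i \<in> {..m}" for i
    using that by blast+
  then have "hausdorff_dist (hull0 {..m} (\<lambda>i. \<Sum>l<i. (x(k := u)) l)) (hull0 {..m} (\<lambda>i. \<Sum>l<i. (x(k := v)) l)) \<le> norm (u - v)"
    by (rule hausdorff_dist_hull0_le[OF finite_atMost finite_atMost norm_ge_zero])
  moreover have "\<bar>g (hull0 {..m} (\<lambda>i. \<Sum>l<i. (x(k := u)) l)) - g (hull0 {..m} (\<lambda>i. \<Sum>l<i. (x(k := v)) l))\<bar>
      \<le> hausdorff_dist (hull0 {..m} (\<lambda>i. \<Sum>l<i. (x(k := u)) l)) (hull0 {..m} (\<lambda>i. \<Sum>l<i. (x(k := v)) l))"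
    by (intro g hull0_in_convex_bodies0) auto
  ultimately show ?thesis by (rule order_trans[rotated])
qed

text \<open>Moves the hull functional to the product of the laws of the increments, where two
  families of independent increments on different spaces can be compared.\<close>

lemma (in prob_space) integral_hull0_partial_sums:
  fixes U :: "nat \<Rightarrow> 'a \<Rightarrow> 'b::euclidean_space"
  assumes g: "\<And>A B. A \<in> convex_bodies0 \<Longrightarrow> B \<in> convex_bodies0 \<Longrightarrow> \<bar>g A - g B\<bar> \<le> hausdorff_dist A B"
    and U: "\<And>i. U i \<in> borel_measurable M" and ind: "indep_vars (\<lambda>_. borel) U {..<m}" and m: "0 < m"
  shows "(\<integral>\<omega>. g (hull0 {..m} (\<lambda>i. \<Sum>l<i. U l \<omega>)) \<partial>M) =
    (\<integral>x. g (hull0 {..m} (\<lambda>i. \<Sum>l<i. x l)) \<partial>(\<Pi>\<^sub>M i\<in>{..<m}. distr M borel (U i)))"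
    and "(\<lambda>x. g (hull0 {..m} (\<lambda>i. \<Sum>l<i. x l))) \<in> borel_measurable (\<Pi>\<^sub>M i\<in>{..<m}. (borel :: 'b measure))"
proof -
  show meas: "(\<lambda>x. g (hull0 {..m} (\<lambda>i. \<Sum>l<i. x l))) \<in> borel_measurable (\<Pi>\<^sub>M i\<in>{..<m}. (borel :: 'b measure))"
    by (intro borel_measurable_lipschitz_hull0 g borel_measurable_sum measurable_component_singleton) auto
  have ne: "{..<m} \<noteq> {}" using m by (simp add: lessThan_empty_iff)
  have "distr M (\<Pi>\<^sub>M i\<in>{..<m}. borel) (\<lambda>\<omega>. \<lambda>i\<in>{..<m}. U i \<omega>) = (\<Pi>\<^sub>M i\<in>{..<m}. distr M borel (U i))"
    using ind U by (subst (asm) indep_vars_iff_distr_eq_PiM'[OF ne]) auto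
  then have "(\<integral>x. g (hull0 {..m} (\<lambda>i. \<Sum>l<i. x l)) \<partial>(\<Pi>\<^sub>M i\<in>{..<m}. distr M borel (U i))) =
      (\<integral>x. g (hull0 {..m} (\<lambda>i. \<Sum>l<i. x l)) \<partial>distr M (\<Pi>\<^sub>M i\<in>{..<m}. borel) (\<lambda>\<omega>. \<lambda>i\<in>{..<m}. U i \<omega>))" by simp
  also have "\<dots> = (\<integral>\<omega>. g (hull0 {..m} (\<lambda>i. \<Sum>l<i. (\<lambda>i\<in>{..<m}. U i \<omega>) l)) \<partial>M)"
    by (rule integral_distr[OF _ meas]) (intro measurable_restrict U)
  also have "\<dots> = (\<integral>\<omega>. g (hull0 {..m} (\<lambda>i. \<Sum>l<i. U l \<omega>)) \<partial>M)"
  proof (intro arg_cong[where f = "integral\<^sup>L M"] ext)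
    fix \<omega>
    have "(\<lambda>i. \<Sum>l<i. (\<lambda>i\<in>{..<m}. U i \<omega>) l) ` {..m} = (\<lambda>i. \<Sum>l<i. U l \<omega>) ` {..m}"
      by (intro image_cong sum.cong) auto
    then show "g (hull0 {..m} (\<lambda>i. \<Sum>l<i. (\<lambda>i\<in>{..<m}. U i \<omega>) l)) = g (hull0 {..m} (\<lambda>i. \<Sum>l<i. U l \<omega>))"
      by (simp only: hull0_def)
  qed
  finally show "(\<integral>\<omega>. g (hull0 {..m} (\<lambda>i. \<Sum>l<i. U l \<omega>)) \<partial>M) =
    (\<integral>x. g (hull0 {..m} (\<lambda>i. \<Sum>l<i. x l)) \<partial>(\<Pi>\<^sub>M i\<in>{..<m}. distr M borel (U i)))" ..
qed

context stable_walk
begin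

text \<open>Dividing after multiplying by \<open>i\<close> makes the grid end exactly at
  \<open>n\<close> and keeps each step within 1 of n / 2^K.\<close>

definition grid :: "nat \<Rightarrow> nat \<Rightarrow> nat \<Rightarrow> nat" where
  "grid n K i = n * i div 2 ^ K"

lemma grid_0 [simp]: "grid n K 0 = 0"
  by (simp add: grid_def)

lemma grid_last [simp]: "grid n K (2 ^ K) = n"
  by (simp add: grid_def)

lemma mono_grid: "mono (grid n K)"
  by (auto simp: mono_def grid_def div_le_mono)

lemma grid_le: "i \<le> 2 ^ K \<Longrightarrow> grid n K i \<le> n"
  using monoD[OF mono_grid, of i "2 ^ K" n K] by simp

lemma abs_grid_step: "\<bar>real (grid n K (Suc i) - grid n K i) - real n / 2 ^ K\<bar> \<le> 1"
proof -
  have le: "grid n K i \<le> grid n K (Suc i)" using mono_grid by (simp add: monoD)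
  have "real (n * Suc i) / 2 ^ K - real (n * i) / 2 ^ K = real n / 2 ^ K"
    by (simp add: algebra_simps add_divide_distrib)
  moreover have "real (grid n K j) \<le> real (n * j) / 2 ^ K" "real (n * j) / 2 ^ K < real (grid n K j) + 1" for j
    using real_div_bounds[of "2 ^ K" "n * j"] by (simp_all add: grid_def)
  ultimately show ?thesis
    using le by (simp only: of_nat_diff) (smt (verit))
qed

lemma grid_increment_close:
  assumes e: "0 < e"
  shows "\<exists>n0. \<forall>n\<ge>n0. \<forall>i<2^K. bl_close e (distr M borel (\<lambda>\<omega>. (T (grid n K (Suc i)) \<omega> - T (grid n K i) \<omega>) /\<^sub>R b n)) (distr N borel (X (1 / 2 ^ K)))"
proof -
  obtain \<eta> where \<eta>: "0 < \<eta>" "\<And>s t. 0 \<le> s \<Longrightarrow> 0 \<le> t \<Longrightarrow> \<bar>s powr (1 / \<alpha>) - t powr (1 / \<alpha>)\<bar> \<le> \<eta> \<Longrightarrow> bl_close (e / 2) (distr N borel (X s)) (distr N borel (X t))"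
    using N.bl_close_X[of "e / 2"] e by auto
  have "isCont (\<lambda>u. u powr (1 / \<alpha>)) (1 / 2 ^ K)"
    by (intro continuous_intros) auto
  then obtain \<rho> where \<rho>: "0 < \<rho>" "\<And>u. dist u (1 / 2 ^ K) < \<rho> \<Longrightarrow> dist (u powr (1 / \<alpha>)) ((1 / 2 ^ K) powr (1 / \<alpha>)) < \<eta>"
    using \<eta>(1) unfolding continuous_at_eps_delta by blast
  obtain n0 where n0: "\<And>n k j. n0 \<le> n \<Longrightarrow> k \<le> n \<Longrightarrow> j \<le> k \<Longrightarrow>
      bl_close (e / 2) (distr M borel (\<lambda>\<omega>. (T k \<omega> - T j \<omega>) /\<^sub>R b n)) (distr N borel (X (real (k - j) / real n)))"
    using increments_close[of "e / 2"] e by auto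
  obtain n1 :: nat where n1: "1 / \<rho> < real n1" using reals_Archimedean2 by blast
  have "bl_close e (distr M borel (\<lambda>\<omega>. (T (grid n K (Suc i)) \<omega> - T (grid n K i) \<omega>) /\<^sub>R b n)) (distr N borel (X (1 / 2 ^ K)))"
    if n: "max n0 n1 \<le> n" and i: "i < 2 ^ K" for n i
  proof -
    define u where "u = real (grid n K (Suc i) - grid n K i) / real n"
    have "1 / \<rho> < real n" using n n1 by (meson less_le_trans max.boundedE of_nat_le_iff)
    moreover have "0 < 1 / \<rho>" using \<rho>(1) by simp
    ultimately have npos: "0 < real n" by linarith
    then have nr: "1 / real n < \<rho>" using \<open>1 / \<rho> < real n\<close> \<rho>(1) by (simp add: divide_less_eq mult.commute)
    have "u - 1 / 2 ^ K = (real (grid n K (Suc i) - grid n K i) - real n / 2 ^ K) / real n"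
      using npos by (simp add: u_def diff_divide_distrib)
    then have "\<bar>u - 1 / 2 ^ K\<bar> \<le> 1 / real n"
      using abs_grid_step[of n K i] npos by (simp add: divide_right_mono)
    then have "dist u (1 / 2 ^ K) < \<rho>" using nr by (simp add: dist_real_def)
    then have "\<bar>u powr (1 / \<alpha>) - (1 / 2 ^ K) powr (1 / \<alpha>)\<bar> \<le> \<eta>" using \<rho>(2)[of u] by (simp add: dist_real_def)
    then have 2: "bl_close (e / 2) (distr N borel (X u)) (distr N borel (X (1 / 2 ^ K)))"
      by (intro \<eta>(2)) (auto simp: u_def)
    have 1: "bl_close (e / 2) (distr M borel (\<lambda>\<omega>. (T (grid n K (Suc i)) \<omega> - T (grid n K i) \<omega>) /\<^sub>R b n)) (distr N borel (X u))"
      unfolding u_def using n i grid_le[of "Suc i" K n] mono_grid[of n K] by (intro n0) (auto simp: monoD)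
    from bl_close_trans[OF 1 2] show ?thesis by simp
  qed
  then show ?thesis by blast
qed

text \<open>On both sides the hull is the same function of 2^K independent increments, whose laws
  are pairwise close by \<open>grid_increment_close\<close>.\<close>

lemma grid_hull_tendsto:
  fixes g :: "'a set \<Rightarrow> real"
  assumes g1: "\<And>A. A \<in> convex_bodies0 \<Longrightarrow> \<bar>g A\<bar> \<le> 1"
    and g: "\<And>A B. A \<in> convex_bodies0 \<Longrightarrow> B \<in> convex_bodies0 \<Longrightarrow> \<bar>g A - g B\<bar> \<le> hausdorff_dist A B"
  shows "(\<lambda>n. \<integral>\<omega>. g (hull0 {..2^K} (\<lambda>i. T (grid n K i) \<omega> /\<^sub>R b n)) \<partial>M) \<longlonglongrightarrow> (\<integral>\<omega>. g (hull0 {..2^K} (\<lambda>i. X (real i / 2 ^ K) \<omega>)) \<partial>N)"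
proof (rule LIMSEQ_I)
  fix r :: real assume r: "0 < r"
  define m where "m = (2::nat) ^ K"
  have m0: "0 < m" by (simp add: m_def)
  \<comment> \<open>The m increments together contribute r/2, leaving a strict inequality.\<close>
  define e where "e = r / (2 * real m)"
  have e: "0 < e" using r m0 by (simp add: e_def)
  obtain n0 where n0: "\<And>n i. n0 \<le> n \<Longrightarrow> i < m \<Longrightarrow> bl_close e (distr M borel (\<lambda>\<omega>. (T (grid n K (Suc i)) \<omega> - T (grid n K i) \<omega>) /\<^sub>R b n)) (distr N borel (X (1 / 2 ^ K)))"
    using grid_increment_close[OF e, of K] unfolding m_def by blast
  define F where "F x = g (hull0 {..m} (\<lambda>i. \<Sum>l<i. x l))" for x :: "nat \<Rightarrow> 'a"
  define V where "V i \<omega> = X (real (Suc i) / 2 ^ K) \<omega> - X (real i / 2 ^ K) \<omega>" for i \<omega>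
  have Vm: "V i \<in> borel_measurable N" for i unfolding V_def by (intro borel_measurable_diff N.X_measurable) auto
  have tm: "mono (\<lambda>i. real i / 2 ^ K)" by (auto simp: mono_def divide_right_mono)
  have Vind: "N.indep_vars (\<lambda>_. borel) V {..<m}"
    unfolding V_def using N.indep_increments[OF _ tm, of m] by simp
  have Vlaw: "distr N borel (V i) = distr N borel (X (1 / 2 ^ K))" for i
    using N.distr_increment[of "real i / 2 ^ K" "real (Suc i) / 2 ^ K"]
    by (simp add: V_def[abs_def] divide_right_mono add_divide_distrib)
  have Vsum: "(\<Sum>l<i. V l \<omega>) = X (real i / 2 ^ K) \<omega>" if "\<omega> \<in> space N" for i \<omega>
    using sum_lessThan_telescope[of "\<lambda>i. X (real i / 2 ^ K) \<omega>" i] that by (simp add: V_def N.X_zero)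
  have "norm ((\<integral>\<omega>. g (hull0 {..2^K} (\<lambda>i. T (grid n K i) \<omega> /\<^sub>R b n)) \<partial>M) - (\<integral>\<omega>. g (hull0 {..2^K} (\<lambda>i. X (real i / 2 ^ K) \<omega>)) \<partial>N)) < r"
    if n: "n0 \<le> n" for n
  proof -
    define U where "U i \<omega> = (T (grid n K (Suc i)) \<omega> - T (grid n K i) \<omega>) /\<^sub>R b n" for i \<omega>
    have Um: "U i \<in> borel_measurable M" for i unfolding U_def by measurable
    have Uind: "indep_vars (\<lambda>_. borel) U {..<m}"
      unfolding U_def by (rule indep_vars_compose2[OF indep_vars_T_diff[OF mono_grid, of n K "{..<m}"], of "\<lambda>_ x. x /\<^sub>R b n"]) auto
    have Usum: "(\<Sum>l<i. U l \<omega>) = T (grid n K i) \<omega> /\<^sub>R b n" for i \<omega>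
      using sum_lessThan_telescope[of "\<lambda>i. T (grid n K i) \<omega>" i] by (simp add: U_def flip: scaleR_sum_right)
    have M1: "(\<integral>\<omega>. g (hull0 {..2^K} (\<lambda>i. T (grid n K i) \<omega> /\<^sub>R b n)) \<partial>M) = (\<integral>x. F x \<partial>(\<Pi>\<^sub>M i\<in>{..<m}. distr M borel (U i)))"
      using integral_hull0_partial_sums(1)[OF g Um Uind m0] by (simp add: Usum F_def m_def)
    have "(\<integral>\<omega>. g (hull0 {..2^K} (\<lambda>i. X (real i / 2 ^ K) \<omega>)) \<partial>N) = (\<integral>\<omega>. g (hull0 {..m} (\<lambda>i. \<Sum>l<i. V l \<omega>)) \<partial>N)"
      by (intro Bochner_Integration.integral_cong refl) (simp add: Vsum m_def)
    also have "\<dots> = (\<integral>x. F x \<partial>(\<Pi>\<^sub>M i\<in>{..<m}. distr N borel (V i)))"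
      using N.integral_hull0_partial_sums(1)[OF g Vm Vind m0] by (simp add: F_def)
    finally have N1: "(\<integral>\<omega>. g (hull0 {..2^K} (\<lambda>i. X (real i / 2 ^ K) \<omega>)) \<partial>N) = (\<integral>x. F x \<partial>(\<Pi>\<^sub>M i\<in>{..<m}. distr N borel (V i)))" .
    have "\<bar>(\<integral>x. F x \<partial>(\<Pi>\<^sub>M i\<in>{..<m}. distr M borel (U i))) - (\<integral>x. F x \<partial>(\<Pi>\<^sub>M i\<in>{..<m}. distr N borel (V i)))\<bar> \<le> (\<Sum>i<m. e)"
    proof (rule bl_close_PiM)
      show "prob_space (distr M borel (U i))" for i by (rule prob_space_distr[OF Um])
      show "prob_space (distr N borel (V i))" for i by (rule N.prob_space_distr[OF Vm])
      show "bl_close e (distr M borel (U i)) (distr N borel (V i))" if "i \<in> {..<m}" for i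
        unfolding Vlaw U_def[abs_def] using n0[OF n] that by simp
      show "F \<in> borel_measurable (\<Pi>\<^sub>M i\<in>{..<m}. borel)"
        unfolding F_def by (rule integral_hull0_partial_sums(2)[OF g Um Uind m0])
      show "\<bar>F x\<bar> \<le> 1" for x unfolding F_def by (intro g1 hull0_in_convex_bodies0) simp
      show "\<bar>F (x(i := u)) - F (x(i := v))\<bar> \<le> norm (u - v)" for x i u v
        unfolding F_def by (rule lipschitz_hull0_partial_sums[OF g])
    qed auto
    also have "(\<Sum>i<m. e) < r" using r m0 by (simp add: e_def)
    finally show ?thesis by (simp add: M1 N1)
  qed
  then show "\<exists>no. \<forall>n\<ge>no. norm ((\<integral>\<omega>. g (hull0 {..2^K} (\<lambda>i. T (grid n K i) \<omega> /\<^sub>R b n)) \<partial>M) - (\<integral>\<omega>. g (hull0 {..2^K} (\<lambda>i. X (real i / 2 ^ K) \<omega>)) \<partial>N)) < r"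
    by blast
qed

text \<open>The bad event of a block. A single large jump does not belong to it when the walk stays
  near the start before the jump and near the end after it.\<close>

definition off_grid :: "real \<Rightarrow> nat \<Rightarrow> nat \<Rightarrow> nat \<Rightarrow> 'w set" where
  "off_grid \<delta> n K i = {\<omega> \<in> space M. \<exists>k\<in>{grid n K i..grid n K (Suc i)}.
     \<delta> * b n < norm (T k \<omega> - T (grid n K i) \<omega>) \<and> \<delta> * b n < norm (T (grid n K (Suc i)) \<omega> - T k \<omega>)}"

lemma off_grid_measurable[measurable]: "off_grid \<delta> n K i \<in> sets M"
  unfolding off_grid_def by measurable

text \<open>The tail bound is taken at level \<delta>/4 because \<open>far_from_both_ends\<close>
  loses a factor 4; the steps of the grid have the length that \<open>increment_tail\<close>
  admits.\<close>

lemma prob_off_grid: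
  assumes \<delta>: "0 < \<delta>"
  shows "\<exists>C>0. \<forall>K\<ge>1. C / 2 ^ K \<le> 1 / 2 \<longrightarrow> (\<exists>n0. \<forall>n\<ge>n0. \<forall>i<2^K. prob (off_grid \<delta> n K i) \<le> 4 * (C / 2 ^ K)\<^sup>2)"
proof -
  have "0 < \<delta> / 4" using \<delta> by simp
  from increment_tail[OF this] obtain C where C: "0 < C" and tail: "\<forall>K\<ge>1. \<exists>n0. \<forall>n\<ge>n0. \<forall>k\<le>n. \<forall>j\<le>k. real (k - j) \<le> real n / 2 ^ K + 1 \<longrightarrow>
    prob {\<omega> \<in> space M. \<delta> / 4 * b n < norm (T k \<omega> - T j \<omega>)} \<le> C / 2 ^ K" by blast
  have "\<exists>n0. \<forall>n\<ge>n0. \<forall>i<2^K. prob (off_grid \<delta> n K i) \<le> 4 * (C / 2 ^ K)\<^sup>2" if K: "1 \<le> K" "C / 2 ^ K \<le> 1 / 2" for K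
  proof -
    obtain n0 where n0: "\<And>n k j. n0 \<le> n \<Longrightarrow> k \<le> n \<Longrightarrow> j \<le> k \<Longrightarrow> real (k - j) \<le> real n / 2 ^ K + 1 \<Longrightarrow>
      prob {\<omega> \<in> space M. \<delta> / 4 * b n < norm (T k \<omega> - T j \<omega>)} \<le> C / 2 ^ K" using tail K(1) by blast
    have "prob (off_grid \<delta> n K i) \<le> 4 * (C / 2 ^ K)\<^sup>2" if n: "max n0 1 \<le> n" and i: "i < 2 ^ K" for n i
    proof -
      have bn: "0 < b n" using n b(2)[of n] by simp
      have "prob {\<omega> \<in> space M. \<exists>k\<in>{grid n K i..grid n K (Suc i)}. 4 * (\<delta> / 4 * b n) < norm (T k \<omega> - T (grid n K i) \<omega>) \<and>
          4 * (\<delta> / 4 * b n) < norm (T (grid n K (Suc i)) \<omega> - T k \<omega>)} \<le> 4 * (C / 2 ^ K)\<^sup>2"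
      proof (rule far_from_both_ends[OF _ _ K(2)])
        show "grid n K i \<le> grid n K (Suc i)" using mono_grid by (simp add: monoD)
        show "0 \<le> \<delta> / 4 * b n" using \<delta> bn by simp
        fix k l assume kl: "grid n K i \<le> k" "k \<le> l" "l \<le> grid n K (Suc i)"
        have "real (l - k) \<le> real (grid n K (Suc i) - grid n K i)" using kl by (simp add: diff_le_mono2 le_diff_conv)
        also have "\<dots> \<le> real n / 2 ^ K + 1" using abs_grid_step[of n K i] by linarith
        finally show "prob {\<omega> \<in> space M. \<delta> / 4 * b n < norm (T l \<omega> - T k \<omega>)} \<le> C / 2 ^ K"
          using n kl grid_le[of "Suc i" K n] i by (intro n0) auto
      qed
      then show ?thesis by (simp add: off_grid_def)
    qed
    then show ?thesis by blast
  qed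
  with C show ?thesis by blast
qed

text \<open>Outside the bad events each value of the walk is near the value at an end of its block,
  and conversely the grid values are values of the walk.\<close>

lemma hausdorff_dist_grid_hull:
  assumes \<delta>: "0 < \<delta>" and n: "1 \<le> n" and \<omega>: "\<omega> \<in> space M" "\<And>i. i < 2 ^ K \<Longrightarrow> \<omega> \<notin> off_grid \<delta> n K i"
  shows "hausdorff_dist (hull0 {..n} (\<lambda>k. T k \<omega> /\<^sub>R b n)) (hull0 {..2^K} (\<lambda>i. T (grid n K i) \<omega> /\<^sub>R b n)) \<le> \<delta>"
proof (rule hausdorff_dist_hull0_le)
  have bn: "0 < b n" using b(2)[OF n] .
  have scale: "norm (x /\<^sub>R b n - y /\<^sub>R b n) \<le> \<delta>" if "norm (x - y) \<le> \<delta> * b n" for x y :: 'a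
  proof -
    have "norm (x /\<^sub>R b n - y /\<^sub>R b n) = norm (x - y) / b n"
      using bn by (simp add: divide_inverse mult.commute flip: scaleR_diff_right)
    then show ?thesis using that bn by (simp add: divide_le_eq)
  qed
  show "\<exists>i\<in>{..2^K}. norm (T k \<omega> /\<^sub>R b n - T (grid n K i) \<omega> /\<^sub>R b n) \<le> \<delta>" if k: "k \<in> {..n}" for k
  proof -
    have "Suc (2 ^ K - 1) = 2 ^ K" by simp
    then obtain i where i: "i \<le> 2 ^ K - 1" "grid n K i \<le> k" "k \<le> grid n K (Suc i)"
      using exists_covering_block[of "grid n K" k "2 ^ K - 1"] k by auto
    then have i2: "i < 2 ^ K" by (metis \<open>Suc (2 ^ K - 1) = 2 ^ K\<close> less_Suc_eq_le)
    have "norm (T k \<omega> - T (grid n K i) \<omega>) \<le> \<delta> * b n \<or> norm (T k \<omega> - T (grid n K (Suc i)) \<omega>) \<le> \<delta> * b n"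
      using \<omega>(2)[OF i2] \<omega>(1) i by (force simp: off_grid_def not_less norm_minus_commute)
    then show ?thesis
    proof
      assume "norm (T k \<omega> - T (grid n K i) \<omega>) \<le> \<delta> * b n"
      then show ?thesis using i2 scale by (intro bexI[of _ i]) auto
    next
      assume "norm (T k \<omega> - T (grid n K (Suc i)) \<omega>) \<le> \<delta> * b n"
      then show ?thesis using i2 scale by (intro bexI[of _ "Suc i"]) auto
    qed
  qed
  show "\<exists>k\<in>{..n}. norm (T k \<omega> /\<^sub>R b n - T (grid n K i) \<omega> /\<^sub>R b n) \<le> \<delta>" if "i \<in> {..2^K}" for i
    using that grid_le[of i K n] \<delta> by (intro bexI[of _ "grid n K i"]) auto
qed (use \<delta> in auto)

lemma hull_tendsto:
  fixes g :: "'a set \<Rightarrow> real"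
  assumes g1: "\<And>A. A \<in> convex_bodies0 \<Longrightarrow> \<bar>g A\<bar> \<le> 1"
    and g: "\<And>A B. A \<in> convex_bodies0 \<Longrightarrow> B \<in> convex_bodies0 \<Longrightarrow> \<bar>g A - g B\<bar> \<le> hausdorff_dist A B"
  shows "(\<lambda>n. \<integral>\<omega>. g (hull0 {..n} (\<lambda>k. T k \<omega> /\<^sub>R b n)) \<partial>M) \<longlonglongrightarrow> (\<integral>\<omega>. g (path_hull X \<omega>) \<partial>N)"
proof (rule LIMSEQ_I)
  fix r :: real assume r: "0 < r"
  \<comment> \<open>Three errors: replacing the walk by the grid costs less than 2 \<delta>, the
    limit along the grid less than \<delta>, and the dyadic approximation of the path hull less than
    \<delta>.\<close>
  define \<delta> where "\<delta> = r / 4"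
  have \<delta>: "0 < \<delta>" using r by (simp add: \<delta>_def)
  obtain C where C: "0 < C" "\<And>K. 1 \<le> K \<Longrightarrow> C / 2 ^ K \<le> 1 / 2 \<Longrightarrow> \<exists>n0. \<forall>n\<ge>n0. \<forall>i<2^K. prob (off_grid \<delta> n K i) \<le> 4 * (C / 2 ^ K)\<^sup>2"
    using prob_off_grid[OF \<delta>] by blast
  have "(\<lambda>K. \<integral>\<omega>. g (hull0 {..2^K} (\<lambda>i. X (real i / 2 ^ K) \<omega>)) \<partial>N) \<longlonglongrightarrow> (\<integral>\<omega>. g (path_hull X \<omega>) \<partial>N)"
  proof (rule integral_dominated_convergence[where w = "\<lambda>_. 1"])
    show "(\<lambda>\<omega>. g (path_hull X \<omega>)) \<in> borel_measurable N"
      by (rule measurable_compose[OF N.measurable_path_hull measurable_continuous_map_borel_of[OF hausdorff.lipschitz_continuous_map[of g 1]]]) (use g in auto)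
    show "(\<lambda>\<omega>. g (hull0 {..2^K} (\<lambda>i. X (real i / 2 ^ K) \<omega>))) \<in> borel_measurable N" for K
      by (rule borel_measurable_lipschitz_hull0) (auto intro: N.X_measurable g)
    show "AE \<omega> in N. (\<lambda>K. g (hull0 {..2^K} (\<lambda>i. X (real i / 2 ^ K) \<omega>))) \<longlonglongrightarrow> g (path_hull X \<omega>)"
      by (intro AE_I2 hausdorff.lipschitz_tendsto[OF g])
         (auto intro: hull0_in_convex_bodies0 N.path_hull_in_convex_bodies0 N.dyadic_hull_tendsto)
    show "AE \<omega> in N. norm (g (hull0 {..2^K} (\<lambda>i. X (real i / 2 ^ K) \<omega>))) \<le> 1" for K
      using g1[OF hull0_in_convex_bodies0] by auto
  qed simp
  from tendstoD[OF this \<delta>]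
  have "eventually (\<lambda>K. \<bar>(\<integral>\<omega>. g (hull0 {..2^K} (\<lambda>i. X (real i / 2 ^ K) \<omega>)) \<partial>N) - (\<integral>\<omega>. g (path_hull X \<omega>) \<partial>N)\<bar> < \<delta>) sequentially"
    by (simp only: dist_real_def)
  moreover have "(\<lambda>K. C / 2 ^ K) \<longlonglongrightarrow> 0" by real_asymp
  then have "eventually (\<lambda>K. C / 2 ^ K < 1 / 2) sequentially" by (rule order_tendstoD) simp
  \<comment> \<open>The 2^K blocks of probability at most 4 (C / 2^K)^2 sum to 4 C^2 / 2^K, and on
    the bad event two values of the test function differ by at most 2.\<close>
  moreover have "(\<lambda>K::nat. 8 * C\<^sup>2 / 2 ^ K) \<longlonglongrightarrow> 0" by real_asymp
  then have "eventually (\<lambda>K::nat. 8 * C\<^sup>2 / 2 ^ K < \<delta>) sequentially" using \<delta> by (rule order_tendstoD)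
  moreover have "eventually (\<lambda>K::nat. 1 \<le> K) sequentially" by (rule eventually_ge_at_top)
  ultimately have "eventually (\<lambda>K. \<bar>(\<integral>\<omega>. g (hull0 {..2^K} (\<lambda>i. X (real i / 2 ^ K) \<omega>)) \<partial>N) - (\<integral>\<omega>. g (path_hull X \<omega>) \<partial>N)\<bar> < \<delta> \<and>
      C / 2 ^ K < 1 / 2 \<and> 8 * C\<^sup>2 / 2 ^ K < \<delta> \<and> 1 \<le> K) sequentially"
    by eventually_elim auto
  then obtain K where K: "\<bar>(\<integral>\<omega>. g (hull0 {..2^K} (\<lambda>i. X (real i / 2 ^ K) \<omega>)) \<partial>N) - (\<integral>\<omega>. g (path_hull X \<omega>) \<partial>N)\<bar> < \<delta>"
      "C / 2 ^ K \<le> 1 / 2" "8 * C\<^sup>2 / 2 ^ K < \<delta>" "1 \<le> K"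
    by (auto simp: eventually_sequentially intro: less_imp_le)
  obtain n0 where n0: "\<And>n i. n0 \<le> n \<Longrightarrow> i < 2 ^ K \<Longrightarrow> prob (off_grid \<delta> n K i) \<le> 4 * (C / 2 ^ K)\<^sup>2"
    using C(2)[OF K(4,2)] by blast
  have "eventually (\<lambda>n. \<bar>(\<integral>\<omega>. g (hull0 {..2^K} (\<lambda>i. T (grid n K i) \<omega> /\<^sub>R b n)) \<partial>M) - (\<integral>\<omega>. g (hull0 {..2^K} (\<lambda>i. X (real i / 2 ^ K) \<omega>)) \<partial>N)\<bar> < \<delta>) sequentially"
    using tendstoD[OF grid_hull_tendsto[OF g1 g] \<delta>] by (auto simp: dist_real_def)
  then obtain n1 where n1: "\<And>n. n1 \<le> n \<Longrightarrow> \<bar>(\<integral>\<omega>. g (hull0 {..2^K} (\<lambda>i. T (grid n K i) \<omega> /\<^sub>R b n)) \<partial>M) - (\<integral>\<omega>. g (hull0 {..2^K} (\<lambda>i. X (real i / 2 ^ K) \<omega>)) \<partial>N)\<bar> < \<delta>"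
    by (auto simp: eventually_sequentially)
  have "norm ((\<integral>\<omega>. g (hull0 {..n} (\<lambda>k. T k \<omega> /\<^sub>R b n)) \<partial>M) - (\<integral>\<omega>. g (path_hull X \<omega>) \<partial>N)) < r"
    if n: "max 1 (max n0 n1) \<le> n" for n
  proof -
    define B where "B = (\<Union>i\<in>{..<2^K}. off_grid \<delta> n K i)"
    have [measurable]: "B \<in> sets M" unfolding B_def by measurable
    have "prob B \<le> (\<Sum>i\<in>{..<(2::nat)^K}. prob (off_grid \<delta> n K i))"
      unfolding B_def by (rule finite_measure_subadditive_finite) auto
    also have "\<dots> \<le> (\<Sum>i\<in>{..<(2::nat)^K}. 4 * (C / 2 ^ K)\<^sup>2)" using n0 n by (intro sum_mono) auto
    also have "\<dots> = 4 * C\<^sup>2 / 2 ^ K" by (simp add: power2_eq_square)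
    finally have PB: "2 * prob B < \<delta>" using K(3) by simp
    define h1 where "h1 \<omega> = g (hull0 {..n} (\<lambda>k. T k \<omega> /\<^sub>R b n))" for \<omega>
    define h2 where "h2 \<omega> = g (hull0 {..2^K} (\<lambda>i. T (grid n K i) \<omega> /\<^sub>R b n))" for \<omega>
    have hm: "h1 \<in> borel_measurable M" "h2 \<in> borel_measurable M"
      unfolding h1_def h2_def by (rule borel_measurable_lipschitz_hull0; auto intro: g)+
    have hb: "\<bar>h1 \<omega>\<bar> \<le> 1" "\<bar>h2 \<omega>\<bar> \<le> 1" for \<omega> unfolding h1_def h2_def by (intro g1 hull0_in_convex_bodies0; simp)+
    have hi: "integrable M h1" "integrable M h2" using hm hb by (auto intro: integrable_bounded[of _ 1])
    have "\<bar>(\<integral>\<omega>. h1 \<omega> \<partial>M) - (\<integral>\<omega>. h2 \<omega> \<partial>M)\<bar> = \<bar>\<integral>\<omega>. h1 \<omega> - h2 \<omega> \<partial>M\<bar>" using hi by simp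
    also have "\<dots> \<le> (\<integral>\<omega>. \<bar>h1 \<omega> - h2 \<omega>\<bar> \<partial>M)" using integral_abs_bound by blast
    also have "\<dots> \<le> (\<integral>\<omega>. \<delta> + 2 * indicator B \<omega> \<partial>M)"
    proof (rule integral_mono)
      fix \<omega> assume \<omega>: "\<omega> \<in> space M"
      show "\<bar>h1 \<omega> - h2 \<omega>\<bar> \<le> \<delta> + 2 * indicator B \<omega>"
      proof (cases "\<omega> \<in> B")
        case True
        then show ?thesis using hb[of \<omega>] \<delta> by auto
      next
        case False
        have "\<bar>h1 \<omega> - h2 \<omega>\<bar> \<le> hausdorff_dist (hull0 {..n} (\<lambda>k. T k \<omega> /\<^sub>R b n)) (hull0 {..2^K} (\<lambda>i. T (grid n K i) \<omega> /\<^sub>R b n))"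
          unfolding h1_def h2_def by (intro g hull0_in_convex_bodies0) auto
        also have "\<dots> \<le> \<delta>" using False n by (intro hausdorff_dist_grid_hull[OF \<delta> _ \<omega>]) (auto simp: B_def)
        finally show ?thesis using False by simp
      qed
    qed (use hi in \<open>auto simp: emeasure_eq_measure\<close>)
    also have "\<dots> = \<delta> + 2 * prob B" by (subst Bochner_Integration.integral_add) (auto simp: prob_space emeasure_eq_measure)
    finally have "\<bar>(\<integral>\<omega>. h1 \<omega> \<partial>M) - (\<integral>\<omega>. h2 \<omega> \<partial>M)\<bar> < 2 * \<delta>" using PB by simp
    moreover have "\<bar>(\<integral>\<omega>. h2 \<omega> \<partial>M) - (\<integral>\<omega>. g (hull0 {..2^K} (\<lambda>i. X (real i / 2 ^ K) \<omega>)) \<partial>N)\<bar> < \<delta>"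
      using n1[of n] n by (simp add: h2_def)
    moreover have "r = 4 * \<delta>" by (simp add: \<delta>_def)
    ultimately show ?thesis using K(1) unfolding h1_def[symmetric] real_norm_def by linarith
  qed
  then show "\<exists>no. \<forall>n\<ge>no. norm ((\<integral>\<omega>. g (hull0 {..n} (\<lambda>k. T k \<omega> /\<^sub>R b n)) \<partial>M) - (\<integral>\<omega>. g (path_hull X \<omega>) \<partial>N)) < r"
    by blast
qed

lemma hull_converges_in_distribution:
  "converges_in_distribution hausdorff_topology M (\<lambda>n \<omega>. hull0 {..n} (\<lambda>k. T k \<omega> /\<^sub>R b n)) N (path_hull X)"
proof (rule hausdorff.converges_in_distributionI[OF prob_space_axioms N.prob_space_axioms])
  show "(\<lambda>\<omega>. hull0 {..n} (\<lambda>k. T k \<omega> /\<^sub>R b n)) \<in> M \<rightarrow>\<^sub>M borel_of hausdorff_topology" for n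
    by (rule measurable_hull0) auto
qed (rule N.measurable_path_hull, rule hull_tendsto)

end

section \<open>Continuous functionals and the conclusion\<close>

lemma continuous_map_intrinsic_volume:
  assumes "m \<le> DIM('a)"
  shows "continuous_map hausdorff_topology euclidean (intrinsic_volume m :: 'a::euclidean_space set \<Rightarrow> real)"
  by (rule hausdorff.continuous_map_sequentiallyI, rule intrinsic_volume_tendsto[OF assms])
     (auto dest: convex_bodies0D)

lemma continuous_map_steiner_point:
  "continuous_map hausdorff_topology euclidean (steiner_point :: 'a::euclidean_space set \<Rightarrow> 'a)"
  by (rule hausdorff.continuous_map_sequentiallyI, rule steiner_point_tendsto) (auto dest: convex_bodies0D)

text \<open>The index \<open>0\<close> is treated separately because \<open>b 0\<close> is arbitrary.\<close>
lemma converges_in_distribution_cong: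
  fixes Z Z2 :: "nat \<Rightarrow> 'w \<Rightarrow> 'a::euclidean_space"
  assumes "converges_in_distribution euclidean M Z N Z'"
    and "\<And>n \<omega>. 1 \<le> n \<Longrightarrow> \<omega> \<in> space M \<Longrightarrow> Z2 n \<omega> = Z n \<omega>" and "Z2 0 \<in> borel_measurable M"
  shows "converges_in_distribution euclidean M Z2 N Z'"
  unfolding converges_in_distribution_def borel_of_euclidean
proof (intro conjI allI impI)
  show "Z2 n \<in> borel_measurable M" for n
  proof (cases "n = 0")
    case False
    have "Z n \<in> borel_measurable M" using assms(1) by (simp add: converges_in_distribution_def borel_of_euclidean)
    then show ?thesis using False assms(2)[of n] by (subst measurable_cong[of M "Z2 n" "Z n"]) auto
  qed (use assms(3) in simp)
  show "Z' \<in> borel_measurable N" using assms(1) by (simp add: converges_in_distribution_def borel_of_euclidean)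
  fix f :: "'a \<Rightarrow> real" assume "continuous_map euclidean euclideanreal f \<and> bounded (f ` topspace euclidean)"
  then have lim: "(\<lambda>n. \<integral>\<omega>. f (Z n \<omega>) \<partial>M) \<longlonglongrightarrow> (\<integral>\<omega>. f (Z' \<omega>) \<partial>N)"
    using assms(1) unfolding converges_in_distribution_def by blast
  have "eventually (\<lambda>n. (\<integral>\<omega>. f (Z n \<omega>) \<partial>M) = (\<integral>\<omega>. f (Z2 n \<omega>) \<partial>M)) sequentially"
    unfolding eventually_sequentially
    by (intro exI[of _ 1] allI impI Bochner_Integration.integral_cong) (auto simp: assms(2))
  from Lim_transform_eventually[OF lim this]
  show "(\<lambda>n. \<integral>\<omega>. f (Z2 n \<omega>) \<partial>M) \<longlonglongrightarrow> (\<integral>\<omega>. f (Z' \<omega>) \<partial>N)" .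
qed

theorem proposition2p1:
  fixes M :: "'w measure" and N :: "'v measure"
    and Y :: "nat \<Rightarrow> 'w \<Rightarrow> real ^ 'd" and X :: "real \<Rightarrow> 'v \<Rightarrow> real ^ 'd"
    and \<alpha> :: real and l :: "real \<Rightarrow> real" and b :: "nat \<Rightarrow> real"
  assumes "0 < \<alpha>" and "\<alpha> \<le> 2"
    and "prob_space M"
    and "prob_space.indep_vars M (\<lambda>_. borel) Y {1..}"
    and "\<forall>i\<ge>1. distr M borel (Y i) = distr M borel (Y 1)"
    and "stable_levy_process N \<alpha> X"
    and "slowly_varying l"
    and "\<forall>n\<ge>1. b n = real n powr (1 / \<alpha>) * l (real n) \<and> 0 < b n"
    and "converges_in_distribution euclidean
           M (\<lambda>n \<omega>. (walk Y n \<omega> - centering M \<alpha> b (Y 1) n) /\<^sub>R b n) N (X 1)"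
  shows "converges_in_distribution hausdorff_topology
           M (\<lambda>n \<omega>. (\<lambda>x. x /\<^sub>R b n) ` walk_hull M \<alpha> b Y n \<omega>) N (path_hull X) \<and>
         (\<forall>m\<in>{1..CARD('d)}. converges_in_distribution euclidean
           M (\<lambda>n \<omega>. intrinsic_volume m (walk_hull M \<alpha> b Y n \<omega>) / b n ^ m)
           N (\<lambda>\<omega>. intrinsic_volume m (path_hull X \<omega>))) \<and>
         converges_in_distribution euclidean
           M (\<lambda>n \<omega>. steiner_point (walk_hull M \<alpha> b Y n \<omega>) /\<^sub>R b n)
           N (\<lambda>\<omega>. steiner_point (path_hull X \<omega>))"
proof -
  define a where "a = centering M \<alpha> b (Y 1)"
  have N: "prob_space N" using assms(6) by (simp add: stable_levy_process_def levy_process_def)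
  interpret W: random_walk M Y a
  proof (intro random_walk.intro random_walk_axioms.intro)
    show "distr M borel (Y i) = distr M borel (Y 1)" if "1 \<le> i" for i using assms(5) that by blast
    show "a 0 = 0" by (simp add: a_def centering_def vec_eq_iff)
  qed fact+
  have T: "walk Y k \<omega> - a k = W.T k \<omega>" for k \<omega> by (simp add: W.T_def)
  interpret S: stable_walk M Y a \<alpha> l b N X
  proof (intro stable_walk.intro W.random_walk_axioms)
    show "regularly_varying_sequence \<alpha> l b"
      using assms(1,7,8) unfolding regularly_varying_sequence_def by blast
    show "stable_process N \<alpha> X"
      using assms(1,6) N by (simp add: stable_process_def stable_process_axioms_def)
    show "stable_walk_axioms M Y a b N X"
      using assms(9) unfolding stable_walk_axioms_def a_def[symmetric] T .
  qed
  define H where "H n \<omega> = hull0 {..n} (\<lambda>k. W.T k \<omega> /\<^sub>R b n)" for n \<omega>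
  have H0: "H n \<omega> \<in> convex_bodies0" for n \<omega> unfolding H_def by (rule hull0_in_convex_bodies0) simp
  have walk_hull: "walk_hull M \<alpha> b Y n \<omega> = convex hull ((\<lambda>k. W.T k \<omega>) ` {..n})" for n \<omega>
    by (simp add: walk_hull_def a_def[symmetric] T atLeast0AtMost del: One_nat_def)
  have image: "(\<lambda>x. x /\<^sub>R b n) ` walk_hull M \<alpha> b Y n \<omega> = H n \<omega>" for n \<omega>
  proof -
    \<comment> \<open>The walk starts at 0, so the origin adjoined in \<open>hull0\<close> is
      already among the points, also for \<open>n = 0\<close>.\<close>
    have "0 \<in> (\<lambda>k. W.T k \<omega> /\<^sub>R b n) ` {..n}" by (rule image_eqI[of _ _ 0]) auto
    then have "H n \<omega> = convex hull ((\<lambda>x. x /\<^sub>R b n) ` (\<lambda>k. W.T k \<omega>) ` {..n})"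
      by (simp add: H_def hull0_def insert_absorb image_image)
    then show ?thesis by (simp only: walk_hull convex_hull_scaling)
  qed
  have unscale: "walk_hull M \<alpha> b Y n \<omega> = (\<lambda>x. b n *\<^sub>R x) ` H n \<omega>" if "1 \<le> n" for n \<omega>
    using S.b(2)[OF that] by (simp add: image[symmetric] image_image)
  \<comment> \<open>At \<open>n = 0\<close> the scale \<open>b 0\<close> is arbitrary and rescaling
    may fail, but the body is constant, which gives the measurability required there.\<close>
  have zero: "walk_hull M \<alpha> b Y 0 \<omega> = {0}" for \<omega> by (simp add: walk_hull)
  have conv: "converges_in_distribution hausdorff_topology M H N (path_hull X)"
    using S.hull_converges_in_distribution by (simp add: H_def[abs_def])
  have "converges_in_distribution euclidean M (\<lambda>n \<omega>. intrinsic_volume m (walk_hull M \<alpha> b Y n \<omega>) / b n ^ m)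
      N (\<lambda>\<omega>. intrinsic_volume m (path_hull X \<omega>))" if "m \<in> {1..CARD('d)}" for m
  proof (rule converges_in_distribution_cong)
    have m: "m \<le> DIM(real ^ 'd)" using that by simp
    show "converges_in_distribution euclidean M (\<lambda>n \<omega>. intrinsic_volume m (H n \<omega>)) N (\<lambda>\<omega>. intrinsic_volume m (path_hull X \<omega>))"
      by (rule converges_in_distribution_continuous_map[OF conv continuous_map_intrinsic_volume[OF m]])
    show "intrinsic_volume m (walk_hull M \<alpha> b Y n \<omega>) / b n ^ m = intrinsic_volume m (H n \<omega>)" if "1 \<le> n" for n \<omega>
      using S.b(2)[OF that] intrinsic_volume_scaleR[OF m convex_bodies0D(1-3)[OF H0] S.b(2)[OF that], of n \<omega>]
      by (simp add: unscale[OF that])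
  qed (simp add: zero)
  moreover have "converges_in_distribution euclidean M (\<lambda>n \<omega>. steiner_point (walk_hull M \<alpha> b Y n \<omega>) /\<^sub>R b n)
      N (\<lambda>\<omega>. steiner_point (path_hull X \<omega>))"
  proof (rule converges_in_distribution_cong)
    show "converges_in_distribution euclidean M (\<lambda>n \<omega>. steiner_point (H n \<omega>)) N (\<lambda>\<omega>. steiner_point (path_hull X \<omega>))"
      by (rule converges_in_distribution_continuous_map[OF conv continuous_map_steiner_point])
    show "steiner_point (walk_hull M \<alpha> b Y n \<omega>) /\<^sub>R b n = steiner_point (H n \<omega>)" if "1 \<le> n" for n \<omega>
      using S.b(2)[OF that] steiner_point_scaleR[OF convex_bodies0D(1,3)[OF H0] S.b(2)[OF that], of n \<omega>]
      by (simp add: unscale[OF that])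
  qed (simp add: zero)
  ultimately show ?thesis using conv by (simp only: image) blast
qed

end
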